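(* Let $(M_{\rm ext}, g_{\rm ext})$ be a continuous extension of a smooth spacetime $(M,g)$ such that $M = I^+(\mathcal{O}, M_{\rm ext})$ for some point $\mathcal{O} \in \partial^- M$. Assume the following. (a) $(M,g)$ solves the Einstein equations with a perfect fluid $(u,\rho,p)$, i.e. $\mathrm{Ric} - \frac{1}{2}Rg = 8\pi\big[(\rho+p)\,u_*\otimes u_* + p\,g\big]$ on $M$. (b) All the integral curves of $u$ have past endpoint $\mathcal{O}$ within $M_{\rm ext}$. Moreover, each of these extended curves is a future directed timelike curve in $M_{\rm ext}$ on any compact domain; that is, if $\gamma\colon[0,b]\to M\cup\{\mathcal{O}\}$ is an integral curve of $u$ on $(0,b]$ with past endpoint $\gamma(0)=\mathcal{O}$, then $\gamma$ is a future directed timelike curve within $M_{\rm ext}$. (c) The Ricci tensor $\mathrm{Ric}$ of $(M,g)$, the function $\rho$, and the function $p$ all extend continuously to $M\cup\{\mathcal{O}\}$. (d$'$) For any neighborhood $U$ of $\mathcal{O}$ in $M_{\rm ext}$, there is a neighborhood $V\subset U$ of $\mathcal{O}$ such that $\partial^-M\cap V\subset J^+(\mathcal{O},V)$. Then the continuous extensions $\widetilde{\rho}$ and $\widetilde{p}$ of $\rho$ and $p$ to $M\cup\{\mathcal{O}\}$ satisfy $\widetilde{\rho}(\mathcal{O}) = -\widetilde{p}(\mathcal{O})$.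
   Context: Spacetimes. A spacetime $(M,g)$ is a smooth (connected, Hausdorff, second countable) manifold $M$ of dimension $n+1$ with a time-oriented Lorentzian metric $g$ of signature $(-,+,\dots,+)$. It is smooth (resp. continuous) if the components $g_{\mu\nu}=g(\partial_\mu,\partial_\nu)$ are smooth (resp. continuous) in any coordinates $(x^0,\dots,x^n)$; the manifold is always smooth. Curves. In a continuous spacetime, a future directed causal curve is a locally Lipschitz curve $\gamma$ (with respect to some complete smooth Riemannian metric) such that $\gamma'$ is future directed causal (in particular nonzero) almost everywhere. A future directed timelike curve $\gamma\colon[a,b]\to M$ is a Lipschitz curve that is future directed timelike almost everywhere and satisfies $g(\gamma',\gamma')<-\varepsilon$ almost everywhere for some $\varepsilon>0$. $I^+(q,M)$ is the set of endpoints of future directed timelike curves in $M$ starting at $q$. For an open set $V$ and $q\in V$, $J^+(q,V)$ is the set consisting of $q$ and all endpoints of future directed causal curves starting at $q$ and contained in $V$. Extensions. A continuous spacetime $(M_{\rm ext},g_{\rm ext})$ is a continuous extension of a smooth spacetime $(M,g)$ if $M$ and $M_{\rm ext}$ have the same dimension and there is an isometric embedding $(M,g)\hookrightarrow(M_{\rm ext},g_{\rm ext})$ preserving time orientations whose image is a proper subset; $M$ is identified with its image. $\partial M=\overline{M}\setminus M$ is the topological boundary of $M$ in $M_{\rm ext}$. The past boundary $\partial^-M$ is the set of $q\in\partial M$ for which there is a future directed timelike curve $\gamma\colon[a,b]\to M_{\rm ext}$ with $\gamma(a)=q$ and $\gamma((a,b])\subset M$. Perfect fluid. $u$ is a smooth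 future directed timelike vector field on $M$ with $g(u,u)=-1$, $\rho$ and $p$ are smooth real functions on $M$, $u_*=g(u,\cdot)$ is the one-form metrically equivalent to $u$, and $R$ is the scalar curvature of $g$. Past endpoint. An integral curve of $u$ (maximally extended to the past) has past endpoint $\mathcal{O}$ if, after translating its parameter so that its domain begins at $0$, it extends continuously to parameter $0$ with value $\mathcal{O}$ there. Continuous extension to $M\cup\{\mathcal{O}\}$. $M\cup\{\mathcal{O}\}$ carries the subspace topology from $M_{\rm ext}$. A smooth function $f$ on $M$ extends continuously to $M\cup\{\mathcal{O}\}$ if there is a continuous $\widetilde f\colon M\cup\{\mathcal{O}\}\to\mathbb{R}$ with $\widetilde f|_M=f$; $\widetilde f$ is called the continuous extension of $f$. A smooth tensor on $M$ extends continuously to $M\cup\{\mathcal{O}\}$ if there is a coordinate neighborhood $U\subset M_{\rm ext}$ of $\mathcal{O}$ such that each component of the tensor in the coordinates on $U$ extends continuously to $(U\cap M)\cup\{\mathcal{O}\}$ (this does not depend on the coordinates). *)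

theory Defs
  imports "HOL-Analysis.Analysis"
begin

section \<open>Smooth maps on open subsets of \<open>\<real>\<^sup>m\<close>\<close>

primrec Ck_on :: "nat \<Rightarrow> (real^'i) set \<Rightarrow> (real^'i \<Rightarrow> 'b::real_normed_vector) \<Rightarrow> bool" where
  "Ck_on 0 U f \<longleftrightarrow> continuous_on U f"
| "Ck_on (Suc k) U f \<longleftrightarrow> (\<forall>y\<in>U. f differentiable (at y)) \<and>
     (\<forall>v. Ck_on k U (\<lambda>y. frechet_derivative f (at y) v))"

text \<open>Meant for open \<open>U\<close> only: the derivatives are two-sided.\<close>

definition smooth_on :: "(real^'i) set \<Rightarrow> (real^'i \<Rightarrow> 'b::real_normed_vector) \<Rightarrow> bool" where
  "smooth_on U f \<longleftrightarrow> (\<forall>k. Ck_on k U f)"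

definition partial :: "'i \<Rightarrow> (real^'i \<Rightarrow> real) \<Rightarrow> real^'i \<Rightarrow> real" where
  "partial i f y = frechet_derivative f (at y) (axis i 1)"

section \<open>Manifolds and tensor fields\<close>

text \<open>A chart is a domain together with a coordinate map; the values of the map outside the
  domain are irrelevant. The dimension of the manifold is the cardinality of the index type.\<close>

type_synonym ('p, 'i) chart = "'p set \<times> ('p \<Rightarrow> real^'i)"

abbreviation cdom :: "('p, 'i::finite) chart \<Rightarrow> 'p set" where "cdom c \<equiv> fst c"
abbreviation crd :: "('p, 'i::finite) chart \<Rightarrow> 'p \<Rightarrow> real^'i" where "crd c \<equiv> snd c"

definition cinv :: "('p, 'i::finite) chart \<Rightarrow> real^'i \<Rightarrow> 'p" where
  "cinv c = inv_into (cdom c) (crd c)"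

definition is_chart :: "('p::topological_space, 'i::finite) chart \<Rightarrow> bool" where
  "is_chart c \<longleftrightarrow> open (cdom c) \<and> open (crd c ` cdom c) \<and>
     homeomorphism (cdom c) (crd c ` cdom c) (crd c) (cinv c)"

definition smoothly_compatible ::
  "('p::topological_space, 'i::finite) chart \<Rightarrow> ('p, 'i) chart \<Rightarrow> bool" where
  "smoothly_compatible c d \<longleftrightarrow>
     smooth_on (crd c ` (cdom c \<inter> cdom d)) (crd d \<circ> cinv c) \<and>
     smooth_on (crd d ` (cdom c \<inter> cdom d)) (crd c \<circ> cinv d)"

text \<open>The points of the manifold are those covered by the charts, an open subset of the
  ambient type, with the subspace topology.\<close>

definition points :: "('p, 'i::finite) chart set \<Rightarrow> 'p set" where
  "points A = (\<Union>c\<in>A. cdom c)"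

definition smooth_manifold ::
  "('p::{t2_space,second_countable_topology}, 'i::finite) chart set \<Rightarrow> bool" where
  "smooth_manifold A \<longleftrightarrow>
     (\<forall>c\<in>A. is_chart c) \<and> (\<forall>c\<in>A. \<forall>d\<in>A. smoothly_compatible c d) \<and>
     (\<forall>c. is_chart c \<and> cdom c \<subseteq> points A \<and> (\<forall>d\<in>A. smoothly_compatible c d) \<longrightarrow> c \<in> A)"

text \<open>The Jacobian matrix at \<open>x\<close> of a map \<open>f\<close> in the coordinates of \<open>c\<close> (source) and
  \<open>d\<close> (target).\<close>

definition jac :: "('p \<Rightarrow> 'q) \<Rightarrow> ('p, 'i::finite) chart \<Rightarrow> ('q, 'i) chart \<Rightarrow> 'p \<Rightarrow> real^'i^'i" where
  "jac f c d x = jacobian (crd d \<circ> f \<circ> cinv c) (at (crd c x))"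

text \<open>Tensor fields are given by their components in every chart, subject to the
  transformation law.\<close>

type_synonym ('p, 'i) vfield = "('p, 'i) chart \<Rightarrow> 'p \<Rightarrow> real^'i"
type_synonym ('p, 'i) tensor2 = "('p, 'i) chart \<Rightarrow> 'p \<Rightarrow> real^'i^'i"

definition vector_field :: "('p, 'i::finite) chart set \<Rightarrow> ('p, 'i) vfield \<Rightarrow> bool" where
  "vector_field A X \<longleftrightarrow>
     (\<forall>c\<in>A. \<forall>d\<in>A. \<forall>x\<in>cdom c \<inter> cdom d. X d x = jac id c d x *v X c x)"

definition covariant2_tensor :: "('p, 'i::finite) chart set \<Rightarrow> ('p, 'i) tensor2 \<Rightarrow> bool" where
  "covariant2_tensor A B \<longleftrightarrow>
     (\<forall>c\<in>A. \<forall>d\<in>A. \<forall>x\<in>cdom c \<inter> cdom d.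
        B c x = transpose (jac id c d x) ** B d x ** jac id c d x)"

text \<open>Both apply to vector fields and to 2-tensors.\<close>

definition continuous_components ::
  "('p::topological_space, 'i::finite) chart set \<Rightarrow>
    (('p, 'i) chart \<Rightarrow> 'p \<Rightarrow> 'b::real_normed_vector) \<Rightarrow> bool" where
  "continuous_components A B \<longleftrightarrow> (\<forall>c\<in>A. continuous_on (cdom c) (B c))"

definition smooth_components ::
  "('p, 'i::finite) chart set \<Rightarrow> (('p, 'i) chart \<Rightarrow> 'p \<Rightarrow> 'b::real_normed_vector) \<Rightarrow> bool" where
  "smooth_components A B \<longleftrightarrow> (\<forall>c\<in>A. smooth_on (crd c ` cdom c) (B c \<circ> cinv c))"

definition smooth_function :: "('p, 'i::finite) chart set \<Rightarrow> ('p \<Rightarrow> real) \<Rightarrow> bool" where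
  "smooth_function A f \<longleftrightarrow> (\<forall>c\<in>A. smooth_on (crd c ` cdom c) (f \<circ> cinv c))"

definition bilin :: "real^'i^'i \<Rightarrow> real^'i \<Rightarrow> real^'i::finite \<Rightarrow> real" where
  "bilin B v w = v \<bullet> (B *v w)"

section \<open>Riemannian distance\<close>

definition riemannian_metric ::
  "('p, 'i::finite) chart set \<Rightarrow> ('p, 'i) tensor2 \<Rightarrow> bool" where
  "riemannian_metric A h \<longleftrightarrow> covariant2_tensor A h \<and> smooth_components A h \<and>
     (\<forall>c\<in>A. \<forall>x\<in>cdom c. transpose (h c x) = h c x \<and> (\<forall>v. v \<noteq> 0 \<longrightarrow> 0 < bilin (h c x) v v))"

definition C1_path ::
  "('p::topological_space, 'i::finite) chart set \<Rightarrow> (real \<Rightarrow> 'p) \<Rightarrow> bool" where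
  "C1_path A \<gamma> \<longleftrightarrow> continuous_on {0..1} \<gamma> \<and> \<gamma> ` {0..1} \<subseteq> points A \<and>
     (\<forall>c\<in>A. (\<forall>t\<in>{0..1}. \<gamma> t \<in> cdom c \<longrightarrow> (crd c \<circ> \<gamma>) differentiable (at t within {0..1})) \<and>
        continuous_on {t\<in>{0..1}. \<gamma> t \<in> cdom c}
          (\<lambda>t. vector_derivative (crd c \<circ> \<gamma>) (at t within {0..1})))"

text \<open>The choice of the chart is immaterial by the transformation law.\<close>

definition chart_at :: "('p, 'i::finite) chart set \<Rightarrow> 'p \<Rightarrow> ('p, 'i) chart" where
  "chart_at A x = (SOME c. c \<in> A \<and> x \<in> cdom c)"

definition speed ::
  "('p, 'i::finite) chart set \<Rightarrow> ('p, 'i) tensor2 \<Rightarrow> (real \<Rightarrow> 'p) \<Rightarrow> real \<Rightarrow> real" where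
  "speed A h \<gamma> t =
     (let c = chart_at A (\<gamma> t); v = vector_derivative (crd c \<circ> \<gamma>) (at t within {0..1})
      in sqrt (bilin (h c (\<gamma> t)) v v))"

definition riemannian_dist ::
  "('p::topological_space, 'i::finite) chart set \<Rightarrow> ('p, 'i) tensor2 \<Rightarrow> 'p \<Rightarrow> 'p \<Rightarrow> real" where
  "riemannian_dist A h x y =
     Inf {integral {0..1} (speed A h \<gamma>) | \<gamma>. C1_path A \<gamma> \<and> \<gamma> 0 = x \<and> \<gamma> 1 = y}"

definition complete_riemannian_metric ::
  "('p::topological_space, 'i::finite) chart set \<Rightarrow> ('p, 'i) tensor2 \<Rightarrow> bool" where
  "complete_riemannian_metric A h \<longleftrightarrow> riemannian_metric A h \<and>
     (\<forall>X. (\<forall>n::nat. X n \<in> points A) \<and>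
          (\<forall>\<epsilon>>0. \<exists>N. \<forall>m\<ge>N. \<forall>n\<ge>N. riemannian_dist A h (X m) (X n) < \<epsilon>) \<longrightarrow>
          (\<exists>x\<in>points A. (\<lambda>n. riemannian_dist A h (X n) x) \<longlonglongrightarrow> 0))"

section \<open>Spacetimes\<close>

definition lorentzian_form :: "real^'i^'i::finite \<Rightarrow> bool" where
  "lorentzian_form B \<longleftrightarrow> transpose B = B \<and>
     (\<exists>(P::real^'i^'i) k. invertible P \<and>
        transpose P ** B ** P = (\<chi> i j. if i = j then (if i = k then -1 else 1) else 0))"

text \<open>The time orientation is represented by a continuous timelike vector field
  (the third component), which is future directed by definition.\<close>

record ('p, 'i) spacetime =
  atlas :: "('p, 'i) chart set"
  gmetric :: "('p, 'i) tensor2"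
  tfield :: "('p, 'i) vfield"

definition carrier :: "('p, 'i::finite) spacetime \<Rightarrow> 'p set" where
  "carrier M = points (atlas M)"

definition future_causal ::
  "('p, 'i::finite) spacetime \<Rightarrow> ('p, 'i) chart \<Rightarrow> 'p \<Rightarrow> real^'i \<Rightarrow> bool" where
  "future_causal M c x v \<longleftrightarrow> v \<noteq> 0 \<and> bilin (gmetric M c x) v v \<le> 0 \<and>
     bilin (gmetric M c x) v (tfield M c x) < 0"

definition future_timelike ::
  "('p, 'i::finite) spacetime \<Rightarrow> ('p, 'i) chart \<Rightarrow> 'p \<Rightarrow> real^'i \<Rightarrow> bool" where
  "future_timelike M c x v \<longleftrightarrow> bilin (gmetric M c x) v v < 0 \<and>
     bilin (gmetric M c x) v (tfield M c x) < 0"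

definition continuous_spacetime ::
  "('p::{t2_space,second_countable_topology}, 'i::finite) spacetime \<Rightarrow> bool" where
  "continuous_spacetime M \<longleftrightarrow>
     smooth_manifold (atlas M) \<and> connected (carrier M) \<and>
     covariant2_tensor (atlas M) (gmetric M) \<and> continuous_components (atlas M) (gmetric M) \<and>
     (\<forall>c\<in>atlas M. \<forall>x\<in>cdom c. lorentzian_form (gmetric M c x)) \<and>
     vector_field (atlas M) (tfield M) \<and> continuous_components (atlas M) (tfield M) \<and>
     (\<forall>c\<in>atlas M. \<forall>x\<in>cdom c. bilin (gmetric M c x) (tfield M c x) (tfield M c x) < 0)"

definition smooth_spacetime ::
  "('p::{t2_space,second_countable_topology}, 'i::finite) spacetime \<Rightarrow> bool" where
  "smooth_spacetime M \<longleftrightarrow> continuous_spacetime M \<and> smooth_components (atlas M) (gmetric M)"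

section \<open>Causal and timelike curves\<close>

text \<open>\<open>P c x v\<close> holds for the velocity \<open>v\<close>, expressed in every chart \<open>c\<close> around
  \<open>x = \<gamma> t\<close>, at almost every \<open>t\<close> in \<open>{a..b}\<close>; in particular \<open>\<gamma>\<close> is differentiable there.\<close>

definition ae_velocity ::
  "('p, 'i::finite) spacetime \<Rightarrow> (real \<Rightarrow> 'p) \<Rightarrow> real \<Rightarrow> real \<Rightarrow>
    (('p, 'i) chart \<Rightarrow> 'p \<Rightarrow> real^'i \<Rightarrow> bool) \<Rightarrow> bool" where
  "ae_velocity M \<gamma> a b P \<longleftrightarrow>
     (AE t in lebesgue. t \<in> {a..b} \<longrightarrow>
        (\<forall>c\<in>atlas M. \<gamma> t \<in> cdom c \<longrightarrow>
           (\<exists>v. ((crd c \<circ> \<gamma>) has_vector_derivative v) (at t within {a..b}) \<and> P c (\<gamma> t) v)))"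

definition causal_curve ::
  "('p::topological_space, 'i::finite) spacetime \<Rightarrow> (real \<Rightarrow> 'p) \<Rightarrow> real \<Rightarrow> real \<Rightarrow> bool" where
  "causal_curve M \<gamma> a b \<longleftrightarrow> a < b \<and> \<gamma> ` {a..b} \<subseteq> carrier M \<and>
     (\<exists>h. complete_riemannian_metric (atlas M) h \<and>
        (\<forall>t\<in>{a..b}. \<exists>\<delta>>0. \<exists>L. \<forall>r\<in>{a..b} \<inter> ball t \<delta>. \<forall>s\<in>{a..b} \<inter> ball t \<delta>.
           riemannian_dist (atlas M) h (\<gamma> r) (\<gamma> s) \<le> L * \<bar>r - s\<bar>)) \<and>
     ae_velocity M \<gamma> a b (future_causal M)"

definition timelike_curve ::
  "('p::topological_space, 'i::finite) spacetime \<Rightarrow> (real \<Rightarrow> 'p) \<Rightarrow> real \<Rightarrow> real \<Rightarrow> bool" where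
  "timelike_curve M \<gamma> a b \<longleftrightarrow> a < b \<and> \<gamma> ` {a..b} \<subseteq> carrier M \<and>
     (\<exists>h. complete_riemannian_metric (atlas M) h \<and>
        (\<exists>L. \<forall>r\<in>{a..b}. \<forall>s\<in>{a..b}.
           riemannian_dist (atlas M) h (\<gamma> r) (\<gamma> s) \<le> L * \<bar>r - s\<bar>)) \<and>
     ae_velocity M \<gamma> a b (future_timelike M) \<and>
     (\<exists>\<epsilon>>0. ae_velocity M \<gamma> a b (\<lambda>c x v. bilin (gmetric M c x) v v < - \<epsilon>))"

definition chronological_future ::
  "('p::topological_space, 'i::finite) spacetime \<Rightarrow> 'p \<Rightarrow> 'p set" where
  "chronological_future M q = {\<gamma> b | \<gamma> a b. timelike_curve M \<gamma> a b \<and> \<gamma> a = q}"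

definition causal_future_in ::
  "('p::topological_space, 'i::finite) spacetime \<Rightarrow> 'p \<Rightarrow> 'p set \<Rightarrow> 'p set" where
  "causal_future_in M q V =
     insert q {\<gamma> b | \<gamma> a b. causal_curve M \<gamma> a b \<and> \<gamma> a = q \<and> \<gamma> ` {a..b} \<subseteq> V}"

section \<open>Extensions\<close>

definition isometric_embedding ::
  "('p::topological_space, 'i::finite) spacetime \<Rightarrow> ('q::topological_space, 'i) spacetime \<Rightarrow>
    ('p \<Rightarrow> 'q) \<Rightarrow> bool" where
  "isometric_embedding M N f \<longleftrightarrow>
     f ` carrier M \<subseteq> carrier N \<and> (\<exists>k. homeomorphism (carrier M) (f ` carrier M) f k) \<and>
     (\<forall>c\<in>atlas M. \<forall>d\<in>atlas N.
        smooth_on (crd c ` (cdom c \<inter> f -` cdom d)) (crd d \<circ> f \<circ> cinv c) \<and>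
        (\<forall>x\<in>cdom c \<inter> f -` cdom d.
           inj ((*v) (jac f c d x)) \<and>
           gmetric M c x = transpose (jac f c d x) ** gmetric N d (f x) ** jac f c d x))"

definition preserves_time_orientation ::
  "('p, 'i::finite) spacetime \<Rightarrow> ('q, 'i) spacetime \<Rightarrow> ('p \<Rightarrow> 'q) \<Rightarrow> bool" where
  "preserves_time_orientation M N f \<longleftrightarrow>
     (\<forall>c\<in>atlas M. \<forall>d\<in>atlas N. \<forall>x\<in>cdom c \<inter> f -` cdom d. \<forall>v.
        future_timelike M c x v \<longrightarrow> future_timelike N d (f x) (jac f c d x *v v))"

text \<open>\<open>M\<close> is identified with its image, so the embedding is the inclusion map.\<close>

definition continuous_extension ::
  "('p::{t2_space,second_countable_topology}, 'i::finite) spacetime \<Rightarrow>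
    ('p, 'i) spacetime \<Rightarrow> bool" where
  "continuous_extension M M\<^sub>e \<longleftrightarrow>
     smooth_spacetime M \<and> continuous_spacetime M\<^sub>e \<and>
     isometric_embedding M M\<^sub>e id \<and> preserves_time_orientation M M\<^sub>e id \<and> carrier M \<subset> carrier M\<^sub>e"

definition boundary ::
  "('p::topological_space, 'i::finite) spacetime \<Rightarrow> ('p, 'i) spacetime \<Rightarrow> 'p set" where
  "boundary M M\<^sub>e = (closure (carrier M) \<inter> carrier M\<^sub>e) - carrier M"

definition past_boundary ::
  "('p::topological_space, 'i::finite) spacetime \<Rightarrow> ('p, 'i) spacetime \<Rightarrow> 'p set" where
  "past_boundary M M\<^sub>e = {q \<in> boundary M M\<^sub>e. \<exists>\<gamma> a b.
     timelike_curve M\<^sub>e \<gamma> a b \<and> \<gamma> a = q \<and> \<gamma> ` {a<..b} \<subseteq> carrier M}"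

section \<open>Curvature and perfect fluids\<close>

text \<open>Coordinate expressions; \<open>G\<close> is the matrix of metric components as a function of the
  coordinates. The sign convention for the Ricci tensor is the one for which round spheres
  have positive Ricci curvature.\<close>

definition christoffel ::
  "(real^'i \<Rightarrow> real^'i^'i) \<Rightarrow> 'i \<Rightarrow> 'i \<Rightarrow> 'i \<Rightarrow> real^'i::finite \<Rightarrow> real" where
  "christoffel G k i j y = (\<Sum>l\<in>UNIV. matrix_inv (G y) $ k $ l *
     (partial i (\<lambda>z. G z $ l $ j) y + partial j (\<lambda>z. G z $ i $ l) y
       - partial l (\<lambda>z. G z $ i $ j) y)) / 2"

definition ricci_coord ::
  "(real^'i \<Rightarrow> real^'i^'i) \<Rightarrow> real^'i::finite \<Rightarrow> real^'i^'i" where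
  "ricci_coord G y = (\<chi> i j.
     (\<Sum>k\<in>UNIV. partial k (christoffel G k i j) y) - (\<Sum>k\<in>UNIV. partial j (christoffel G k i k) y)
     + (\<Sum>k\<in>UNIV. \<Sum>l\<in>UNIV. christoffel G k k l y * christoffel G l i j y
          - christoffel G k j l y * christoffel G l i k y))"

definition ricci :: "('p, 'i::finite) spacetime \<Rightarrow> ('p, 'i) tensor2" where
  "ricci M c x = ricci_coord (gmetric M c \<circ> cinv c) (crd c x)"

definition scalar_curvature ::
  "('p, 'i::finite) spacetime \<Rightarrow> ('p, 'i) chart \<Rightarrow> 'p \<Rightarrow> real" where
  "scalar_curvature M c x =
     (\<Sum>i\<in>UNIV. \<Sum>j\<in>UNIV. matrix_inv (gmetric M c x) $ i $ j * ricci M c x $ i $ j)"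

definition fluid_data ::
  "('p, 'i::finite) spacetime \<Rightarrow> ('p, 'i) vfield \<Rightarrow> ('p \<Rightarrow> real) \<Rightarrow> ('p \<Rightarrow> real) \<Rightarrow> bool" where
  "fluid_data M u \<rho> p \<longleftrightarrow>
     vector_field (atlas M) u \<and> smooth_components (atlas M) u \<and>
     (\<forall>c\<in>atlas M. \<forall>x\<in>cdom c.
        future_timelike M c x (u c x) \<and> bilin (gmetric M c x) (u c x) (u c x) = -1) \<and>
     smooth_function (atlas M) \<rho> \<and> smooth_function (atlas M) p"

definition lower_index ::
  "('p, 'i::finite) spacetime \<Rightarrow> ('p, 'i) vfield \<Rightarrow> ('p, 'i) chart \<Rightarrow> 'p \<Rightarrow> real^'i" where
  "lower_index M u c x = gmetric M c x *v u c x"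

definition einstein_perfect_fluid ::
  "('p, 'i::finite) spacetime \<Rightarrow> ('p, 'i) vfield \<Rightarrow> ('p \<Rightarrow> real) \<Rightarrow> ('p \<Rightarrow> real) \<Rightarrow> bool" where
  "einstein_perfect_fluid M u \<rho> p \<longleftrightarrow>
     (\<forall>c\<in>atlas M. \<forall>x\<in>cdom c. \<forall>i j.
        ricci M c x $ i $ j - 1/2 * scalar_curvature M c x * gmetric M c x $ i $ j =
        8 * pi * ((\<rho> x + p x) * (lower_index M u c x $ i * lower_index M u c x $ j)
                  + p x * gmetric M c x $ i $ j))"

section \<open>Integral curves\<close>

definition integral_curve ::
  "('p, 'i::finite) spacetime \<Rightarrow> ('p, 'i) vfield \<Rightarrow> (real \<Rightarrow> 'p) \<Rightarrow> real set \<Rightarrow> bool" where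
  "integral_curve M u \<gamma> I \<longleftrightarrow> is_interval I \<and> interior I \<noteq> {} \<and> \<gamma> ` I \<subseteq> carrier M \<and>
     (\<forall>t\<in>I. \<forall>c\<in>atlas M. \<gamma> t \<in> cdom c \<longrightarrow>
        ((crd c \<circ> \<gamma>) has_vector_derivative u c (\<gamma> t)) (at t within I))"

definition past_maximal_integral_curve ::
  "('p, 'i::finite) spacetime \<Rightarrow> ('p, 'i) vfield \<Rightarrow> (real \<Rightarrow> 'p) \<Rightarrow> real set \<Rightarrow> bool" where
  "past_maximal_integral_curve M u \<gamma> I \<longleftrightarrow> integral_curve M u \<gamma> I \<and>
     \<not> (\<exists>\<sigma> J. integral_curve M u \<sigma> J \<and> I \<subseteq> J \<and> (\<forall>t\<in>I. \<sigma> t = \<gamma> t) \<and> (\<exists>s\<in>J. \<forall>t\<in>I. s < t))"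

text \<open>The domain \<open>I\<close> begins at \<open>a\<close> (not included in \<open>I\<close>), which is the parameter
  that is translated to \<open>0\<close>.\<close>

definition has_past_endpoint ::
  "(real \<Rightarrow> 'p::topological_space) \<Rightarrow> real set \<Rightarrow> 'p \<Rightarrow> bool" where
  "has_past_endpoint \<gamma> I q \<longleftrightarrow>
     (\<exists>a. (\<forall>t\<in>I. a < t) \<and> (\<forall>s>a. \<exists>t\<in>I. t < s) \<and> (\<gamma> \<longlongrightarrow> q) (at a within I))"

section \<open>Continuous extension to an additional point\<close>

definition function_extension ::
  "('p::topological_space, 'i::finite) spacetime \<Rightarrow> 'p \<Rightarrow> ('p \<Rightarrow> real) \<Rightarrow> ('p \<Rightarrow> real) \<Rightarrow> bool" where
  "function_extension M q f F \<longleftrightarrow>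
     continuous_on (insert q (carrier M)) F \<and> (\<forall>x\<in>carrier M. F x = f x)"

text \<open>For \<open>x\<close> in \<open>M\<close>, the matrix \<open>F x\<close> consists of the components of \<open>B\<close> at \<open>x\<close> in the
  coordinates \<open>c\<close> of the extension; the Jacobian relates them to the components in charts
  of \<open>M\<close>.\<close>

definition tensor2_extends ::
  "('p::topological_space, 'i::finite) spacetime \<Rightarrow> ('p, 'i) spacetime \<Rightarrow> 'p \<Rightarrow>
    ('p, 'i) tensor2 \<Rightarrow> bool" where
  "tensor2_extends M M\<^sub>e q B \<longleftrightarrow>
     (\<exists>c\<in>atlas M\<^sub>e. q \<in> cdom c \<and>
        (\<exists>F::'p \<Rightarrow> real^'i^'i.
           (\<forall>i j. continuous_on (insert q (cdom c \<inter> carrier M)) (\<lambda>x. F x $ i $ j)) \<and>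
           (\<forall>d\<in>atlas M. \<forall>x\<in>cdom d \<inter> cdom c.
              B d x = transpose (jac id d c x) ** F x ** jac id d c x)))"

end

theory Submission
  imports Defs
begin

text \<open>
  Suppose that \<open>\<rho> + p\<close> has a nonzero limit at \<open>\<O>\<close>. The trace of \<open>Ric = 8\<pi>(\<rho> + p) u\<^sub>* \<otimes> u\<^sub>* + \<mu> g\<close>
  expresses \<open>\<mu>\<close> by quantities that converge at \<open>\<O>\<close>, so \<open>u\<^sub>* \<otimes> u\<^sub>*\<close> converges and, \<open>u\<close> being future
  directed, \<open>u\<close> itself converges to a timelike vector \<open>e\<close>. In coordinates, all flow lines near \<open>\<O>\<close> are
  then almost parallel to \<open>e\<close>. Take a point \<open>x\<close> of \<open>I\<^sup>+(\<O>, M\<^sub>e) = M\<close> very close to \<open>\<O>\<close>, reached from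
  \<open>\<O>\<close> along a straight segment in a timelike direction different from \<open>e\<close>. The flow line through \<open>x\<close>
  cannot run back to \<open>\<O>\<close> inside a small coordinate ball, hence it leaves the ball, and it does so in
  the timelike past of \<open>\<O>\<close>. The exit point is in \<open>M\<close>, hence in the future of \<open>\<O>\<close>. So \<open>\<O>\<close> is in its own
  timelike future, which is \<open>M\<close>, contradicting \<open>\<O> \<in> \<partial>M\<close>.
\<close>

text \<open>Both fates of the flow line rest on one gap of scales. Near \<open>\<O>\<close> all
  vectors within \<open>k\<close> of \<open>e\<close> are uniformly timelike, whereas the fluid
  velocity deviates from \<open>e\<close> by at most \<open>k / 4\<close>. The initial segment uses
  the full deviation \<open>k\<close>, orthogonally to \<open>e\<close>, which is where dimension at
  least two enters. A flow line from \<open>\<O>\<close> to its endpoint inside the ball would have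
  mean velocity within \<open>k / 4\<close> of \<open>e\<close> and cannot produce this
  displacement. If the line leaves the ball, the time it needs is bounded below independently of the
  starting point, so starting close enough to \<open>\<O>\<close> costs at most the remaining
  \<open>3/4 * k\<close> when the endpoint is moved to \<open>\<O>\<close>. The bulk of the work has
  another origin. Timelike curves are Lipschitz for the distance of some complete Riemannian metric.
  Prolonging a curve by a straight segment therefore needs the triangle inequality for an infimum of
  lengths of \<open>C1_path\<close>s, hence a concatenation of paths without corners. The complete
  metric is always taken from a timelike curve that is already given.\<close>

section \<open>Charts\<close>

lemma smooth_on_differentiable:
  "smooth_on U f \<Longrightarrow> y \<in> U \<Longrightarrow> f differentiable (at y)"
  unfolding smooth_on_def by (metis Ck_on.simps(2))

lemma smooth_on_continuous: "smooth_on U f \<Longrightarrow> continuous_on U f"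
  unfolding smooth_on_def by (metis Ck_on.simps(1))

lemma smooth_on_frechet_continuous:
  "smooth_on U f \<Longrightarrow> continuous_on U (\<lambda>y. frechet_derivative f (at y) v)"
  unfolding smooth_on_def by (metis Ck_on.simps)

lemma chart_inv:
  assumes "is_chart c"
  shows "x \<in> cdom c \<Longrightarrow> cinv c (crd c x) = x"
    and "y \<in> crd c ` cdom c \<Longrightarrow> crd c (cinv c y) = y"
    and "y \<in> crd c ` cdom c \<Longrightarrow> cinv c y \<in> cdom c"
    and "continuous_on (cdom c) (crd c)"
    and "continuous_on (crd c ` cdom c) (cinv c)"
    and "open (cdom c)" and "open (crd c ` cdom c)"
  using assms unfolding is_chart_def homeomorphism_def by auto

lemma smooth_manifold_chart: "smooth_manifold A \<Longrightarrow> c \<in> A \<Longrightarrow> is_chart c"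
  by (simp add: smooth_manifold_def)

lemma smooth_manifold_compatible:
  "smooth_manifold A \<Longrightarrow> c \<in> A \<Longrightarrow> d \<in> A \<Longrightarrow> smoothly_compatible c d"
  by (simp add: smooth_manifold_def)

lemma points_chart_at:
  assumes "x \<in> points A"
  shows "chart_at A x \<in> A" "x \<in> cdom (chart_at A x)"
proof -
  have "\<exists>c. c \<in> A \<and> x \<in> cdom c"
    using assms unfolding points_def by blast
  then have "chart_at A x \<in> A \<and> x \<in> cdom (chart_at A x)"
    unfolding chart_at_def by (rule someI_ex)
  then show "chart_at A x \<in> A" "x \<in> cdom (chart_at A x)" by auto
qed

lemma jac_has_derivative:
  assumes "smooth_on (crd c ` (cdom c \<inter> f -` cdom d)) (crd d \<circ> f \<circ> cinv c)"
    and "x \<in> cdom c" "f x \<in> cdom d"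
  shows "((crd d \<circ> f \<circ> cinv c) has_derivative (\<lambda>v. jac f c d x *v v)) (at (crd c x))"
  unfolding jac_def
  using smooth_on_differentiable[OF assms(1)] assms(2,3) jacobian_works by blast

lemma transition_has_derivative:
  assumes "smooth_manifold A" "c \<in> A" "d \<in> A" "x \<in> cdom c" "x \<in> cdom d"
  shows "((crd d \<circ> cinv c) has_derivative (\<lambda>v. jac id c d x *v v)) (at (crd c x))"
  using jac_has_derivative[of c id d x] smooth_manifold_compatible[OF assms(1-3)] assms
  by (simp add: smoothly_compatible_def)

text \<open>The chain rule concerns
  \<open>crd d \<circ> cinv c \<circ> (crd c \<circ> \<gamma>)\<close>, which agrees with
  \<open>crd d \<circ> \<gamma>\<close> only while the curve is in the domain of \<open>c\<close>.
  Differentiability of \<open>crd c \<circ> \<gamma>\<close> does not ensure this, as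
  \<open>crd c\<close> is arbitrary off its domain; hence the separate continuity
  hypothesis.\<close>

lemma curve_change_chart:
  assumes "is_chart c" "(\<gamma> \<longlongrightarrow> \<gamma> t) (at t within S)" "\<gamma> t \<in> cdom c" "t \<in> S"
    and "((crd d \<circ> cinv c) has_derivative (\<lambda>v. J *v v)) (at (crd c (\<gamma> t)))"
    and "((crd c \<circ> \<gamma>) has_vector_derivative v) (at t within S)"
  shows "((crd d \<circ> \<gamma>) has_vector_derivative (J *v v)) (at t within S)"
proof -
  have "\<forall>\<^sub>F s in at t within S. \<gamma> s \<in> cdom c"
    using assms(2,3) chart_inv(6)[OF assms(1)] topological_tendstoD by blast
  then have ev: "\<forall>\<^sub>F s in at t within S. (crd d \<circ> cinv c \<circ> (crd c \<circ> \<gamma>)) s = (crd d \<circ> \<gamma>) s"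
    by (rule eventually_mono) (simp add: chart_inv(1)[OF assms(1)])
  have "((crd d \<circ> cinv c \<circ> (crd c \<circ> \<gamma>)) has_derivative ((\<lambda>v. J *v v) \<circ> (\<lambda>h. h *\<^sub>R v))) (at t within S)"
    using assms(5,6) by (intro diff_chain_within) (auto simp: has_vector_derivative_def intro: has_derivative_at_withinI)
  then have "((crd d \<circ> \<gamma>) has_derivative ((\<lambda>v. J *v v) \<circ> (\<lambda>h. h *\<^sub>R v))) (at t within S)"
    by (rule has_derivative_transform_eventually[OF _ ev _ assms(4)])
       (simp add: chart_inv(1)[OF assms(1) assms(3)])
  then show ?thesis
    by (simp add: has_vector_derivative_def o_def matrix_vector_mult_scaleR)
qed

lemma bilin_congruence:
  fixes J :: "real^'i^'i::finite"
  shows "bilin (transpose J ** B ** J) v w = bilin B (J *v v) (J *v w)"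
  unfolding bilin_def by (metis dot_lmul_matrix matrix_vector_mul_assoc vector_transpose_matrix transpose_transpose)

lemma bilin_scaleR:
  fixes B :: "real^'i^'i::finite"
  shows "bilin B (a *\<^sub>R v) (b *\<^sub>R w) = a * b * bilin B v w"
  by (simp add: bilin_def matrix_vector_mult_scaleR)

lemma bilin_tensor_change:
  assumes "covariant2_tensor A B" "c \<in> A" "d \<in> A" "x \<in> cdom c" "x \<in> cdom d"
  shows "bilin (B c x) v w = bilin (B d x) (jac id c d x *v v) (jac id c d x *v w)"
  using assms bilin_congruence by (metis IntI covariant2_tensor_def)

section \<open>Paths of class \<open>C\<^sup>1\<close>\<close>

text \<open>Allows any explicit continuous velocity to be exhibited in each chart; derivatives
  within a nondegenerate interval are unique, so it coincides with
  \<open>vector_derivative\<close>.\<close>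

lemma C1_pathI:
  fixes A :: "('p::topological_space, 'i::finite) chart set"
  assumes "continuous_on {0..1} \<gamma>" "\<gamma> ` {0..1} \<subseteq> points A"
    and "\<And>d. d \<in> A \<Longrightarrow> \<exists>V. (\<forall>t\<in>{0..1}. \<gamma> t \<in> cdom d \<longrightarrow>
      ((crd d \<circ> \<gamma>) has_vector_derivative V t) (at t within {0..1})) \<and>
      continuous_on {t\<in>{0..1}. \<gamma> t \<in> cdom d} V"
  shows "C1_path A \<gamma>"
  unfolding C1_path_def
proof (intro conjI ballI impI assms(1,2))
  fix d t assume d: "d \<in> A" and t: "t \<in> {0..1}" "\<gamma> t \<in> cdom d"
  then show "(crd d \<circ> \<gamma>) differentiable (at t within {0..1})"
    using assms(3)[OF d] differentiableI_vector by blast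
next
  fix d assume d: "d \<in> A"
  obtain V where V: "\<forall>t\<in>{0..1}. \<gamma> t \<in> cdom d \<longrightarrow>
      ((crd d \<circ> \<gamma>) has_vector_derivative V t) (at t within {0..1})"
      "continuous_on {t\<in>{0..1}. \<gamma> t \<in> cdom d} V" using assms(3)[OF d] by blast
  show "continuous_on {t\<in>{0..1}. \<gamma> t \<in> cdom d}
      (\<lambda>t. vector_derivative (crd d \<circ> \<gamma>) (at t within {0..1}))"
    using V(1) by (intro continuous_on_eq[OF V(2)])
      (metis (mono_tags, lifting) mem_Collect_eq vector_derivative_within_cbox cbox_interval zero_less_one)
qed

lemma C1_path_has_vector_derivative:
  assumes "C1_path A \<gamma>" "d \<in> A" "t \<in> {0..1}" "\<gamma> t \<in> cdom d"
  shows "((crd d \<circ> \<gamma>) has_vector_derivative vector_derivative (crd d \<circ> \<gamma>) (at t within {0..1})) (at t within {0..1})"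
  using assms vector_derivative_works unfolding C1_path_def by blast

text \<open>The definition of \<open>speed\<close> uses an arbitrarily chosen chart. The Jacobian
  acting on the velocity cancels against the transformation law of \<open>h\<close>, so every chart
  gives the same value.\<close>

lemma speed_eq:
  assumes A: "smooth_manifold A" and h: "covariant2_tensor A h"
    and g: "continuous_on {0..1} \<gamma>" "c \<in> A" "t \<in> {0..1}" "\<gamma> t \<in> cdom c"
    and v: "((crd c \<circ> \<gamma>) has_vector_derivative v) (at t within {0..1})"
  shows "speed A h \<gamma> t = sqrt (bilin (h c (\<gamma> t)) v v)"
proof -
  define d where "d = chart_at A (\<gamma> t)"
  have "\<gamma> t \<in> points A" using g by (auto simp: points_def)
  then have d: "d \<in> A" "\<gamma> t \<in> cdom d" unfolding d_def by (rule points_chart_at)+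
  have "((crd d \<circ> \<gamma>) has_vector_derivative (jac id c d (\<gamma> t) *v v)) (at t within {0..1})"
    using g(1,3) by (intro curve_change_chart[OF smooth_manifold_chart[OF A g(2)] _ g(4) g(3)
      transition_has_derivative[OF A g(2) d(1) g(4) d(2)] v]) (simp add: continuous_on)
  then have "vector_derivative (crd d \<circ> \<gamma>) (at t within {0..1}) = jac id c d (\<gamma> t) *v v"
    using g(3) by (metis cbox_interval vector_derivative_within_cbox zero_less_one)
  then show ?thesis
    using bilin_tensor_change[OF h g(2) d(1) g(4) d(2)] by (simp add: speed_def Let_def flip: d_def)
qed

lemma tendsto_bilin [tendsto_intros]:
  fixes B :: "'x \<Rightarrow> real^'i^'i::finite"
  assumes "(B \<longlongrightarrow> B0) F" "(v \<longlongrightarrow> v0) F" "(w \<longlongrightarrow> w0) F"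
  shows "((\<lambda>x. bilin (B x) (v x) (w x)) \<longlongrightarrow> bilin B0 v0 w0) F"
  unfolding bilin_def matrix_vector_mult_def inner_vec_def
  using assms by (auto intro!: tendsto_intros)

lemma continuous_on_bilin [continuous_intros]:
  fixes B :: "'x::topological_space \<Rightarrow> real^'i^'i::finite"
  assumes "continuous_on S B" "continuous_on S v" "continuous_on S w"
  shows "continuous_on S (\<lambda>x. bilin (B x) (v x) (w x))"
  using assms unfolding continuous_on by (auto intro!: tendsto_intros)

lemma smooth_components_continuous:
  assumes "smooth_manifold A" "smooth_components A B" "c \<in> A"
  shows "continuous_on (cdom c) (B c)"
proof -
  note ch = chart_inv[OF smooth_manifold_chart[OF assms(1,3)]]
  have "continuous_on (crd c ` cdom c) (B c \<circ> cinv c)"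
    using assms smooth_on_continuous unfolding smooth_components_def by blast
  then have "continuous_on (cdom c) ((B c \<circ> cinv c) \<circ> crd c)"
    by (rule continuous_on_compose[OF ch(4)])
  then show ?thesis
    by (rule continuous_on_eq) (simp add: ch(1))
qed

text \<open>The chart chosen by \<open>speed\<close> may jump with the parameter. Near a given
  \<open>t\<close> one fixed chart computes the speed, and there the expression is visibly
  continuous.\<close>

lemma continuous_on_speed:
  assumes A: "smooth_manifold A" and h: "covariant2_tensor A h" "smooth_components A h"
    and g: "C1_path A \<gamma>"
  shows "continuous_on {0..1} (speed A h \<gamma>)"
  unfolding continuous_on_eq_continuous_within
proof
  fix t :: real assume t: "t \<in> {0..1}"
  have gc: "continuous_on {0..1} \<gamma>" "\<gamma> t \<in> points A" using g t by (auto simp: C1_path_def)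
  define c where "c = chart_at A (\<gamma> t)"
  have c: "c \<in> A" "\<gamma> t \<in> cdom c" unfolding c_def by (rule points_chart_at[OF gc(2)])+
  let ?S = "{0..1} \<inter> \<gamma> -` cdom c"
  let ?V = "\<lambda>t. vector_derivative (crd c \<circ> \<gamma>) (at t within {0..1})"
  have "continuous_on ?S ?V"
    using g c(1) by (auto simp: C1_path_def Int_def)
  moreover have "continuous_on ?S (\<lambda>t. h c (\<gamma> t))"
    by (rule continuous_on_compose2[OF smooth_components_continuous[OF A h(2) c(1)]])
       (auto intro: continuous_on_subset[OF gc(1)])
  ultimately have "continuous_on ?S (\<lambda>t. sqrt (bilin (h c (\<gamma> t)) (?V t) (?V t)))"
    by (intro continuous_intros)
  then have "continuous_on ?S (speed A h \<gamma>)"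
  proof (rule continuous_on_eq)
    fix s assume s: "s \<in> ?S"
    then have "s \<in> {0..1}" "\<gamma> s \<in> cdom c" by auto
    then show "sqrt (bilin (h c (\<gamma> s)) (?V s) (?V s)) = speed A h \<gamma> s"
      using speed_eq[OF A h(1) gc(1) c(1)] C1_path_has_vector_derivative[OF g c(1)] by metis
  qed
  \<comment> \<open>Relative openness of \<open>?S\<close> turns continuity on \<open>?S\<close>
    into continuity at \<open>t\<close> within the whole interval.\<close>
  moreover have "openin (top_of_set {0..1}) ?S"
    using gc(1) chart_inv(6)[OF smooth_manifold_chart[OF A c(1)]] continuous_openin_preimage_gen by blast
  then obtain T where T: "open T" "?S = {0..1} \<inter> T" by (auto simp: openin_open)
  ultimately have "continuous (at t within {0..1} \<inter> T) (speed A h \<gamma>)"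
    using t c(2) by (auto simp: continuous_on_eq_continuous_within)
  moreover have "at t within {0..1} \<inter> T = at t within {0..1}"
  proof (rule at_within_nhd[OF _ T(1)])
    have "t \<in> ?S" using t c(2) by blast
    then show "t \<in> T" unfolding T(2) by blast
  qed blast
  ultimately show "continuous (at t within {0..1}) (speed A h \<gamma>)" by simp
qed

text \<open>The path is straight in \<open>c\<close>, but the \<open>C1_path\<close> condition
  concerns every chart \<open>d\<close> it meets. There its velocity is the derivative of the
  transition map applied to the constant vector \<open>q - p\<close>, continuous because transition
  maps are smooth.\<close>

lemma C1_path_segment:
  assumes A: "smooth_manifold A" "c \<in> A" and seg: "closed_segment p q \<subseteq> crd c ` cdom c"
  defines "\<gamma> \<equiv> \<lambda>t. cinv c (p + t *\<^sub>R (q - p))"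
  shows "C1_path A \<gamma>" "t \<in> {0..1} \<Longrightarrow> ((crd c \<circ> \<gamma>) has_vector_derivative (q - p)) (at t within {0..1})"
    and "t \<in> {0..1} \<Longrightarrow> \<gamma> t \<in> cdom c"
proof -
  note ch = chart_inv[OF smooth_manifold_chart[OF A]]
  let ?l = "\<lambda>t. p + t *\<^sub>R (q - p)"
  have l: "?l t \<in> crd c ` cdom c" if "t \<in> {0..1}" for t
  proof -
    have "?l t \<in> closed_segment p q"
      using that by (auto simp: closed_segment_def algebra_simps intro!: exI[of _ t])
    then show ?thesis using seg by blast
  qed
  show mem: "\<gamma> t \<in> cdom c" if "t \<in> {0..1}" for t
    using ch(3)[OF l[OF that]] by (simp add: \<gamma>_def)
  have cg: "continuous_on {0..1} \<gamma>"
    unfolding \<gamma>_def by (rule continuous_on_compose2[OF ch(5)]) (use l in \<open>auto intro!: continuous_intros\<close>)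
  have dl: "(?l has_vector_derivative (q - p)) (at t within S)" for t S
    by (auto intro!: derivative_eq_intros)
  show "((crd c \<circ> \<gamma>) has_vector_derivative (q - p)) (at t within {0..1})" if "t \<in> {0..1}" for t
    by (rule has_vector_derivative_transform[OF that _ dl]) (use ch(2) l in \<open>simp add: \<gamma>_def\<close>)
  show "C1_path A \<gamma>"
  proof (rule C1_pathI[OF cg])
    show "\<gamma> ` {0..1} \<subseteq> points A" using mem A(2) by (auto simp: points_def)
  next
    fix d assume d: "d \<in> A"
    let ?f = "crd d \<circ> cinv c" and ?W = "crd c ` (cdom c \<inter> cdom d)"
    have sm: "smooth_on ?W ?f"
      using smooth_manifold_compatible[OF A d] by (simp add: smoothly_compatible_def)
    have lW: "?l t \<in> ?W" if "t \<in> {0..1}" "\<gamma> t \<in> cdom d" for t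
      using that mem[OF that(1)] ch(2)[OF l[OF that(1)]] unfolding \<gamma>_def by (metis IntI imageI)
    show "\<exists>V. (\<forall>t\<in>{0..1}. \<gamma> t \<in> cdom d \<longrightarrow>
      ((crd d \<circ> \<gamma>) has_vector_derivative V t) (at t within {0..1})) \<and>
      continuous_on {t\<in>{0..1}. \<gamma> t \<in> cdom d} V"
    proof (intro exI[of _ "\<lambda>t. frechet_derivative ?f (at (?l t)) (q - p)"] conjI ballI impI)
      fix t :: real assume t: "t \<in> {0..1}" "\<gamma> t \<in> cdom d"
      have "(?f has_derivative frechet_derivative ?f (at (?l t))) (at (?l t))"
        using smooth_on_differentiable[OF sm lW[OF t]] frechet_derivative_works by blast
      then have "((?f \<circ> ?l) has_vector_derivative frechet_derivative ?f (at (?l t)) (q - p)) (at t within {0..1})"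
        by (rule vector_derivative_diff_chain_within[OF dl has_derivative_at_withinI])
      then show "((crd d \<circ> \<gamma>) has_vector_derivative frechet_derivative ?f (at (?l t)) (q - p)) (at t within {0..1})"
        by (simp add: o_def \<gamma>_def)
    next
      show "continuous_on {t \<in> {0..1}. \<gamma> t \<in> cdom d} (\<lambda>t. frechet_derivative ?f (at (?l t)) (q - p))"
        by (rule continuous_on_compose2[OF smooth_on_frechet_continuous[OF sm]])
           (use lW in \<open>auto intro!: continuous_intros\<close>)
    qed
  qed
qed

text \<open>The parameter change \<open>t \<mapsto> sin\<^sup>2 (\<pi> t)\<close> brings both pieces to rest at the junction, so
  that the concatenation is again of class \<open>C\<^sup>1\<close>.\<close>

lemma C1_path_join:
  assumes A: "smooth_manifold A" and h: "covariant2_tensor A h" "smooth_components A h"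
    and al: "C1_path A \<alpha>" and be: "C1_path A \<beta>" and eq: "\<alpha> 1 = \<beta> 0"
  obtains \<sigma> where "C1_path A \<sigma>" "\<sigma> 0 = \<alpha> 0" "\<sigma> 1 = \<beta> 1"
    "integral {0..1} (speed A h \<sigma>) = integral {0..1} (speed A h \<alpha>) + integral {0..1} (speed A h \<beta>)"
proof -
  define f where "f = (\<lambda>t::real. (sin (pi * t))\<^sup>2)"
  \<comment> \<open>\<open>k\<close> equals \<open>1 - f\<close>: on \<open>{1/2..1}\<close> it
    rises from 0 to 1, so \<open>\<beta>\<close> is traversed forwards in the second half, and its
    derivative is \<open>- f'\<close>.\<close>
  define k where "k = (\<lambda>t::real. (cos (pi * t))\<^sup>2)"
  define f' where "f' = (\<lambda>t::real. 2 * pi * sin (pi * t) * cos (pi * t))"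
  define \<sigma> where "\<sigma> = (\<lambda>t. if t \<in> {0..1/2} then \<alpha> (f t) else \<beta> (k t))"
  have f01: "f t \<in> {0..1}" and k01: "k t \<in> {0..1}" for t
    by (auto simp: f_def k_def abs_square_le_1)
  have cf: "continuous_on S f" and ck: "continuous_on S k" and cf': "continuous_on S f'" for S
    by (auto simp: f_def k_def f'_def intro!: continuous_intros)
  have df: "(f has_real_derivative f' t) (at t within S)" for t S
    unfolding f_def f'_def by (auto intro!: derivative_eq_intros)
  have dk: "(k has_real_derivative - f' t) (at t within S)" for t S
    unfolding k_def f'_def by (auto intro!: derivative_eq_intros)
  have half [simp]: "f (1/2) = 1" "k (1/2) = 0" "f' (1/2) = 0" "f 0 = 0" "k 1 = 1"
    by (simp_all add: f_def k_def f'_def)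
  have half' [simp]: "f t = 1" "k t = 0" "f' t = 0" if "t * 2 = 1" for t
  proof -
    have "t = 1/2" using that by simp
    then show "f t = 1" "k t = 0" "f' t = 0" using half by (simp_all only:)
  qed
  have s1: "\<sigma> t = \<alpha> (f t)" if "t \<in> {0..1/2}" for t using that by (simp add: \<sigma>_def)
  have s2: "\<sigma> t = \<beta> (k t)" if "t \<in> {1/2..1}" for t
  proof (cases "t = 1/2")
    case True
    show ?thesis unfolding True by (simp add: \<sigma>_def eq)
  qed (use that in \<open>auto simp: \<sigma>_def\<close>)
  \<comment> \<open>The signs are needed for the speed: the factor leaves the square root as an
    absolute value.\<close>
  have pos1: "f' t \<ge> 0" if "t \<in> {0..1/2}" for t
  proof -
    have "0 \<le> pi * t" "pi * t \<le> pi / 2" using that by auto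
    moreover from this have "- (pi / 2) \<le> pi * t" using pi_ge_zero by linarith
    ultimately show ?thesis
      by (auto simp: f'_def intro!: mult_nonneg_nonneg sin_ge_zero cos_ge_zero)
  qed
  have pos2: "- f' t \<ge> 0" if "t \<in> {1/2..1}" for t
  proof -
    have "cos (pi * t) \<le> 0"
    proof -
      have "sin (pi * (t - 1/2)) \<ge> 0" using that by (intro sin_ge_zero) (auto simp: mult_le_cancel_left1)
      then show ?thesis by (simp add: right_diff_distrib sin_diff)
    qed
    moreover have "sin (pi * t) \<ge> 0" using that by (intro sin_ge_zero) auto
    ultimately show ?thesis by (simp add: f'_def mult_nonneg_nonpos)
  qed
  have ca: "continuous_on {0..1} \<alpha>" and cb: "continuous_on {0..1} \<beta>"
    and pa: "\<alpha> ` {0..1} \<subseteq> points A" and pb: "\<beta> ` {0..1} \<subseteq> points A"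
    using al be by (auto simp: C1_path_def)
  have c1: "continuous_on {0..1/2} (\<lambda>t. \<alpha> (f t))" and c2: "continuous_on {1/2..1} (\<lambda>t. \<beta> (k t))"
    using f01 k01 by (auto intro!: continuous_on_compose2[OF ca cf] continuous_on_compose2[OF cb ck])
  have u01: "{0..1} = {0..1/2} \<union> {1/2..1::real}" by auto
  have cs: "continuous_on {0..1} \<sigma>"
    unfolding u01 \<sigma>_def by (rule continuous_on_cases[OF _ _ c1 c2]) (use eq in auto)
  let ?Va = "\<lambda>d t. vector_derivative (crd d \<circ> \<alpha>) (at t within {0..1})"
  let ?Vb = "\<lambda>d t. vector_derivative (crd d \<circ> \<beta>) (at t within {0..1})"
  \<comment> \<open>The two formulas agree at \<open>1/2\<close> because \<open>f'\<close> vanishes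
    there, whatever the end velocities of \<open>\<alpha>\<close> and
    \<open>\<beta>\<close>.\<close>
  let ?V = "\<lambda>d t. if t \<in> {0..1/2} then f' t *\<^sub>R ?Va d (f t) else - f' t *\<^sub>R ?Vb d (k t)"
  have dV: "((crd d \<circ> \<sigma>) has_vector_derivative ?V d t) (at t within {0..1})"
    if d: "d \<in> A" and t: "t \<in> {0..1}" "\<sigma> t \<in> cdom d" for d t
  proof -
    have 1: "((crd d \<circ> \<alpha> \<circ> f) has_vector_derivative f' t *\<^sub>R ?Va d (f t)) (at t within {0..1/2})"
      if "t \<in> {0..1/2}"
    proof (rule vector_diff_chain_within)
      show "(f has_vector_derivative f' t) (at t within {0..1/2})"
        using df by (simp add: has_real_derivative_iff_has_vector_derivative)
      show "(crd d \<circ> \<alpha> has_vector_derivative ?Va d (f t)) (at (f t) within f ` {0..1/2})"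
        by (rule has_vector_derivative_within_subset[OF C1_path_has_vector_derivative[OF al d]])
           (use s1[OF that] t(2) f01 in auto)
    qed
    have 2: "((crd d \<circ> \<beta> \<circ> k) has_vector_derivative - f' t *\<^sub>R ?Vb d (k t)) (at t within {1/2..1})"
      if "t \<in> {1/2..1}"
    proof (rule vector_diff_chain_within)
      show "(k has_vector_derivative - f' t) (at t within {1/2..1})"
        using dk by (simp add: has_real_derivative_iff_has_vector_derivative)
      show "(crd d \<circ> \<beta> has_vector_derivative ?Vb d (k t)) (at (k t) within k ` {1/2..1})"
        by (rule has_vector_derivative_within_subset[OF C1_path_has_vector_derivative[OF be d]])
           (use s2[OF that] t(2) k01 in auto)
    qed
    have cl: "{0..1/2} \<inter> {1/2..1} = {1/2::real}" by auto
    have "((\<lambda>t. if t \<in> {0..1/2} then (crd d \<circ> \<alpha> \<circ> f) t else (crd d \<circ> \<beta> \<circ> k) t)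
       has_vector_derivative ?V d t) (at t within {0..1})"
      by (rule has_vector_derivative_If_within_closures[OF _ u01])
         (use 1 2 t(1) eq in \<open>auto simp: cl insert_absorb o_def\<close>)
    moreover have "(\<lambda>t. if t \<in> {0..1/2} then (crd d \<circ> \<alpha> \<circ> f) t else (crd d \<circ> \<beta> \<circ> k) t) = crd d \<circ> \<sigma>"
      by (auto simp: \<sigma>_def)
    ultimately show ?thesis by simp
  qed
  have C1: "C1_path A \<sigma>"
  proof (rule C1_pathI[OF cs])
    show "\<sigma> ` {0..1} \<subseteq> points A" using pa pb f01 k01 by (auto simp: \<sigma>_def)
  next
    fix d assume d: "d \<in> A"
    let ?S = "{t \<in> {0..1/2}. \<sigma> t \<in> cdom d}" and ?T = "{t \<in> {1/2..1}. \<sigma> t \<in> cdom d}"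
    have un: "{t \<in> {0..1}. \<sigma> t \<in> cdom d} = ?S \<union> ?T" by auto
    have *: "continuous_on ?S (\<lambda>t. f' t *\<^sub>R ?Va d (f t))"
    proof (intro continuous_intros cf' continuous_on_compose2[OF _ cf])
      show "continuous_on {t \<in> {0..1}. \<alpha> t \<in> cdom d} (?Va d)" using al d by (simp add: C1_path_def)
    qed (use f01 s1 in auto)
    have **: "continuous_on ?T (\<lambda>t. - f' t *\<^sub>R ?Vb d (k t))"
    proof (intro continuous_intros cf' continuous_on_compose2[OF _ ck])
      show "continuous_on {t \<in> {0..1}. \<beta> t \<in> cdom d} (?Vb d)" using be d by (simp add: C1_path_def)
    qed (use k01 s2 in auto)
    have "continuous_on {t \<in> {0..1}. \<sigma> t \<in> cdom d} (?V d)"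
      unfolding un
    proof (rule continuous_on_cases_local[OF _ _ * **])
      show "closedin (top_of_set (?S \<union> ?T)) ?S"
        unfolding closedin_closed by (rule exI[of _ "{0..1/2}"]) auto
      show "closedin (top_of_set (?S \<union> ?T)) ?T"
        unfolding closedin_closed by (rule exI[of _ "{1/2..1}"]) auto
      show "f' x *\<^sub>R ?Va d (f x) = - f' x *\<^sub>R ?Vb d (k x)"
        if "x \<in> ?S \<and> x \<notin> {0..1/2} \<or> x \<in> ?T \<and> x \<in> {0..1/2}" for x
      proof -
        have "x = 1/2" using that by auto
        show ?thesis unfolding \<open>x = 1/2\<close> by simp
      qed
    qed
    then show "\<exists>V. (\<forall>t\<in>{0..1}. \<sigma> t \<in> cdom d \<longrightarrow>
      ((crd d \<circ> \<sigma>) has_vector_derivative V t) (at t within {0..1})) \<and>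
      continuous_on {t\<in>{0..1}. \<sigma> t \<in> cdom d} V"
      by (intro exI[of _ "?V d"] conjI ballI impI dV[OF d])
  qed
  have sp1: "f' t *\<^sub>R speed A h \<alpha> (f t) = speed A h \<sigma> t" if t: "t \<in> {0..1/2}" for t
  proof -
    have t1: "t \<in> {0..1}" using t by auto
    have "\<sigma> t \<in> points A" using C1 t1 by (auto simp: C1_path_def)
    from points_chart_at[OF this] obtain c where c: "c \<in> A" "\<sigma> t \<in> cdom c" by blast
    have c': "\<alpha> (f t) \<in> cdom c" using c(2) s1[OF t] by simp
    have "speed A h \<sigma> t = sqrt (bilin (h c (\<sigma> t)) (?V c t) (?V c t))"
      by (rule speed_eq[OF A h(1) cs c(1) t1 c(2) dV[OF c(1) t1 c(2)]])
    also have "\<dots> = f' t * sqrt (bilin (h c (\<sigma> t)) (?Va c (f t)) (?Va c (f t)))"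
      using t pos1[OF t] by (simp add: bilin_scaleR real_sqrt_mult)
    also have "\<dots> = f' t * speed A h \<alpha> (f t)"
      using speed_eq[OF A h(1) ca c(1) f01 c' C1_path_has_vector_derivative[OF al c(1) f01 c']] s1[OF t] by simp
    finally show ?thesis by simp
  qed
  have sp2: "- f' t *\<^sub>R speed A h \<beta> (k t) = speed A h \<sigma> t" if t: "t \<in> {1/2..1}" for t
  proof -
    have t1: "t \<in> {0..1}" using t by auto
    have "\<sigma> t \<in> points A" using C1 t1 by (auto simp: C1_path_def)
    from points_chart_at[OF this] obtain c where c: "c \<in> A" "\<sigma> t \<in> cdom c" by blast
    have c': "\<beta> (k t) \<in> cdom c" using c(2) s2[OF t] by simp
    have V: "?V c t = - f' t *\<^sub>R ?Vb c (k t)"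
    proof (cases "t = 1/2")
      case True
      show ?thesis unfolding True by simp
    qed (use t in auto)
    have "speed A h \<sigma> t = sqrt (bilin (h c (\<sigma> t)) (?V c t) (?V c t))"
      by (rule speed_eq[OF A h(1) cs c(1) t1 c(2) dV[OF c(1) t1 c(2)]])
    also have "\<dots> = - f' t * sqrt (bilin (h c (\<sigma> t)) (?Vb c (k t)) (?Vb c (k t)))"
      unfolding V bilin_scaleR using pos2[OF t] by (simp add: real_sqrt_mult)
    also have "\<dots> = - f' t * speed A h \<beta> (k t)"
      using speed_eq[OF A h(1) cb c(1) k01 c' C1_path_has_vector_derivative[OF be c(1) k01 c']] s2[OF t] by simp
    finally show ?thesis by simp
  qed
  \<comment> \<open>Length is invariant under the parameter change: integration by substitution
    gives back the full length of each piece.\<close>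
  have "((\<lambda>t. f' t *\<^sub>R speed A h \<alpha> (f t)) has_integral integral {f 0..f (1/2)} (speed A h \<alpha>)) {0..1/2}"
    by (rule has_integral_substitution[OF _ _ _ continuous_on_speed[OF A h al] df]) (use f01 in auto)
  then have i1: "(speed A h \<sigma> has_integral integral {0..1} (speed A h \<alpha>)) {0..1/2}"
    unfolding half by (rule has_integral_eq[OF sp1, rotated])
  have "((\<lambda>t. - f' t *\<^sub>R speed A h \<beta> (k t)) has_integral integral {k (1/2)..k 1} (speed A h \<beta>)) {1/2..1}"
    by (rule has_integral_substitution[OF _ _ _ continuous_on_speed[OF A h be] dk]) (use k01 in auto)
  then have i2: "(speed A h \<sigma> has_integral integral {0..1} (speed A h \<beta>)) {1/2..1}"
    unfolding half by (rule has_integral_eq[OF sp2, rotated])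
  have "(speed A h \<sigma> has_integral integral {0..1} (speed A h \<alpha>) + integral {0..1} (speed A h \<beta>)) {0..1}"
    by (rule has_integral_combine[OF _ _ i1 i2]) auto
  then show thesis
    using that[OF C1] s1[of 0] s2[of 1] by (auto dest: integral_unique)
qed

section \<open>The Riemannian distance\<close>

lemma riemannian_metricD:
  assumes "riemannian_metric A h"
  shows "covariant2_tensor A h" "smooth_components A h"
    and "c \<in> A \<Longrightarrow> x \<in> cdom c \<Longrightarrow> 0 \<le> bilin (h c x) v v"
proof -
  show "covariant2_tensor A h" "smooth_components A h"
    using assms by (auto simp: riemannian_metric_def)
  show "0 \<le> bilin (h c x) v v" if "c \<in> A" "x \<in> cdom c"
  proof (cases "v = 0")
    case False
    then have "0 < bilin (h c x) v v" using assms that unfolding riemannian_metric_def by blast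
    then show ?thesis by simp
  qed (simp add: bilin_def)
qed

lemma speed_nonneg:
  assumes "riemannian_metric A h" "C1_path A \<gamma>" "t \<in> {0..1}"
  shows "0 \<le> speed A h \<gamma> t"
proof -
  have "\<gamma> t \<in> points A" using assms(2,3) by (auto simp: C1_path_def)
  then show ?thesis
    using riemannian_metricD(3)[OF assms(1) points_chart_at] by (simp add: speed_def Let_def)
qed

lemma speed_integral_nonneg:
  assumes "smooth_manifold A" "riemannian_metric A h" "C1_path A \<gamma>"
  shows "0 \<le> integral {0..1} (speed A h \<gamma>)"
  by (intro integral_nonneg integrable_continuous_interval
      continuous_on_speed[OF assms(1) riemannian_metricD(1,2)[OF assms(2)] assms(3)]
      speed_nonneg[OF assms(2,3)])

text \<open>A real infimum lies below the members of its set only if the set is bounded below; here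
  lengths are nonnegative.\<close>

lemma riemannian_dist_le:
  assumes "smooth_manifold A" "riemannian_metric A h" "C1_path A \<gamma>"
  shows "riemannian_dist A h (\<gamma> 0) (\<gamma> 1) \<le> integral {0..1} (speed A h \<gamma>)"
  unfolding riemannian_dist_def
proof (rule cInf_lower)
  show "bdd_below {integral {0..1} (speed A h \<gamma>') |\<gamma>'. C1_path A \<gamma>' \<and> \<gamma>' 0 = \<gamma> 0 \<and> \<gamma>' 1 = \<gamma> 1}"
    using speed_integral_nonneg[OF assms(1,2)] by (intro bdd_belowI[of _ 0]) auto
qed (use assms(3) in auto)

text \<open>Coordinate balls are convex, so coordinate segments join any two of their
  points.\<close>

lemma local_C1_paths:
  assumes "smooth_manifold A" "z \<in> points A"
  obtains N where "open N" "z \<in> N" "\<And>x y. x \<in> N \<Longrightarrow> y \<in> N \<Longrightarrow> \<exists>\<gamma>. C1_path A \<gamma> \<and> \<gamma> 0 = x \<and> \<gamma> 1 = y"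
proof -
  define c where "c = chart_at A z"
  have c: "c \<in> A" "z \<in> cdom c" unfolding c_def by (rule points_chart_at[OF assms(2)])+
  note ch = chart_inv[OF smooth_manifold_chart[OF assms(1) c(1)]]
  obtain e where e: "e > 0" "ball (crd c z) e \<subseteq> crd c ` cdom c"
    using ch(7) c(2) by (meson imageI open_contains_ball)
  let ?N = "cdom c \<inter> crd c -` ball (crd c z) e"
  show thesis
  proof
    show "open ?N" using ch(4,6) by (auto intro: continuous_open_preimage)
    show "z \<in> ?N" using c e by auto
  next
    fix x y assume xy: "x \<in> ?N" "y \<in> ?N"
    then have "closed_segment (crd c x) (crd c y) \<subseteq> ball (crd c z) e"
      by (intro closed_segment_subset) auto
    then have "closed_segment (crd c x) (crd c y) \<subseteq> crd c ` cdom c" using e(2) by blast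
    note seg = C1_path_segment(1)[OF assms(1) c(1) this]
    show "\<exists>\<gamma>. C1_path A \<gamma> \<and> \<gamma> 0 = x \<and> \<gamma> 1 = y"
      by (rule exI[of _ "\<lambda>t. cinv c (crd c x + t *\<^sub>R (crd c y - crd c x))"], intro conjI seg)
         (use xy ch(1) in auto)
  qed
qed

text \<open>Guarantees that the infimum defining the distance is over a nonempty set. Being
  reachable from \<open>x\<close> is a locally constant property, by joining with a local path, and
  the manifold is connected.\<close>

lemma C1_path_exists:
  assumes A: "smooth_manifold A" and h: "riemannian_metric A h" and con: "connected (points A)"
    and x: "x \<in> points A" and y: "y \<in> points A"
  shows "\<exists>\<gamma>. C1_path A \<gamma> \<and> \<gamma> 0 = x \<and> \<gamma> 1 = y"
proof (rule connected_induction_simple[OF con x y])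
  show "\<exists>\<gamma>. C1_path A \<gamma> \<and> \<gamma> 0 = x \<and> \<gamma> 1 = x"
    by (rule local_C1_paths[OF A x]) blast
next
  fix z assume "z \<in> points A"
  from local_C1_paths[OF A this] obtain N where N: "open N" "z \<in> N"
    "\<And>x y. x \<in> N \<Longrightarrow> y \<in> N \<Longrightarrow> \<exists>\<gamma>. C1_path A \<gamma> \<and> \<gamma> 0 = x \<and> \<gamma> 1 = y" by blast
  have "\<exists>\<gamma>. C1_path A \<gamma> \<and> \<gamma> 0 = x \<and> \<gamma> 1 = w"
    if vw: "v \<in> N" "w \<in> N" and ex: "\<exists>\<gamma>. C1_path A \<gamma> \<and> \<gamma> 0 = x \<and> \<gamma> 1 = v" for v w
  proof -
    obtain \<alpha> where \<alpha>: "C1_path A \<alpha>" "\<alpha> 0 = x" "\<alpha> 1 = v" using ex by blast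
    obtain \<beta> where \<beta>: "C1_path A \<beta>" "\<beta> 0 = v" "\<beta> 1 = w" using N(3)[OF vw] by blast
    have eq: "\<alpha> 1 = \<beta> 0" using \<alpha> \<beta> by simp
    show ?thesis
      by (rule C1_path_join[OF A riemannian_metricD(1,2)[OF h] \<alpha>(1) \<beta>(1) eq]) (use \<alpha> \<beta> in auto)
  qed
  then show "\<exists>T. openin (top_of_set (points A)) T \<and> z \<in> T \<and> (\<forall>v\<in>T. \<forall>w\<in>T.
      (\<exists>\<gamma>. C1_path A \<gamma> \<and> \<gamma> 0 = x \<and> \<gamma> 1 = v) \<longrightarrow> (\<exists>\<gamma>. C1_path A \<gamma> \<and> \<gamma> 0 = x \<and> \<gamma> 1 = w))"
    by (intro exI[of _ "points A \<inter> N"] conjI ballI impI)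
      (use N(1,2) \<open>z \<in> points A\<close> in auto)
qed

text \<open>Paths that are optimal up to \<open>e / 2\<close> are joined, and the length of the
  joined path is the sum of the two lengths.\<close>

lemma riemannian_dist_triangle:
  assumes A: "smooth_manifold A" and h: "riemannian_metric A h" and con: "connected (points A)"
    and pts: "x \<in> points A" "y \<in> points A" "z \<in> points A"
  shows "riemannian_dist A h x z \<le> riemannian_dist A h x y + riemannian_dist A h y z"
proof (rule field_le_epsilon)
  fix e :: real assume e: "e > 0"
  have ex: "\<exists>\<gamma>. C1_path A \<gamma> \<and> \<gamma> 0 = v \<and> \<gamma> 1 = w \<and>
      integral {0..1} (speed A h \<gamma>) < riemannian_dist A h v w + e / 2"
    if "v \<in> points A" "w \<in> points A" for v w
  proof -
    let ?S = "{integral {0..1} (speed A h \<gamma>) | \<gamma>. C1_path A \<gamma> \<and> \<gamma> 0 = v \<and> \<gamma> 1 = w}"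
    have ne: "?S \<noteq> {}" using C1_path_exists[OF A h con that] by blast
    have "Inf ?S < riemannian_dist A h v w + e / 2"
      using e unfolding riemannian_dist_def by linarith
    from cInf_lessD[OF ne this] show ?thesis by blast
  qed
  obtain \<alpha> where \<alpha>: "C1_path A \<alpha>" "\<alpha> 0 = x" "\<alpha> 1 = y"
    "integral {0..1} (speed A h \<alpha>) < riemannian_dist A h x y + e / 2" using ex pts by blast
  obtain \<beta> where \<beta>: "C1_path A \<beta>" "\<beta> 0 = y" "\<beta> 1 = z"
    "integral {0..1} (speed A h \<beta>) < riemannian_dist A h y z + e / 2" using ex pts by blast
  have eq: "\<alpha> 1 = \<beta> 0" using \<alpha> \<beta> by simp
  obtain \<sigma> where "C1_path A \<sigma>" "\<sigma> 0 = \<alpha> 0" "\<sigma> 1 = \<beta> 1"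
    "integral {0..1} (speed A h \<sigma>) = integral {0..1} (speed A h \<alpha>) + integral {0..1} (speed A h \<beta>)"
    by (rule C1_path_join[OF A riemannian_metricD(1,2)[OF h] \<alpha>(1) \<beta>(1) eq])
  then show "riemannian_dist A h x z \<le> riemannian_dist A h x y + riemannian_dist A h y z + e"
    using riemannian_dist_le[OF A h, of \<sigma>] \<alpha> \<beta> by simp
qed

text \<open>On the compact set of base points in \<open>K\<close> and unit vectors the quadratic
  form of \<open>h\<close> is bounded, and scaling extends the bound to all vectors. Convexity keeps
  coordinate segments in \<open>K\<close>, so their lengths bound the distance.\<close>

lemma riemannian_dist_chart_lipschitz:
  assumes A: "smooth_manifold A" and h: "riemannian_metric A h" and c: "c \<in> A"
    and K: "compact K" "convex K" "K \<subseteq> crd c ` cdom c"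
  obtains L where "L \<ge> 0"
    "\<And>p q. p \<in> K \<Longrightarrow> q \<in> K \<Longrightarrow> riemannian_dist A h (cinv c p) (cinv c q) \<le> L * norm (q - p)"
proof -
  note ch = chart_inv[OF smooth_manifold_chart[OF A c]]
  note hD = riemannian_metricD[OF h]
  let ?f = "\<lambda>(y, v). bilin (h c (cinv c y)) v v"
  have "continuous_on (K \<times> sphere 0 1) ?f"
    unfolding split_beta
    by (intro continuous_intros continuous_on_compose2[OF smooth_components_continuous[OF A hD(2) c]]
        continuous_on_compose2[OF ch(5)]) (use K(3) ch(3) in auto)
  then have "bounded (?f ` (K \<times> sphere 0 1))"
    by (intro compact_imp_bounded compact_continuous_image compact_Times K compact_sphere)
  then obtain C where C: "C > 0" "\<forall>z \<in> ?f ` (K \<times> sphere 0 1). norm z \<le> C"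
    using bounded_pos by blast
  have bd: "bilin (h c (cinv c y)) v v \<le> C * (norm v)\<^sup>2" if "y \<in> K" for y v
  proof (cases "v = 0")
    case False
    define n where "n = v /\<^sub>R norm v"
    have "norm n = 1" using False by (simp add: n_def)
    then have "?f (y, n) \<in> ?f ` (K \<times> sphere 0 1)" using that by (intro imageI) auto
    then have "bilin (h c (cinv c y)) n n \<le> C" using C(2) by force
    then have "(norm v)\<^sup>2 * bilin (h c (cinv c y)) n n \<le> (norm v)\<^sup>2 * C"
      by (rule mult_left_mono) simp
    moreover have "bilin (h c (cinv c y)) v v
        = bilin (h c (cinv c y)) (norm v *\<^sub>R n) (norm v *\<^sub>R n)"
      using False by (simp add: n_def)
    ultimately show ?thesis by (simp add: bilin_scaleR power2_eq_square mult.commute)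
  qed (simp add: bilin_def)
  show thesis
  proof
    show "0 \<le> sqrt C" using C by simp
    fix p q assume pq: "p \<in> K" "q \<in> K"
    let ?g = "\<lambda>t. cinv c (p + t *\<^sub>R (q - p))"
    have inK: "p + t *\<^sub>R (q - p) \<in> K" if "t \<in> {0..1}" for t
      using convexD_alt[OF K(2) pq, of t] that by (simp add: algebra_simps)
    have seg: "closed_segment p q \<subseteq> crd c ` cdom c"
      using closed_segment_subset[OF pq K(2)] K(3) by blast
    note S = C1_path_segment[OF A c seg]
    have le: "speed A h ?g t \<le> sqrt C * norm (q - p)" if t: "t \<in> {0..1}" for t
    proof -
      have "speed A h ?g t = sqrt (bilin (h c (?g t)) (q - p) (q - p))"
        using S(1) by (intro speed_eq[OF A hD(1) _ c t S(3)[OF t] S(2)[OF t]]) (simp add: C1_path_def)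
      also have "\<dots> \<le> sqrt (C * (norm (q - p))\<^sup>2)"
        using bd[OF inK[OF t]] by (rule real_sqrt_le_mono)
      finally show ?thesis by (simp add: real_sqrt_mult)
    qed
    have "riemannian_dist A h (?g 0) (?g 1) \<le> integral {0..1} (speed A h ?g)"
      by (rule riemannian_dist_le[OF A h S(1)])
    also have "\<dots> \<le> integral {0..1} (\<lambda>t::real. sqrt C * norm (q - p))"
      by (intro integral_le integrable_continuous_interval continuous_on_speed[OF A hD(1,2) S(1)] le)
         auto
    also have "\<dots> = sqrt C * norm (q - p)" by simp
    finally show "riemannian_dist A h (cinv c p) (cinv c q) \<le> sqrt C * norm (q - p)" by simp
  qed
qed

section \<open>Timelike curves\<close>

lemma continuous_spacetimeD:
  assumes "continuous_spacetime M"
  shows "smooth_manifold (atlas M)" "connected (points (atlas M))"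
    and "covariant2_tensor (atlas M) (gmetric M)" "vector_field (atlas M) (tfield M)"
    and "c \<in> atlas M \<Longrightarrow> continuous_on (cdom c) (gmetric M c)"
    and "c \<in> atlas M \<Longrightarrow> continuous_on (cdom c) (tfield M c)"
    and "c \<in> atlas M \<Longrightarrow> x \<in> cdom c \<Longrightarrow> lorentzian_form (gmetric M c x)"
    and "c \<in> atlas M \<Longrightarrow> x \<in> cdom c \<Longrightarrow> bilin (gmetric M c x) (tfield M c x) (tfield M c x) < 0"
  using assms unfolding continuous_spacetime_def carrier_def continuous_components_def by blast+

lemma future_timelike_change:
  assumes M: "continuous_spacetime M" and cd: "c \<in> atlas M" "d \<in> atlas M" "x \<in> cdom c" "x \<in> cdom d"
    and v: "future_timelike M c x v"
  shows "future_timelike M d x (jac id c d x *v v)"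
proof -
  have "tfield M d x = jac id c d x *v tfield M c x"
    using continuous_spacetimeD(4)[OF M] cd unfolding vector_field_def by blast
  then show ?thesis
    using v bilin_tensor_change[OF continuous_spacetimeD(3)[OF M] cd]
    by (simp add: future_timelike_def)
qed

text \<open>A straight line in the coordinates of \<open>c\<close> with constant coordinate velocity
  \<open>v\<close>. The uniform margin \<open>\<epsilon>\<close> is the one that the definition of
  timelike curves asks for.\<close>

definition timelike_segment ::
  "('p::topological_space, 'i::finite) spacetime \<Rightarrow> ('p, 'i) chart \<Rightarrow> real^'i \<Rightarrow> real^'i \<Rightarrow> real \<Rightarrow> bool" where
  "timelike_segment M c p v \<tau> \<longleftrightarrow> 0 < \<tau> \<and> (\<exists>\<epsilon>>0. \<forall>t\<in>{0..\<tau>}.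
     p + t *\<^sub>R v \<in> crd c ` cdom c \<and> future_timelike M c (cinv c (p + t *\<^sub>R v)) v \<and>
     bilin (gmetric M c (cinv c (p + t *\<^sub>R v))) v v < - \<epsilon>)"

text \<open>The shift by \<open>b\<close> lets the segment continue a curve that ends at parameter
  \<open>b\<close>. The velocity exists at every parameter, so nothing has to be excluded as a null
  set.\<close>

lemma ae_velocity_segment:
  fixes b :: real
  assumes A: "smooth_manifold (atlas M)" and c: "c \<in> atlas M"
    and mem: "\<And>t. t \<in> {0..\<tau>} \<Longrightarrow> p + t *\<^sub>R v \<in> crd c ` cdom c"
    and P: "\<And>t d. t \<in> {0..\<tau>} \<Longrightarrow> d \<in> atlas M \<Longrightarrow> cinv c (p + t *\<^sub>R v) \<in> cdom d \<Longrightarrow>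
      P d (cinv c (p + t *\<^sub>R v)) (jac id c d (cinv c (p + t *\<^sub>R v)) *v v)"
  shows "ae_velocity M (\<lambda>t. cinv c (p + (t - b) *\<^sub>R v)) b (b + \<tau>) P"
  unfolding ae_velocity_def
proof (intro AE_I2 impI ballI)
  fix t d assume t: "t \<in> {b..b + \<tau>}" and d: "d \<in> atlas M" and md: "cinv c (p + (t - b) *\<^sub>R v) \<in> cdom d"
  note ch = chart_inv[OF smooth_manifold_chart[OF A c]]
  let ?l = "\<lambda>t. p + (t - b) *\<^sub>R v"
  have tb: "t - b \<in> {0..\<tau>}" using t by auto
  have mc: "cinv c (?l t) \<in> cdom c" using ch(3)[OF mem[OF tb]] .
  have "(?l has_vector_derivative v) (at t within {b..b + \<tau>})"
    by (auto intro!: derivative_eq_intros)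
  moreover have "((crd d \<circ> cinv c) has_derivative (\<lambda>w. jac id c d (cinv c (?l t)) *v w)) (at (?l t))"
    using transition_has_derivative[OF A c d mc md] ch(2)[OF mem[OF tb]] by simp
  ultimately have "((crd d \<circ> cinv c \<circ> ?l) has_vector_derivative jac id c d (cinv c (?l t)) *v v) (at t within {b..b + \<tau>})"
    by (rule vector_derivative_diff_chain_within[OF _ has_derivative_at_withinI])
  then show "\<exists>w. ((crd d \<circ> (\<lambda>t. cinv c (?l t))) has_vector_derivative w) (at t within {b..b + \<tau>}) \<and> P d (cinv c (?l t)) w"
    using P[OF tb d md] by (auto simp: o_def)
qed

text \<open>The Lipschitz bound is proved for an arbitrary Riemannian metric \<open>h\<close>,
  because a segment appended to a given curve must be Lipschitz for the metric that comes with that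
  curve.\<close>

lemma timelike_segmentD:
  fixes M :: "('p::{t2_space,second_countable_topology}, 'i::finite) spacetime" and b :: real
  assumes M: "continuous_spacetime M" and c: "c \<in> atlas M" and seg: "timelike_segment M c p v \<tau>"
    and \<gamma>_def: "\<gamma> = (\<lambda>t. cinv c (p + (t - b) *\<^sub>R v))"
  shows "\<gamma> ` {b..b + \<tau>} \<subseteq> carrier M"
    and "ae_velocity M \<gamma> b (b + \<tau>) (future_timelike M)"
    and "\<exists>\<epsilon>>0. ae_velocity M \<gamma> b (b + \<tau>) (\<lambda>c x v. bilin (gmetric M c x) v v < - \<epsilon>)"
    and "riemannian_metric (atlas M) h \<Longrightarrow> \<exists>L\<ge>0. \<forall>r\<in>{b..b + \<tau>}. \<forall>s\<in>{b..b + \<tau>}.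
      riemannian_dist (atlas M) h (\<gamma> r) (\<gamma> s) \<le> L * \<bar>r - s\<bar>"
proof -
  note A = continuous_spacetimeD(1)[OF M]
  note ch = chart_inv[OF smooth_manifold_chart[OF A c]]
  obtain \<epsilon> where \<tau>: "\<tau> > 0" and \<epsilon>: "\<epsilon> > 0" and s: "\<And>t. t \<in> {0..\<tau>} \<Longrightarrow>
     p + t *\<^sub>R v \<in> crd c ` cdom c \<and> future_timelike M c (cinv c (p + t *\<^sub>R v)) v \<and>
     bilin (gmetric M c (cinv c (p + t *\<^sub>R v))) v v < - \<epsilon>"
    using seg unfolding timelike_segment_def by blast
  have mem: "p + t *\<^sub>R v \<in> crd c ` cdom c" if "t \<in> {0..\<tau>}" for t using s that by blast
  have mc: "cinv c (p + t *\<^sub>R v) \<in> cdom c" if "t \<in> {0..\<tau>}" for t using ch(3)[OF mem[OF that]] .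
  show "\<gamma> ` {b..b + \<tau>} \<subseteq> carrier M"
    using mc c by (auto simp: \<gamma>_def carrier_def points_def)
  show "ae_velocity M \<gamma> b (b + \<tau>) (future_timelike M)"
    unfolding \<gamma>_def
  proof (rule ae_velocity_segment[OF A c mem])
    fix t d assume t: "t \<in> {0..\<tau>}" and d: "d \<in> atlas M" "cinv c (p + t *\<^sub>R v) \<in> cdom d"
    show "future_timelike M d (cinv c (p + t *\<^sub>R v)) (jac id c d (cinv c (p + t *\<^sub>R v)) *v v)"
      by (rule future_timelike_change[OF M c d(1) mc[OF t] d(2)]) (use s[OF t] in blast)
  qed
  show "\<exists>\<epsilon>>0. ae_velocity M \<gamma> b (b + \<tau>) (\<lambda>c x v. bilin (gmetric M c x) v v < - \<epsilon>)"
  proof (intro exI[of _ \<epsilon>] conjI \<epsilon>)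
    show "ae_velocity M \<gamma> b (b + \<tau>) (\<lambda>c x v. bilin (gmetric M c x) v v < - \<epsilon>)"
      unfolding \<gamma>_def
    proof (rule ae_velocity_segment[OF A c mem])
      fix t d assume t: "t \<in> {0..\<tau>}" and d: "d \<in> atlas M" "cinv c (p + t *\<^sub>R v) \<in> cdom d"
      show "bilin (gmetric M d (cinv c (p + t *\<^sub>R v))) (jac id c d (cinv c (p + t *\<^sub>R v)) *v v)
        (jac id c d (cinv c (p + t *\<^sub>R v)) *v v) < - \<epsilon>"
        using s[OF t] bilin_tensor_change[OF continuous_spacetimeD(3)[OF M] c d(1) mc[OF t] d(2)] by simp
    qed
  qed
  show "\<exists>L\<ge>0. \<forall>r\<in>{b..b + \<tau>}. \<forall>s\<in>{b..b + \<tau>}.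
      riemannian_dist (atlas M) h (\<gamma> r) (\<gamma> s) \<le> L * \<bar>r - s\<bar>" if h: "riemannian_metric (atlas M) h"
  proof -
    let ?K = "(\<lambda>t. p + t *\<^sub>R v) ` {0..\<tau>}"
    have "compact ?K" by (intro compact_continuous_image continuous_intros) auto
    moreover have "convex ?K"
    proof -
      have "convex ((+) p ` (\<lambda>t. t *\<^sub>R v) ` {0..\<tau>})"
        by (intro convex_translation convex_linear_image
            bounded_linear.linear[OF bounded_linear_scaleR_left]) auto
      then show ?thesis by (simp add: image_image)
    qed
    moreover have "?K \<subseteq> crd c ` cdom c" using mem by auto
    ultimately obtain L where L: "L \<ge> 0" "\<And>y z. y \<in> ?K \<Longrightarrow> z \<in> ?K \<Longrightarrow>
        riemannian_dist (atlas M) h (cinv c y) (cinv c z) \<le> L * norm (z - y)"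
      using riemannian_dist_chart_lipschitz[OF A h c] by blast
    show ?thesis
    proof (intro exI[of _ "L * norm v"] conjI ballI)
      fix r s assume "r \<in> {b..b + \<tau>}" "s \<in> {b..b + \<tau>}"
      then have "riemannian_dist (atlas M) h (\<gamma> r) (\<gamma> s)
          \<le> L * norm ((p + (s - b) *\<^sub>R v) - (p + (r - b) *\<^sub>R v))"
        unfolding \<gamma>_def by (intro L(2)) auto
      also have "(p + (s - b) *\<^sub>R v) - (p + (r - b) *\<^sub>R v) = (s - r) *\<^sub>R v"
        by (simp add: algebra_simps)
      finally show "riemannian_dist (atlas M) h (\<gamma> r) (\<gamma> s) \<le> L * norm v * \<bar>r - s\<bar>"
        by (simp add: abs_minus_commute mult_ac)
    qed (use L(1) in simp)
  qed
qed

lemma timelike_curveI: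
  assumes "a < b" "\<gamma> ` {a..b} \<subseteq> carrier M" "complete_riemannian_metric (atlas M) h"
    and "\<And>r s. r \<in> {a..b} \<Longrightarrow> s \<in> {a..b} \<Longrightarrow>
      riemannian_dist (atlas M) h (\<gamma> r) (\<gamma> s) \<le> L * \<bar>r - s\<bar>"
    and "ae_velocity M \<gamma> a b (future_timelike M)" "\<epsilon> > 0"
    and "ae_velocity M \<gamma> a b (\<lambda>c x v. bilin (gmetric M c x) v v < - \<epsilon>)"
  shows "timelike_curve M \<gamma> a b"
  unfolding timelike_curve_def
proof (intro conjI assms(1,2,5))
  show "\<exists>h. complete_riemannian_metric (atlas M) h \<and> (\<exists>L. \<forall>r\<in>{a..b}. \<forall>s\<in>{a..b}.
      riemannian_dist (atlas M) h (\<gamma> r) (\<gamma> s) \<le> L * \<bar>r - s\<bar>)"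
    by (intro exI[of _ h] exI[of _ L] conjI ballI assms(3,4))
  show "\<exists>\<epsilon>>0. ae_velocity M \<gamma> a b (\<lambda>c x v. bilin (gmetric M c x) v v < - \<epsilon>)"
    by (intro exI[of _ \<epsilon>] conjI assms(6,7))
qed

lemma chronological_futureI:
  "timelike_curve M \<gamma> a b \<Longrightarrow> \<gamma> a = q \<Longrightarrow> \<gamma> b = x \<Longrightarrow> x \<in> chronological_future M q"
  unfolding chronological_future_def by auto

text \<open>A complete metric has to be supplied, since a timelike curve by definition refers to
  one.\<close>

lemma timelike_segment_chronological:
  fixes M :: "('p::{t2_space,second_countable_topology}, 'i::finite) spacetime"
  assumes M: "continuous_spacetime M" and c: "c \<in> atlas M" and seg: "timelike_segment M c p v \<tau>"
    and h: "complete_riemannian_metric (atlas M) h"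
  shows "cinv c (p + \<tau> *\<^sub>R v) \<in> chronological_future M (cinv c p)"
proof -
  have h': "riemannian_metric (atlas M) h" using h by (simp add: complete_riemannian_metric_def)
  have \<tau>: "\<tau> > 0" using seg by (simp add: timelike_segment_def)
  note D = timelike_segmentD[OF M c seg refl, where b = 0]
  obtain L where L: "\<And>r s. r \<in> {0..0 + \<tau>} \<Longrightarrow> s \<in> {0..0 + \<tau>} \<Longrightarrow>
      riemannian_dist (atlas M) h (cinv c (p + (r - 0) *\<^sub>R v)) (cinv c (p + (s - 0) *\<^sub>R v)) \<le> L * \<bar>r - s\<bar>"
    using D(4)[OF h'] by blast
  obtain \<epsilon> where \<epsilon>: "\<epsilon> > 0" "ae_velocity M (\<lambda>t. cinv c (p + (t - 0) *\<^sub>R v)) 0 (0 + \<tau>)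
      (\<lambda>c x v. bilin (gmetric M c x) v v < - \<epsilon>)"
    using D(3) by blast
  have "timelike_curve M (\<lambda>t. cinv c (p + (t - 0) *\<^sub>R v)) 0 (0 + \<tau>)"
    by (rule timelike_curveI[OF _ D(1) h L D(2) \<epsilon>]) (use \<tau> in auto)
  then show ?thesis by (rule chronological_futureI) auto
qed

text \<open>The derivative at \<open>t\<close> depends only on the function and on the set near
  \<open>t\<close>. This serves to glue curves with different domains.\<close>

lemma has_vector_derivative_localize:
  fixes t :: real
  assumes f: "(f has_vector_derivative v) (at t within S)" and U: "open U" "t \<in> U" "t \<in> T"
    and ST: "S \<inter> U = T \<inter> U" and fg: "\<And>s. s \<in> T \<inter> U \<Longrightarrow> f s = g s"
  shows "(g has_vector_derivative v) (at t within T)"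
proof -
  obtain e where e: "e > 0" "ball t e \<subseteq> U" using U by (meson open_contains_ball)
  have "at t within S = at t within T"
    by (rule at_within_nhd[OF U(2,1)]) (use ST in blast)
  with f have "(f has_vector_derivative v) (at t within T)" by simp
  then show ?thesis
  proof (rule has_vector_derivative_transform_within[OF _ e(1) U(3)])
    fix s assume "s \<in> T" "dist s t < e"
    then have "s \<in> ball t e" by (simp add: dist_commute)
    then show "f s = g s" using fg e(2) \<open>s \<in> T\<close> by blast
  qed
qed

text \<open>The glued curve may have a corner at \<open>b\<close>, but a single parameter is a null
  set. Elsewhere one of the two pieces describes the curve near \<open>t\<close>.\<close>

lemma ae_velocity_append:
  assumes 1: "ae_velocity M \<gamma> a b P" and 2: "ae_velocity M \<delta> b c P"
    and ab: "a \<le> b" and bc: "b \<le> c"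
  shows "ae_velocity M (\<lambda>t. if t \<le> b then \<gamma> t else \<delta> t) a c P"
proof -
  let ?\<sigma> = "\<lambda>t. if t \<le> b then \<gamma> t else \<delta> t"
  have 3: "AE t in lebesgue. t \<noteq> b"
    by (rule AE_I'[of "{b}"]) (auto simp: negligible_iff_null_sets[symmetric])
  show ?thesis
    using 1 2 3 unfolding ae_velocity_def
  proof eventually_elim
    case (elim t)
    show ?case
    proof (intro impI ballI)
      fix d assume t: "t \<in> {a..c}" and d: "d \<in> atlas M" "?\<sigma> t \<in> cdom d"
      show "\<exists>v. ((crd d \<circ> ?\<sigma>) has_vector_derivative v) (at t within {a..c}) \<and> P d (?\<sigma> t) v"
      proof (cases "t < b")
        case True
        then have "t \<in> {a..b}" "\<gamma> t \<in> cdom d" using t d(2) by auto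
        then obtain v where v: "((crd d \<circ> \<gamma>) has_vector_derivative v) (at t within {a..b})" "P d (\<gamma> t) v"
          using elim(1) d(1) by blast
        have "((crd d \<circ> ?\<sigma>) has_vector_derivative v) (at t within {a..c})"
          by (rule has_vector_derivative_localize[OF v(1), of "{..<b}"]) (use True t bc in auto)
        then show ?thesis using v(2) True by auto
      next
        case False
        then have tb: "b < t" using elim(3) by simp
        then have "t \<in> {b..c}" "\<delta> t \<in> cdom d" using t d(2) by auto
        then obtain v where v: "((crd d \<circ> \<delta>) has_vector_derivative v) (at t within {b..c})" "P d (\<delta> t) v"
          using elim(2) d(1) by blast
        have "((crd d \<circ> ?\<sigma>) has_vector_derivative v) (at t within {a..c})"
          by (rule has_vector_derivative_localize[OF v(1), of "{b<..}"]) (use tb t ab in auto)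
        then show ?thesis using v(2) tb by auto
      qed
    qed
  qed
qed

text \<open>The only global condition is the Lipschitz bound across the junction. It follows from
  the triangle inequality through \<open>\<sigma> b\<close>, as the parameter distances on the two
  sides of \<open>b\<close> add up.\<close>

lemma chronological_future_append:
  fixes M :: "('p::{t2_space,second_countable_topology}, 'i::finite) spacetime"
  assumes M: "continuous_spacetime M" and c: "c \<in> atlas M" and seg: "timelike_segment M c p v \<tau>"
    and x: "cinv c p \<in> chronological_future M q"
  shows "cinv c (p + \<tau> *\<^sub>R v) \<in> chronological_future M q"
proof -
  note A = continuous_spacetimeD(1)[OF M]
  let ?d = "\<lambda>h. riemannian_dist (atlas M) h"
  obtain \<gamma> a b where \<gamma>: "timelike_curve M \<gamma> a b" "\<gamma> a = q" "\<gamma> b = cinv c p"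
    using x unfolding chronological_future_def by fastforce
  note tc = \<gamma>(1)[unfolded timelike_curve_def]
  have ab: "a < b" and im: "\<gamma> ` {a..b} \<subseteq> carrier M"
    and fut: "ae_velocity M \<gamma> a b (future_timelike M)" using tc by auto
  obtain h L where h: "complete_riemannian_metric (atlas M) h"
    and L: "\<And>r s. r \<in> {a..b} \<Longrightarrow> s \<in> {a..b} \<Longrightarrow> ?d h (\<gamma> r) (\<gamma> s) \<le> L * \<bar>r - s\<bar>"
    using tc by blast
  have "\<exists>\<epsilon>>0. ae_velocity M \<gamma> a b (\<lambda>c x v. bilin (gmetric M c x) v v < - \<epsilon>)"
    using tc by blast
  then obtain \<epsilon> where \<epsilon>: "\<epsilon> > 0" "ae_velocity M \<gamma> a b (\<lambda>c x v. bilin (gmetric M c x) v v < - \<epsilon>)"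
    by blast
  have h': "riemannian_metric (atlas M) h" using h by (simp add: complete_riemannian_metric_def)
  have \<tau>: "\<tau> > 0" using seg by (simp add: timelike_segment_def)
  define \<delta> where "\<delta> = (\<lambda>t. cinv c (p + (t - b) *\<^sub>R v))"
  note D = timelike_segmentD[OF M c seg \<delta>_def]
  obtain L' where L': "L' \<ge> 0"
    "\<And>r s. r \<in> {b..b + \<tau>} \<Longrightarrow> s \<in> {b..b + \<tau>} \<Longrightarrow> ?d h (\<delta> r) (\<delta> s) \<le> L' * \<bar>r - s\<bar>"
    using D(4)[OF h'] by blast
  obtain \<epsilon>' where \<epsilon>': "\<epsilon>' > 0"
    "ae_velocity M \<delta> b (b + \<tau>) (\<lambda>c x v. bilin (gmetric M c x) v v < - \<epsilon>')"
    using D(3) by blast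
  define \<sigma> where "\<sigma> = (\<lambda>t. if t \<le> b then \<gamma> t else \<delta> t)"
  have \<delta>b: "\<delta> b = \<gamma> b" using \<gamma>(3) by (simp add: \<delta>_def)
  have s1: "\<sigma> t = \<gamma> t" if "t \<le> b" for t using that by (simp add: \<sigma>_def)
  have s2: "\<sigma> t = \<delta> t" if "b \<le> t" for t using that \<delta>b by (cases "t = b") (auto simp: \<sigma>_def)
  have im': "\<sigma> ` {a..b + \<tau>} \<subseteq> carrier M"
    using im D(1) by (fastforce simp: \<sigma>_def)
  have pts: "\<sigma> t \<in> points (atlas M)" if "t \<in> {a..b + \<tau>}" for t
    using im' that by (auto simp: carrier_def)
  \<comment> \<open>The constant \<open>L\<close> of the given curve comes without a sign, hence the
    absolute value.\<close>
  define B where "B = max \<bar>L\<bar> L'"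
  have d1: "?d h (\<sigma> r) (\<sigma> s) \<le> B * \<bar>r - s\<bar>" if "r \<in> {a..b}" "s \<in> {a..b}" for r s
  proof -
    have "?d h (\<sigma> r) (\<sigma> s) \<le> L * \<bar>r - s\<bar>" using L[OF that] s1 that by auto
    also have "\<dots> \<le> B * \<bar>r - s\<bar>" by (intro mult_right_mono) (auto simp: B_def)
    finally show ?thesis .
  qed
  have d2: "?d h (\<sigma> r) (\<sigma> s) \<le> B * \<bar>r - s\<bar>" if "r \<in> {b..b + \<tau>}" "s \<in> {b..b + \<tau>}" for r s
  proof -
    have "?d h (\<sigma> r) (\<sigma> s) \<le> L' * \<bar>r - s\<bar>" using L'(2)[OF that] s2 that by auto
    also have "\<dots> \<le> B * \<bar>r - s\<bar>" by (intro mult_right_mono) (auto simp: B_def)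
    finally show ?thesis .
  qed
  have tri: "?d h (\<sigma> r) (\<sigma> s) \<le> ?d h (\<sigma> r) (\<sigma> b) + ?d h (\<sigma> b) (\<sigma> s)"
    if "r \<in> {a..b + \<tau>}" "s \<in> {a..b + \<tau>}" for r s
    using that \<tau> ab by (intro riemannian_dist_triangle[OF A h' continuous_spacetimeD(2)[OF M]] pts) auto
  have lip: "?d h (\<sigma> r) (\<sigma> s) \<le> B * \<bar>r - s\<bar>" if rs: "r \<in> {a..b + \<tau>}" "s \<in> {a..b + \<tau>}" for r s
  proof -
    consider "r \<le> b" "s \<le> b" | "b \<le> r" "b \<le> s" | "r \<le> b" "b \<le> s" | "b \<le> r" "s \<le> b"
      by linarith
    then show ?thesis
    proof cases
      case 1 then show ?thesis using d1[of r s] rs by auto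
    next
      case 2 then show ?thesis using d2[of r s] rs by auto
    next
      case 3
      have "?d h (\<sigma> r) (\<sigma> s) \<le> B * \<bar>r - b\<bar> + B * \<bar>b - s\<bar>"
        using tri[OF rs] d1[of r b] d2[of b s] 3 rs ab \<tau> by auto
      also have "\<dots> = B * (\<bar>r - b\<bar> + \<bar>b - s\<bar>)" by (simp add: distrib_left)
      also have "\<bar>r - b\<bar> + \<bar>b - s\<bar> = \<bar>r - s\<bar>" using 3 by linarith
      finally show ?thesis .
    next
      case 4
      have "?d h (\<sigma> r) (\<sigma> s) \<le> B * \<bar>r - b\<bar> + B * \<bar>b - s\<bar>"
        using tri[OF rs] d2[of r b] d1[of b s] 4 rs ab \<tau> by auto
      also have "\<dots> = B * (\<bar>r - b\<bar> + \<bar>b - s\<bar>)" by (simp add: distrib_left)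
      also have "\<bar>r - b\<bar> + \<bar>b - s\<bar> = \<bar>r - s\<bar>" using 4 by linarith
      finally show ?thesis .
    qed
  qed
  \<comment> \<open>Both pieces are brought to a common margin before they are glued.\<close>
  have weak: "ae_velocity M \<eta> r s (\<lambda>c x v. bilin (gmetric M c x) v v < - min \<epsilon> \<epsilon>')"
    if "ae_velocity M \<eta> r s (\<lambda>c x v. bilin (gmetric M c x) v v < - e)" "e \<ge> min \<epsilon> \<epsilon>'" for \<eta> r s e
    using that(1) unfolding ae_velocity_def
  proof eventually_elim
    case (elim t)
    have le: "y < - min \<epsilon> \<epsilon>'" if "y < - e" for y :: real using that \<open>e \<ge> min \<epsilon> \<epsilon>'\<close> by linarith
    show ?case
    proof (intro impI ballI)
      fix d assume "t \<in> {r..s}" "d \<in> atlas M" "\<eta> t \<in> cdom d"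
      with elim obtain v where "((crd d \<circ> \<eta>) has_vector_derivative v) (at t within {r..s})"
        "bilin (gmetric M d (\<eta> t)) v v < - e" by blast
      with le show "\<exists>v. ((crd d \<circ> \<eta>) has_vector_derivative v) (at t within {r..s}) \<and>
        bilin (gmetric M d (\<eta> t)) v v < - min \<epsilon> \<epsilon>'" by (intro exI[of _ v] conjI)
    qed
  qed
  have "ae_velocity M \<sigma> a (b + \<tau>) (future_timelike M)"
    unfolding \<sigma>_def using ab \<tau> by (intro ae_velocity_append[OF fut D(2)]) auto
  moreover have "ae_velocity M \<sigma> a (b + \<tau>) (\<lambda>c x v. bilin (gmetric M c x) v v < - min \<epsilon> \<epsilon>')"
    unfolding \<sigma>_def
    using ab \<tau> by (intro ae_velocity_append[OF weak[OF \<epsilon>(2)] weak[OF \<epsilon>'(2)]]) auto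
  moreover have "min \<epsilon> \<epsilon>' > 0" using \<epsilon> \<epsilon>' by simp
  ultimately have "timelike_curve M \<sigma> a (b + \<tau>)"
    using ab \<tau> by (intro timelike_curveI[OF _ im' h lip]) auto
  then show ?thesis
    by (rule chronological_futureI) (use s1[of a] s2[of "b + \<tau>"] ab \<tau> \<gamma>(2) in \<open>auto simp: \<delta>_def\<close>)
qed

section \<open>Integral curves\<close>

text \<open>The integral operator is a contraction on the closed set of bounded continuous functions
  with values in the ball. Banach's fixed point theorem yields the solution.\<close>

lemma picard_lindelof:
  fixes F :: "'a::euclidean_space \<Rightarrow> 'a"
  assumes r: "r > 0" and L: "\<And>x y. x \<in> cball x0 r \<Longrightarrow> y \<in> cball x0 r \<Longrightarrow> norm (F x - F y) \<le> L * norm (x - y)"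
    and L0: "L \<ge> 0"
  obtains \<delta> z where "\<delta> > 0" "z 0 = x0" "\<forall>t\<in>{0..\<delta>}. z t \<in> cball x0 r"
    "\<forall>t\<in>{0..\<delta>}. (z has_vector_derivative F (z t)) (at t within {0..\<delta>})"
proof -
  have cF: "continuous_on (cball x0 r) F"
  proof (rule lipschitz_on_continuous_on)
    show "L-lipschitz_on (cball x0 r) F"
      using L L0 by (intro lipschitz_onI) (auto simp: dist_norm)
  qed
  then have "bounded (F ` cball x0 r)"
    by (intro compact_imp_bounded compact_continuous_image compact_cball)
  then obtain B where B: "B > 0" "\<And>x. x \<in> cball x0 r \<Longrightarrow> norm (F x) \<le> B"
    unfolding bounded_pos by blast
  \<comment> \<open>The bound \<open>r / B\<close> keeps the iterates in the ball, as
    \<open>B\<close> bounds the speed. The other bound gives contraction factor \<open>1/2\<close>;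
    the added 1 avoids division by zero for \<open>L = 0\<close>.\<close>
  define \<delta> where "\<delta> = min (r / B) (1 / (2 * (L + 1)))"
  have \<delta>: "\<delta> > 0" using r B L0 by (simp add: \<delta>_def)
  have \<delta>B: "B * \<delta> \<le> r" using B by (simp add: \<delta>_def min_def field_simps)
  have "L * \<delta> \<le> L * (1 / (2 * (L + 1)))" using L0 by (intro mult_left_mono) (auto simp: \<delta>_def)
  also have "\<dots> \<le> 1 / 2" using L0 by (simp add: field_simps)
  finally have \<delta>L: "L * \<delta> \<le> 1 / 2" .
  \<comment> \<open>Clamping the time to \<open>{0..\<delta>}\<close> makes every iterate a bounded
    continuous function on the whole real line, so that the complete space of all such functions can
    be used.\<close>
  define c where "c = (\<lambda>t::real. max 0 (min \<delta> t))"
  have c: "c t \<in> {0..\<delta>}" for t using \<delta> by (auto simp: c_def)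
  have ct: "c t = t" if "t \<in> {0..\<delta>}" for t using that by (auto simp: c_def)
  have cc: "continuous_on UNIV c" unfolding c_def by (intro continuous_intros)
  define S where "S = (PiC UNIV (\<lambda>_. cball x0 r) :: (real \<Rightarrow>\<^sub>C 'a) set)"
  have S: "f \<in> S \<longleftrightarrow> (\<forall>t. apply_bcontfun f t \<in> cball x0 r)" for f
    by (auto simp: S_def mem_PiC_iff)
  define P where "P = (\<lambda>(f :: real \<Rightarrow>\<^sub>C 'a) t. x0 + integral {0..c t} (\<lambda>s. F (f s)))"
  have cFf: "continuous_on T (\<lambda>s. F (apply_bcontfun f s))" if "f \<in> S" for f T
    by (rule continuous_on_compose2[OF cF]) (use that S in auto)
  have Pball: "P f t \<in> cball x0 r" if f: "f \<in> S" for f t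
  proof -
    have "norm (integral {0..c t} (\<lambda>s. F (f s))) \<le> B * (c t - 0)"
      using c[of t] B(2) f S by (intro integral_bound cFf[OF f]) auto
    also have "\<dots> \<le> B * \<delta>" using c[of t] B(1) by (intro mult_left_mono) auto
    also have "\<dots> \<le> r" by (rule \<delta>B)
    finally show ?thesis by (simp add: P_def dist_norm)
  qed
  have Pcont: "P f \<in> bcontfun" if f: "f \<in> S" for f
  proof (rule bcontfun_normI)
    have "continuous_on {0..\<delta>} (\<lambda>x. integral {0..x} (\<lambda>s. F (f s)))"
      by (intro indefinite_integral_continuous_1 integrable_continuous_interval cFf[OF f])
    then have "continuous_on UNIV (\<lambda>t. integral {0..c t} (\<lambda>s. F (f s)))"
      by (rule continuous_on_compose2[OF _ cc]) (use c in auto)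
    then show "continuous_on UNIV (P f)" unfolding P_def by (intro continuous_intros)
    show "norm (P f t) \<le> norm x0 + r" for t
    proof -
      have "norm (P f t - x0) \<le> r" using Pball[OF f, of t] by (simp add: dist_norm norm_minus_commute)
      then show ?thesis using norm_triangle_sub[of "P f t" x0] by linarith
    qed
  qed
  define T where "T = (\<lambda>f. Bcontfun (P f))"
  have T: "apply_bcontfun (T f) = P f" if "f \<in> S" for f
    using Pcont[OF that] by (simp add: T_def Bcontfun_inverse)
  have "\<exists>!f\<in>S. T f = f"
  proof (rule Banach_fix[of S "1/2"])
    show "complete S" unfolding S_def complete_eq_closed by (rule closed_PiC) auto
    have "const_bcontfun x0 \<in> S" using r by (simp add: S)
    then show "S \<noteq> {}" by blast
    show "T ` S \<subseteq> S" using T Pball by (auto simp: S)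
    fix f g assume fg: "f \<in> S" "g \<in> S"
    show "dist (T f) (T g) \<le> 1/2 * dist f g"
    proof (rule dist_bound)
      fix t
      have "P f t - P g t = integral {0..c t} (\<lambda>s. F (f s) - F (g s))"
        unfolding P_def
        by (subst Henstock_Kurzweil_Integration.integral_diff) (intro integrable_continuous_interval cFf fg | simp)+
      also have "norm \<dots> \<le> (L * dist f g) * (c t - 0)"
      proof (rule integral_bound)
        fix s
        have "norm (F (f s) - F (g s)) \<le> L * norm (f s - g s)" using fg S by (intro L) auto
        also have "\<dots> \<le> L * dist f g"
          using dist_bounded[of f s g] L0 by (intro mult_left_mono) (auto simp: dist_norm)
        finally show "norm (F (f s) - F (g s)) \<le> L * dist f g" .
      qed (use c[of t] in \<open>auto intro!: continuous_intros cFf fg\<close>)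
      also have "\<dots> \<le> (L * dist f g) * \<delta>" using c[of t] L0 by (intro mult_left_mono) auto
      also have "\<dots> = (L * \<delta>) * dist f g" by simp
      also have "\<dots> \<le> 1/2 * dist f g" using \<delta>L by (intro mult_right_mono) auto
      finally show "dist (T f t) (T g t) \<le> 1/2 * dist f g" by (simp add: T fg dist_norm)
    qed
  qed auto
  then obtain f where f: "f \<in> S" "T f = f" by blast
  define z where "z = apply_bcontfun f"
  have zP: "z t = x0 + integral {0..c t} (\<lambda>s. F (z s))" for t
    using T[OF f(1)] f(2) unfolding z_def P_def by metis
  show thesis
  proof (rule that[of \<delta> z])
    show "z 0 = x0" using zP[of 0] ct[of 0] \<delta> by simp
    show "\<forall>t\<in>{0..\<delta>}. z t \<in> cball x0 r" using f(1) by (simp add: S z_def)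
    show "\<forall>t\<in>{0..\<delta>}. (z has_vector_derivative F (z t)) (at t within {0..\<delta>})"
    proof
      fix t assume t: "t \<in> {0..\<delta>}"
      have "((\<lambda>u. x0 + integral {0..u} (\<lambda>s. F (z s))) has_vector_derivative F (z t)) (at t within {0..\<delta>})"
        using has_vector_derivative_add[OF has_vector_derivative_const
            integral_has_vector_derivative[OF cFf[OF f(1)] t]] by (simp add: z_def)
      then show "(z has_vector_derivative F (z t)) (at t within {0..\<delta>})"
        by (rule has_vector_derivative_transform[OF t, rotated]) (metis zP ct)
    qed
  qed (rule \<delta>)
qed

text \<open>Smoothness gives continuity of the derivative applied to each fixed vector. So the
  finitely many partial derivatives are bounded on the compact ball; expanding in the standard basis
  bounds the operator norm, and the mean value inequality applies on the convex ball.\<close>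

lemma smooth_on_lipschitz_cball:
  fixes F :: "real^'i::finite \<Rightarrow> 'b::real_normed_vector"
  assumes sm: "smooth_on U F" and sub: "cball x0 r \<subseteq> U"
  obtains L where "L \<ge> 0"
    "\<And>x y. x \<in> cball x0 r \<Longrightarrow> y \<in> cball x0 r \<Longrightarrow> norm (F x - F y) \<le> L * norm (x - y)"
proof -
  let ?D = "\<lambda>y. frechet_derivative F (at y)"
  have der: "(F has_derivative ?D y) (at y)" if "y \<in> U" for y
    using smooth_on_differentiable[OF sm that] frechet_derivative_works by blast
  have "\<exists>C. \<forall>y\<in>cball x0 r. norm (?D y (axis i 1)) \<le> C" for i :: 'i
  proof -
    have "bounded ((\<lambda>y. ?D y (axis i 1)) ` cball x0 r)"
      by (intro compact_imp_bounded compact_continuous_image compact_cball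
          continuous_on_subset[OF smooth_on_frechet_continuous[OF sm] sub])
    then show ?thesis unfolding bounded_iff by blast
  qed
  then obtain C where C: "\<And>i y. y \<in> cball x0 r \<Longrightarrow> norm (?D y (axis i 1)) \<le> C i" by metis
  have C0: "C i \<ge> 0" if "cball x0 r \<noteq> {}" for i
    using C norm_ge_zero order_trans that by blast
  show thesis
  proof (cases "cball x0 r = {}")
    case True
    then show ?thesis using that[of 0] by auto
  next
    case False
    show ?thesis
    proof (rule that[of "\<Sum>i\<in>UNIV. C i"])
      show "0 \<le> (\<Sum>i\<in>UNIV. C i)" by (intro sum_nonneg C0 False)
      have on: "onorm (?D y) \<le> (\<Sum>i\<in>UNIV. C i)" if y: "y \<in> cball x0 r" for y
      proof (rule onorm_le)
        fix v :: "real^'i"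
        have lin: "linear (?D y)" using der y sub has_derivative_linear by blast
        have "?D y v = ?D y (\<Sum>i\<in>UNIV. v $ i *\<^sub>R axis i 1)"
          using basis_expansion[of v] by (simp add: scalar_mult_eq_scaleR)
        also have "\<dots> = (\<Sum>i\<in>UNIV. v $ i *\<^sub>R ?D y (axis i 1))"
          by (simp add: linear_sum[OF lin] linear_scale[OF lin])
        also have "norm \<dots> \<le> (\<Sum>i\<in>UNIV. norm (v $ i *\<^sub>R ?D y (axis i 1)))" by (rule norm_sum)
        also have "\<dots> \<le> (\<Sum>i\<in>UNIV. C i * norm v)"
        proof (rule sum_mono)
          fix i :: 'i
          have "\<bar>v $ i\<bar> * norm (?D y (axis i 1)) \<le> norm v * C i"
            by (intro mult_mono component_le_norm_cart C[OF y]) auto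
          then show "norm (v $ i *\<^sub>R ?D y (axis i 1)) \<le> C i * norm v" by (simp add: mult.commute)
        qed
        finally show "norm (?D y v) \<le> (\<Sum>i\<in>UNIV. C i) * norm v" by (simp add: sum_distrib_right)
      qed
      show "norm (F x - F y) \<le> (\<Sum>i\<in>UNIV. C i) * norm (x - y)"
        if "x \<in> cball x0 r" "y \<in> cball x0 r" for x y
      proof (rule differentiable_bound[OF convex_cball _ on that])
        fix w assume "w \<in> cball x0 r"
        then have "w \<in> U" using sub by blast
        from der[OF this] show "(F has_derivative ?D w) (at w within cball x0 r)"
          by (rule has_derivative_at_withinI)
      qed
    qed
  qed
qed

text \<open>The past of \<open>x\<close> is obtained by solving the equation for \<open>- u\<close>
  forwards from \<open>x\<close> and reversing time by \<open>t \<mapsto> b - t\<close>.\<close>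

lemma integral_curve_exists:
  fixes M :: "('p::{t2_space,second_countable_topology}, 'i::finite) spacetime"
  assumes A: "smooth_manifold (atlas M)" and vf: "vector_field (atlas M) u"
    and sm: "smooth_components (atlas M) u" and x: "x \<in> carrier M"
  obtains \<delta> \<gamma> where "\<delta> > 0" "integral_curve M u \<gamma> {b - \<delta>..b}" "\<gamma> b = x"
proof -
  obtain c where c: "c \<in> atlas M" "x \<in> cdom c"
    using points_chart_at[of x "atlas M"] x by (auto simp: carrier_def)
  note ch = chart_inv[OF smooth_manifold_chart[OF A c(1)]]
  let ?F = "\<lambda>y. - (u c \<circ> cinv c) y" and ?U = "crd c ` cdom c"
  have smc: "smooth_on ?U (u c \<circ> cinv c)" using sm c(1) unfolding smooth_components_def by blast
  obtain r where r: "r > 0" "cball (crd c x) r \<subseteq> ?U"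
    using ch(7) c(2) by (meson imageI open_contains_cball)
  obtain L where L: "L \<ge> 0" "\<And>y z. y \<in> cball (crd c x) r \<Longrightarrow> z \<in> cball (crd c x) r \<Longrightarrow>
      norm ((u c \<circ> cinv c) y - (u c \<circ> cinv c) z) \<le> L * norm (y - z)"
    by (rule smooth_on_lipschitz_cball[OF smc r(2)]) blast
  have L': "norm (?F y - ?F z) \<le> L * norm (y - z)"
    if "y \<in> cball (crd c x) r" "z \<in> cball (crd c x) r" for y z
    using L(2)[OF that] by (simp add: norm_minus_commute)
  obtain \<delta> z where \<delta>: "\<delta> > 0" and z: "z 0 = crd c x" "\<forall>t\<in>{0..\<delta>}. z t \<in> cball (crd c x) r"
    "\<forall>t\<in>{0..\<delta>}. (z has_vector_derivative ?F (z t)) (at t within {0..\<delta>})"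
    by (rule picard_lindelof[OF r(1) L' L(1)])
  define y where "y = (\<lambda>t. z (b - t))"
  define \<gamma> where "\<gamma> = (\<lambda>t. cinv c (y t))"
  let ?I = "{b - \<delta>..b}"
  have yU: "y t \<in> ?U" if "t \<in> ?I" for t
  proof -
    have "z (b - t) \<in> cball (crd c x) r" using that by (intro z(2)[rule_format]) auto
    then show ?thesis using r(2) by (auto simp: y_def)
  qed
  have mc: "\<gamma> t \<in> cdom c" "crd c (\<gamma> t) = y t" if "t \<in> ?I" for t
    using ch(2,3)[OF yU[OF that]] by (auto simp: \<gamma>_def)
  have yd: "(y has_vector_derivative u c (\<gamma> t)) (at t within ?I)" if t: "t \<in> ?I" for t
  proof -
    have "((\<lambda>s. b - s) has_vector_derivative -1) (at t within ?I)"
      by (auto intro!: derivative_eq_intros)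
    moreover have "(z has_vector_derivative ?F (z (b - t))) (at (b - t) within (\<lambda>s. b - s) ` ?I)"
      by (rule has_vector_derivative_within_subset[OF z(3)[rule_format]]) (use t in auto)
    ultimately have "((z \<circ> (\<lambda>s. b - s)) has_vector_derivative (-1) *\<^sub>R ?F (z (b - t))) (at t within ?I)"
      by (rule vector_diff_chain_within)
    then show ?thesis by (simp add: o_def y_def \<gamma>_def)
  qed
  have "integral_curve M u \<gamma> ?I"
    unfolding integral_curve_def
  proof (intro conjI ballI impI)
    show "is_interval ?I" by (rule is_interval_cc)
    show "interior ?I \<noteq> {}" using \<delta> by simp
    show "\<gamma> ` ?I \<subseteq> carrier M" using mc(1) c(1) unfolding carrier_def points_def by blast
    fix t d assume t: "t \<in> ?I" and d: "d \<in> atlas M" "\<gamma> t \<in> cdom d"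
    have "((crd d \<circ> cinv c) has_derivative (\<lambda>w. jac id c d (\<gamma> t) *v w)) (at (y t))"
      using transition_has_derivative[OF A c(1) d(1) mc(1)[OF t] d(2)] mc(2)[OF t] by simp
    then have "((crd d \<circ> cinv c \<circ> y) has_vector_derivative (jac id c d (\<gamma> t) *v u c (\<gamma> t))) (at t within ?I)"
      by (rule vector_derivative_diff_chain_within[OF yd[OF t] has_derivative_at_withinI])
    moreover have "jac id c d (\<gamma> t) *v u c (\<gamma> t) = u d (\<gamma> t)"
      using vf c(1) d mc(1)[OF t] unfolding vector_field_def by (metis IntI)
    moreover have "crd d \<circ> cinv c \<circ> y = crd d \<circ> \<gamma>" by (simp add: \<gamma>_def o_def)
    ultimately show "((crd d \<circ> \<gamma>) has_vector_derivative u d (\<gamma> t)) (at t within ?I)" by simp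
  qed
  moreover have "\<gamma> b = x" using z(1) ch(1)[OF c(2)] by (simp add: \<gamma>_def y_def)
  ultimately show thesis using that \<delta> by blast
qed

text \<open>Zorn's lemma for integral curves that arrive at \<open>x\<close> at parameter
  \<open>b\<close>. They are ordered through inclusion of their graphs, which expresses extension
  and disregards the values of a curve off its domain.\<close>

lemma past_maximal_integral_curve_exists:
  fixes M :: "('p::{t2_space,second_countable_topology}, 'i::finite) spacetime"
  assumes A: "smooth_manifold (atlas M)" and vf: "vector_field (atlas M) u"
    and sm: "smooth_components (atlas M) u" and x: "x \<in> carrier M"
  obtains \<gamma> I where "past_maximal_integral_curve M u \<gamma> I" "b \<in> I" "I \<subseteq> {..b}" "\<gamma> b = x"
proof -
  define Q where "Q = (\<lambda>\<gamma> I. integral_curve M u \<gamma> I \<and> b \<in> I \<and> I \<subseteq> {..b} \<and> \<gamma> b = x)"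
  define gr where "gr = (\<lambda>(\<gamma> :: real \<Rightarrow> 'p) I. (\<lambda>t. (t, \<gamma> t)) ` I)"
  have gr: "(t, y) \<in> gr \<gamma> I \<longleftrightarrow> t \<in> I \<and> y = \<gamma> t" for t y \<gamma> I by (auto simp: gr_def)
  have "\<exists>G\<in>{gr \<gamma> I | \<gamma> I. Q \<gamma> I}. \<forall>X\<in>{gr \<gamma> I | \<gamma> I. Q \<gamma> I}. G \<subseteq> X \<longrightarrow> X = G"
  proof (rule subset_Zorn_nonempty)
    obtain \<delta> \<gamma> where "\<delta> > 0" "integral_curve M u \<gamma> {b - \<delta>..b}" "\<gamma> b = x"
      by (rule integral_curve_exists[OF assms])
    then have "Q \<gamma> {b - \<delta>..b}" by (auto simp: Q_def)
    then show "{gr \<gamma> I | \<gamma> I. Q \<gamma> I} \<noteq> {}" by blast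
  next
    fix C assume ne: "C \<noteq> {}" and chain: "subset.chain {gr \<gamma> I | \<gamma> I. Q \<gamma> I} C"
    have ex: "\<exists>\<gamma> I. g = gr \<gamma> I \<and> Q \<gamma> I" if "g \<in> C" for g
      using chain that unfolding subset_chain_def by blast
    have lin: "g \<subseteq> g' \<or> g' \<subseteq> g" if "g \<in> C" "g' \<in> C" for g g'
      using chain that unfolding subset_chain_def by blast
    have uniq: "y = y'" if ty: "(t, y) \<in> \<Union>C" "(t, y') \<in> \<Union>C" for t y y'
    proof -
      obtain g g' where "g \<in> C" "(t, y) \<in> g" "g' \<in> C" "(t, y') \<in> g'" using ty by blast
      then obtain h where "h \<in> C" "(t, y) \<in> h" "(t, y') \<in> h" using lin by blast
      then show ?thesis using ex gr by metis
    qed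
    define I where "I = fst ` \<Union>C"
    define \<gamma> where "\<gamma> = (\<lambda>t. SOME y. (t, y) \<in> \<Union>C)"
    have \<gamma>: "\<gamma> t = y" if "(t, y) \<in> \<Union>C" for t y
      unfolding \<gamma>_def using that uniq by (intro some_equality) auto
    have piece: "\<exists>\<eta> J. Q \<eta> J \<and> s \<in> J \<and> J \<subseteq> I \<and> (\<forall>t\<in>J. \<gamma> t = \<eta> t)" if s: "s \<in> I" for s
    proof -
      obtain y g where g: "g \<in> C" "(s, y) \<in> g" using s unfolding I_def by force
      then obtain \<eta> J where J: "g = gr \<eta> J" "Q \<eta> J" using ex by blast
      have mem: "(t, \<eta> t) \<in> \<Union>C" if "t \<in> J" for t using that g(1) J(1) gr by blast
      have "J \<subseteq> I" using mem unfolding I_def by force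
      moreover have "\<forall>t\<in>J. \<gamma> t = \<eta> t" using mem \<gamma> by blast
      moreover have "s \<in> J" using g(2) J(1) gr by blast
      ultimately show ?thesis using J(2) by blast
    qed
    \<comment> \<open>All pieces have the same right end \<open>b\<close>, so a piece contains every
      parameter between any of its points and \<open>b\<close>.\<close>
    have seg: "t \<in> J" if "Q \<eta> J" "s \<in> J" "s \<le> t" "t \<le> b" for \<eta> J s t
    proof -
      have "is_interval J" "b \<in> J" using that(1) unfolding Q_def integral_curve_def by auto
      then show ?thesis using that unfolding is_interval_1 by blast
    qed
    have Ib: "I \<subseteq> {..b}"
    proof
      fix s assume "s \<in> I"
      then show "s \<in> {..b}" using piece[of s] unfolding Q_def by blast
    qed
    have "I \<noteq> {}"
    proof -
      obtain g where "g \<in> C" using ne by blast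
      then obtain \<eta> J where "g = gr \<eta> J" "Q \<eta> J" using ex by blast
      then have "(b, \<eta> b) \<in> \<Union>C" using \<open>g \<in> C\<close> gr unfolding Q_def by blast
      then show ?thesis unfolding I_def by blast
    qed
    then obtain s0 where s0: "s0 \<in> I" by blast
    obtain \<eta>0 J0 where J0: "Q \<eta>0 J0" "J0 \<subseteq> I" "\<forall>t\<in>J0. \<gamma> t = \<eta>0 t" using piece[OF s0] by blast
    have bI: "b \<in> I" and \<gamma>b: "\<gamma> b = x" using J0 unfolding Q_def by auto
    have "integral_curve M u \<gamma> I"
      unfolding integral_curve_def
    proof (intro conjI ballI impI)
      show "is_interval I"
        unfolding is_interval_1
      proof (intro allI impI ballI)
        fix s s' t assume *: "s \<in> I" "s' \<in> I" "s \<le> t \<and> t \<le> s'"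
        obtain \<eta> J where J: "Q \<eta> J" "s \<in> J" "J \<subseteq> I" using piece[OF *(1)] by blast
        have "t \<le> b" using * Ib by force
        then show "t \<in> I" using seg[OF J(1,2)] * J(3) by blast
      qed
      have "interior J0 \<noteq> {}" using J0(1) by (simp add: Q_def integral_curve_def)
      then show "interior I \<noteq> {}" using interior_mono[OF J0(2)] by blast
      show "\<gamma> ` I \<subseteq> carrier M"
      proof
        fix y assume "y \<in> \<gamma> ` I"
        then obtain t where t: "t \<in> I" "y = \<gamma> t" by blast
        obtain \<eta> J where J: "Q \<eta> J" "t \<in> J" "\<forall>t\<in>J. \<gamma> t = \<eta> t" using piece[OF t(1)] by blast
        then have "\<eta> t \<in> carrier M" unfolding Q_def integral_curve_def by blast
        then show "y \<in> carrier M" using t J by simp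
      qed
      fix t d assume t: "t \<in> I" and d: "d \<in> atlas M" "\<gamma> t \<in> cdom d"
      \<comment> \<open>A piece through a parameter strictly before \<open>t\<close> coincides with
        \<open>I\<close> on a neighbourhood of \<open>t\<close>. If \<open>t\<close> is the least
        element of \<open>I\<close>, the piece through \<open>t\<close> is already all of
        \<open>I\<close>.\<close>
      obtain s where s: "s \<in> I" "s < t \<or> (s = t \<and> (\<forall>r\<in>I. t \<le> r))"
      proof (cases "\<exists>s\<in>I. s < t")
        case False
        then have "\<forall>r\<in>I. t \<le> r" by (meson not_less)
        then show ?thesis using that t by blast
      qed (use that in blast)
      obtain \<eta> J where J: "Q \<eta> J" "s \<in> J" "J \<subseteq> I" "\<forall>t\<in>J. \<gamma> t = \<eta> t" using piece[OF s(1)] by blast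
      have tJ: "t \<in> J" using seg[OF J(1,2), of t] s(2) t Ib by auto
      have up: "r \<in> J" if "r \<in> I" "s \<le> r" for r using seg[OF J(1,2) that(2)] that(1) Ib by blast
      have "((crd d \<circ> \<eta>) has_vector_derivative u d (\<eta> t)) (at t within J)"
        using J(1,4) tJ d unfolding Q_def integral_curve_def by force
      then show "((crd d \<circ> \<gamma>) has_vector_derivative u d (\<gamma> t)) (at t within I)"
        unfolding J(4)[rule_format, OF tJ]
      proof (rule has_vector_derivative_localize)
        show "open (if s < t then {s<..} else UNIV)" by simp
        show "t \<in> (if s < t then {s<..} else UNIV)" by simp
        show "J \<inter> (if s < t then {s<..} else UNIV) = I \<inter> (if s < t then {s<..} else UNIV)"
          using J(3) up s(2) by (auto split: if_splits)
        show "(crd d \<circ> \<eta>) r = (crd d \<circ> \<gamma>) r" if "r \<in> I \<inter> (if s < t then {s<..} else UNIV)" for r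
          using that up[of r] s(2) J(4) by (auto split: if_splits)
      qed (rule t)
    qed
    then have "Q \<gamma> I" using bI Ib \<gamma>b by (simp add: Q_def)
    moreover have "\<Union>C = gr \<gamma> I"
    proof (rule set_eqI)
      fix w :: "real \<times> 'p"
      obtain t y where w: "w = (t, y)" by (cases w)
      show "w \<in> \<Union>C \<longleftrightarrow> w \<in> gr \<gamma> I"
      proof
        assume "w \<in> \<Union>C"
        then show "w \<in> gr \<gamma> I" unfolding w gr I_def using \<gamma> by force
      next
        assume "w \<in> gr \<gamma> I"
        then have "t \<in> I" "y = \<gamma> t" unfolding w gr by auto
        then obtain y' where "(t, y') \<in> \<Union>C" unfolding I_def by force
        then show "w \<in> \<Union>C" using \<gamma>[of t y'] \<open>y = \<gamma> t\<close> w by simp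
      qed
    qed
    ultimately show "\<Union>C \<in> {gr \<gamma> I | \<gamma> I. Q \<gamma> I}" by blast
  qed
  then obtain G where G: "G \<in> {gr \<gamma> I | \<gamma> I. Q \<gamma> I}"
    "\<forall>X\<in>{gr \<gamma> I | \<gamma> I. Q \<gamma> I}. G \<subseteq> X \<longrightarrow> X = G" by (rule bexE)
  from G(1) obtain \<gamma> I where Q: "Q \<gamma> I" and G_eq: "G = gr \<gamma> I" by blast
  have max: "gr \<eta> J = gr \<gamma> I" if "Q \<eta> J" "gr \<gamma> I \<subseteq> gr \<eta> J" for \<eta> J
  proof -
    have "gr \<eta> J \<in> {gr \<gamma> I | \<gamma> I. Q \<gamma> I}" using that(1) by blast
    from G(2)[rule_format, OF this] that(2) show ?thesis unfolding G_eq .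
  qed
  have "past_maximal_integral_curve M u \<gamma> I"
    unfolding past_maximal_integral_curve_def
  proof (intro conjI notI)
    show "integral_curve M u \<gamma> I" using Q by (simp add: Q_def)
    assume "\<exists>\<sigma> J. integral_curve M u \<sigma> J \<and> I \<subseteq> J \<and> (\<forall>t\<in>I. \<sigma> t = \<gamma> t) \<and> (\<exists>s\<in>J. \<forall>t\<in>I. s < t)"
    then obtain \<sigma> J s where J: "integral_curve M u \<sigma> J" "I \<subseteq> J" "\<forall>t\<in>I. \<sigma> t = \<gamma> t"
      and s: "s \<in> J" "\<forall>t\<in>I. s < t" by blast
    \<comment> \<open>A competitor that reaches further into the past might also continue beyond
      \<open>b\<close>; it is cut there to become comparable in the order.\<close>
    let ?J = "J \<inter> {..b}"
    have IJ: "I \<subseteq> ?J" using J(2) Q by (auto simp: Q_def)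
    have "integral_curve M u \<sigma> ?J"
      unfolding integral_curve_def
    proof (intro conjI ballI impI)
      show "is_interval ?J" using J(1) by (auto simp: integral_curve_def is_interval_Int)
      have "interior I \<noteq> {}" using Q by (simp add: Q_def integral_curve_def)
      then show "interior ?J \<noteq> {}" using interior_mono[OF IJ] by blast
      show "\<sigma> ` ?J \<subseteq> carrier M" using J(1) by (auto simp: integral_curve_def)
      fix t d assume "t \<in> ?J" "d \<in> atlas M" "\<sigma> t \<in> cdom d"
      then have "((crd d \<circ> \<sigma>) has_vector_derivative u d (\<sigma> t)) (at t within J)"
        using J(1) unfolding integral_curve_def by blast
      then show "((crd d \<circ> \<sigma>) has_vector_derivative u d (\<sigma> t)) (at t within ?J)"
        by (rule has_vector_derivative_within_subset) blast
    qed
    then have "Q \<sigma> ?J" using Q IJ J(3) by (auto simp: Q_def)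
    moreover have "gr \<gamma> I \<subseteq> gr \<sigma> ?J"
    proof
      fix w assume "w \<in> gr \<gamma> I"
      then obtain t where "t \<in> I" "w = (t, \<gamma> t)" unfolding gr_def by blast
      then show "w \<in> gr \<sigma> ?J" using IJ J(3) gr by auto
    qed
    ultimately have "gr \<sigma> ?J = gr \<gamma> I" by (rule max)
    moreover have "(s, \<sigma> s) \<in> gr \<sigma> ?J" using s Q unfolding gr Q_def by auto
    ultimately have "s \<in> I" using gr by blast
    then show False using s(2) by blast
  qed
  then show thesis using that Q by (simp add: Q_def)
qed

section \<open>Changing coordinate maps off their domains, and continuity of integral curves\<close>

lemma Ck_on_cong:
  fixes f g :: "real^'i::finite \<Rightarrow> 'b::real_normed_vector"
  assumes "open U" "\<And>y. y \<in> U \<Longrightarrow> f y = g y" "Ck_on k U f"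
  shows "Ck_on k U g"
  using assms(2,3)
proof (induction k arbitrary: f g)
  case 0
  then show ?case by (simp cong: continuous_on_cong)
next
  case (Suc k)
  have der: "(g has_derivative frechet_derivative f (at y)) (at y)" if y: "y \<in> U" for y
  proof (rule has_derivative_transform_within_open[OF _ assms(1) y])
    show "(f has_derivative frechet_derivative f (at y)) (at y)"
      using Suc.prems(2) y frechet_derivative_works by auto
  qed (rule Suc.prems(1))
  then have eq: "frechet_derivative f (at y) = frechet_derivative g (at y)" if "y \<in> U" for y
    using frechet_derivative_at that by blast
  show ?case
    unfolding Ck_on.simps
  proof (intro conjI ballI allI)
    show "g differentiable (at y)" if "y \<in> U" for y
      using der[OF that] differentiable_def by blast
    fix v
    have "Ck_on k U (\<lambda>y. frechet_derivative f (at y) v)" using Suc.prems(2) by simp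
    then show "Ck_on k U (\<lambda>y. frechet_derivative g (at y) v)"
      by (rule Suc.IH[rotated]) (simp add: eq)
  qed
qed

lemma smooth_on_cong:
  fixes f g :: "real^'i::finite \<Rightarrow> 'b::real_normed_vector"
  assumes "open U" "\<And>y. y \<in> U \<Longrightarrow> f y = g y" "smooth_on U f"
  shows "smooth_on U g"
  unfolding smooth_on_def
proof
  fix k
  show "Ck_on k U g"
    by (rule Ck_on_cong[where f = f, OF assms(1)]) (use assms(2,3) in \<open>auto simp: smooth_on_def\<close>)
qed

lemma open_chart_image:
  assumes "is_chart c" "open W" "W \<subseteq> cdom c"
  shows "open (crd c ` W)"
proof -
  note ch = chart_inv[OF assms(1)]
  have "crd c ` W = crd c ` cdom c \<inter> cinv c -` W"
  proof (intro equalityI subsetI)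
    fix y assume "y \<in> crd c ` W"
    then show "y \<in> crd c ` cdom c \<inter> cinv c -` W" using assms(3) ch(1) by auto
  next
    fix y assume "y \<in> crd c ` cdom c \<inter> cinv c -` W"
    then show "y \<in> crd c ` W" using ch(2)[of y] by (metis IntD1 IntD2 imageI vimageD)
  qed
  then show ?thesis using continuous_open_preimage[OF ch(5,7) assms(2)] by simp
qed

text \<open>By maximality, the atlas does not care about the values of a coordinate map outside of its
  domain.\<close>

lemma modified_chart_in_atlas:
  assumes A: "smooth_manifold A" and c: "c \<in> A" and f: "\<And>x. x \<in> cdom c \<Longrightarrow> f x = crd c x"
  shows "(cdom c, f) \<in> A"
proof -
  let ?c = "(cdom c, f)"
  have cc: "is_chart c" by (rule smooth_manifold_chart[OF A c])
  have im: "f ` W = crd c ` W" if "W \<subseteq> cdom c" for W using f that by (intro image_cong) auto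
  have inv: "cinv ?c = cinv c"
  proof
    fix y
    \<comment> \<open>\<open>inv_into\<close> selects among points of the domain only, so the
      inverse does not notice the modification.\<close>
    have "(\<lambda>x. x \<in> cdom c \<and> f x = y) = (\<lambda>x. x \<in> cdom c \<and> crd c x = y)" using f by auto
    then show "cinv ?c y = cinv c y" unfolding cinv_def inv_into_def fst_conv snd_conv by simp
  qed
  have "is_chart ?c"
    using cc unfolding is_chart_def inv fst_conv snd_conv im[OF order_refl]
    by (metis (no_types, lifting) f homeomorphism_cong)
  moreover have "smoothly_compatible ?c d" if d: "d \<in> A" for d
  proof -
    have comp: "smoothly_compatible c d" by (rule smooth_manifold_compatible[OF A c d])
    note ch = chart_inv[OF smooth_manifold_chart[OF A d]]
    have op: "open (crd d ` (cdom c \<inter> cdom d))"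
      using chart_inv(6)[OF cc] ch(6)
      by (intro open_chart_image smooth_manifold_chart[OF A d]) auto
    have "smooth_on (crd d ` (cdom c \<inter> cdom d)) (f \<circ> cinv d)"
    proof (rule smooth_on_cong[OF op])
      show "smooth_on (crd d ` (cdom c \<inter> cdom d)) (crd c \<circ> cinv d)"
        using comp by (simp add: smoothly_compatible_def)
      show "(crd c \<circ> cinv d) y = (f \<circ> cinv d) y" if "y \<in> crd d ` (cdom c \<inter> cdom d)" for y
        using that f ch(1) by auto
    qed
    then show ?thesis
      using comp im[of "cdom c \<inter> cdom d"] by (simp add: smoothly_compatible_def inv)
  qed
  moreover have "cdom ?c \<subseteq> points A" using c by (auto simp: points_def)
  ultimately show ?thesis using A unfolding smooth_manifold_def by blast
qed

text \<open>Choosing a coordinate map that is far away from \<open>crd c (\<gamma> t)\<close> outside of its domain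
  forces the curve to stay in the domain for parameters close to \<open>t\<close>.\<close>

lemma integral_curve_continuous:
  fixes M :: "('p::{t2_space,second_countable_topology}, 'i::finite) spacetime"
  assumes A: "smooth_manifold (atlas M)" and \<gamma>: "integral_curve M u \<gamma> I" and t: "t \<in> I"
  shows "(\<gamma> \<longlongrightarrow> \<gamma> t) (at t within I)"
proof -
  have "\<gamma> t \<in> points (atlas M)" using \<gamma> t by (auto simp: integral_curve_def carrier_def)
  from points_chart_at[OF this] obtain c where c: "c \<in> atlas M" "\<gamma> t \<in> cdom c" by blast
  note ch = chart_inv[OF smooth_manifold_chart[OF A c(1)]]
  \<comment> \<open>A unit vector in an arbitrary direction: off the domain \<open>f\<close> is at
    distance exactly 1 from \<open>crd c (\<gamma> t)\<close>, so distance less than 1 certifies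
    membership in the domain.\<close>
  define f where "f = (\<lambda>x. if x \<in> cdom c then crd c x else crd c (\<gamma> t) + axis undefined 1)"
  have "(cdom c, f) \<in> atlas M"
    by (rule modified_chart_in_atlas[OF A c(1)]) (simp add: f_def)
  then have "((f \<circ> \<gamma>) has_vector_derivative u (cdom c, f) (\<gamma> t)) (at t within I)"
    using \<gamma> t c(2) unfolding integral_curve_def by (metis fst_conv snd_conv)
  then have "continuous (at t within I) (f \<circ> \<gamma>)" by (rule has_vector_derivative_continuous)
  then have lim: "((f \<circ> \<gamma>) \<longlongrightarrow> crd c (\<gamma> t)) (at t within I)"
    using c(2) by (simp add: continuous_within f_def)
  then have "\<forall>\<^sub>F s in at t within I. dist ((f \<circ> \<gamma>) s) (crd c (\<gamma> t)) < 1"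
    by (rule tendstoD) simp
  then have "\<forall>\<^sub>F s in at t within I. \<gamma> s \<in> cdom c"
    by (rule eventually_mono) (auto simp: f_def dist_norm norm_axis_1 split: if_splits)
  then have ev: "\<forall>\<^sub>F s in at t within I. cinv c ((f \<circ> \<gamma>) s) = \<gamma> s"
    by (rule eventually_mono) (simp add: f_def ch(1))
  have "isCont (cinv c) (crd c (\<gamma> t))"
    using ch(5,7) c(2) continuous_on_eq_continuous_at by blast
  then have "((\<lambda>s. cinv c ((f \<circ> \<gamma>) s)) \<longlongrightarrow> cinv c (crd c (\<gamma> t))) (at t within I)"
    by (rule isCont_tendsto_compose[OF _ lim])
  then show ?thesis
    using Lim_transform_eventually[OF _ ev] by (simp add: ch(1)[OF c(2)])
qed

section \<open>Lorentzian forms\<close>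

lemma tendsto_det [tendsto_intros]:
  fixes B :: "'x \<Rightarrow> real^'i^'i::finite"
  assumes "(B \<longlongrightarrow> B0) F"
  shows "((\<lambda>x. det (B x)) \<longlongrightarrow> det B0) F"
  unfolding det_def using assms by (intro tendsto_intros)

lemma tendsto_matrix_vector_mult [tendsto_intros]:
  fixes B :: "'x \<Rightarrow> real^'i^'j::finite"
  assumes "(B \<longlongrightarrow> B0) F" "(v \<longlongrightarrow> v0) F"
  shows "((\<lambda>x. B x *v v x) \<longlongrightarrow> B0 *v v0) F"
  unfolding matrix_vector_mult_def using assms by (intro tendsto_intros)

lemma matrix_inv_cancel:
  fixes A :: "real^'i^'i::finite"
  assumes "invertible A"
  shows "A ** matrix_inv A = mat 1" "matrix_inv A ** A = mat 1"
proof -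
  have "A ** matrix_inv A = mat 1 \<and> matrix_inv A ** A = mat 1"
    unfolding matrix_inv_def by (rule someI_ex) (use assms in \<open>simp add: invertible_def\<close>)
  then show "A ** matrix_inv A = mat 1" "matrix_inv A ** A = mat 1" by auto
qed

text \<open>By Cramer's rule each entry of the inverse is a quotient of determinants, and
  determinants are polynomials in the entries. The matrix \<open>?C A\<close> is \<open>A\<close>
  with column \<open>k\<close> replaced by a basis vector.\<close>

lemma tendsto_matrix_inv:
  fixes B :: "'x \<Rightarrow> real^'i^'i::finite"
  assumes B: "(B \<longlongrightarrow> B0) F" and d: "det B0 \<noteq> 0"
  shows "((\<lambda>x. matrix_inv (B x)) \<longlongrightarrow> matrix_inv B0) F"
proof (intro vec_tendstoI)
  fix k j :: 'i
  let ?C = "\<lambda>A::real^'i^'i. \<chi> i l. if l = k then (axis j 1 :: real^'i) $ i else A $ i $ l"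
  have cr: "matrix_inv A $ k $ j = det (?C A) / det A" if "det A \<noteq> 0" for A :: "real^'i^'i"
  proof -
    have "A ** matrix_inv A = mat 1"
      using that by (simp add: invertible_det_nz matrix_inv_cancel)
    then have "A *v (matrix_inv A *v axis j 1) = axis j 1"
      by (simp add: matrix_vector_mul_assoc)
    then have "matrix_inv A *v axis j 1 = (\<chi> k. det (\<chi> i l. if l = k then (axis j 1 :: real^'i) $ i else A $ i $ l) / det A)"
      using cramer[OF that] by blast
    then have "(matrix_inv A *v axis j 1) $ k = det (?C A) / det A" by simp
    then show ?thesis by (simp add: matrix_vector_mult_basis column_def)
  qed
  have "((\<lambda>x. ?C (B x)) \<longlongrightarrow> ?C B0) F"
  proof (intro vec_tendstoI)
    fix i l
    show "((\<lambda>x. ?C (B x) $ i $ l) \<longlongrightarrow> ?C B0 $ i $ l) F"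
      by (cases "l = k") (simp_all add: tendsto_vec_nth[OF tendsto_vec_nth[OF B]])
  qed
  then have "((\<lambda>x. det (?C (B x)) / det (B x)) \<longlongrightarrow> det (?C B0) / det B0) F"
    by (rule tendsto_divide[OF tendsto_det tendsto_det[OF B] d])
  moreover have "\<forall>\<^sub>F x in F. det (B x) \<noteq> 0"
    using tendsto_det[OF B] d by (rule tendsto_imp_eventually_ne)
  then have "\<forall>\<^sub>F x in F. det (?C (B x)) / det (B x) = matrix_inv (B x) $ k $ j"
    by (rule eventually_mono) (simp add: cr)
  ultimately show "((\<lambda>x. matrix_inv (B x) $ k $ j) \<longlongrightarrow> matrix_inv B0 $ k $ j) F"
    unfolding cr[OF d] by (rule Lim_transform_eventually)
qed

lemma bilin_linear:
  fixes B :: "real^'i^'i::finite"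
  shows "bilin B (v + v') w = bilin B v w + bilin B v' w"
    and "bilin B v (w + w') = bilin B v w + bilin B v w'"
    and "bilin B (v - v') w = bilin B v w - bilin B v' w"
    and "bilin B v (w - w') = bilin B v w - bilin B v w'"
    and "bilin B (a *\<^sub>R v) w = a * bilin B v w"
    and "bilin B v (a *\<^sub>R w) = a * bilin B v w"
  by (simp_all add: bilin_def inner_add_left inner_diff_left inner_add_right inner_diff_right
      matrix_vector_right_distrib matrix_vector_mult_diff_distrib matrix_vector_mult_scaleR)

lemma bilin_commute:
  fixes B :: "real^'i^'i::finite"
  assumes "transpose B = B"
  shows "bilin B v w = bilin B w v"
  unfolding bilin_def by (metis assms dot_lmul_matrix inner_commute vector_transpose_matrix)

text \<open>The form is congruent to a diagonal matrix with entries 1 and -1, and congruence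
  multiplies the determinant by a square.\<close>

lemma lorentzian_det:
  fixes B :: "real^'i^'i::finite"
  assumes "lorentzian_form B"
  shows "det B \<noteq> 0"
proof
  assume 0: "det B = 0"
  obtain P :: "real^'i^'i" and k where P: "transpose P ** B ** P = (\<chi> i j. if i = j then (if i = k then -1 else 1) else 0)"
    using assms unfolding lorentzian_form_def by blast
  let ?E = "(\<chi> i j. if i = j then (if i = k then -1 else 1) else 0) :: real^'i^'i"
  have "det ?E = (\<Prod>i\<in>UNIV. ?E $ i $ i)" by (rule det_diagonal) simp
  moreover have "(\<Prod>i\<in>UNIV. ?E $ i $ i) \<noteq> 0" by simp
  moreover have "det ?E = det (transpose P) * det B * det P" by (simp add: det_mul flip: P)
  ultimately show False using 0 by simp
qed

text \<open>In a diagonalising basis the form is nonnegative on vectors whose component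
  \<open>k\<close> vanishes. Two orthogonal timelike vectors would have a combination with vanishing
  component \<open>k\<close>, and its square would be negative.\<close>

lemma timelike_not_orthogonal:
  fixes B :: "real^'i^'i::finite"
  assumes B: "lorentzian_form B" and v: "bilin B v v < 0" and w: "bilin B w w < 0"
  shows "bilin B v w \<noteq> 0"
proof
  assume 0: "bilin B v w = 0"
  have sym: "transpose B = B" using B by (simp add: lorentzian_form_def)
  obtain P :: "real^'i^'i" and k where Pi: "invertible P" and
    P: "transpose P ** B ** P = (\<chi> i j. if i = j then (if i = k then -1 else 1) else 0)"
    using B unfolding lorentzian_form_def by blast
  define a b where "a = matrix_inv P *v v" and "b = matrix_inv P *v w"
  have vw: "v = P *v a" "w = P *v b"
    by (simp_all add: a_def b_def matrix_vector_mul_assoc matrix_inv_cancel(1)[OF Pi])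
  let ?s = "\<lambda>i. if i = k then -1 else 1 :: real"
  have diag: "bilin B (P *v x) (P *v x) = (\<Sum>i\<in>UNIV. ?s i * (x $ i)\<^sup>2)" for x
  proof -
    have "bilin B (P *v x) (P *v x) = bilin (transpose P ** B ** P) x x" by (simp add: bilin_congruence)
    also have "\<dots> = (\<Sum>i\<in>UNIV. x $ i * (\<Sum>j\<in>UNIV. (if i = j then ?s i else 0) * x $ j))"
      by (simp add: P bilin_def inner_vec_def matrix_vector_mult_def)
    also have "\<dots> = (\<Sum>i\<in>UNIV. ?s i * (x $ i)\<^sup>2)"
      by (intro sum.cong) (auto simp: if_distrib[of "\<lambda>z. z * _"] power2_eq_square cong: if_cong)
    finally show ?thesis .
  qed
  have nonneg: "bilin B (P *v x) (P *v x) \<ge> 0" if "x $ k = 0" for x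
    unfolding diag by (intro sum_nonneg) (use that in auto)
  have ak: "a $ k \<noteq> 0" using nonneg[of a] v vw by auto
  define x where "x = b $ k *\<^sub>R a - a $ k *\<^sub>R b"
  have "bilin B (P *v x) (P *v x) \<ge> 0" by (rule nonneg) (simp add: x_def)
  also have "P *v x = b $ k *\<^sub>R v - a $ k *\<^sub>R w"
    by (simp add: x_def vw matrix_vector_mult_diff_distrib matrix_vector_mult_scaleR)
  also have "bilin B \<dots> \<dots> = (b $ k)\<^sup>2 * bilin B v v + (a $ k)\<^sup>2 * bilin B w w"
    using 0 bilin_commute[OF sym, of w v] by (simp add: bilin_linear power2_eq_square)
  also have "\<dots> < 0"
  proof -
    have "(b $ k)\<^sup>2 * bilin B v v \<le> 0" using v by (intro mult_nonneg_nonpos) auto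
    moreover have "(a $ k)\<^sup>2 * bilin B w w < 0" using w ak by (intro mult_pos_neg) auto
    ultimately show ?thesis by linarith
  qed
  finally show False by simp
qed

text \<open>Up to the factor \<open>bilin B w w\<close>, the vector \<open>z\<close> is the part of
  \<open>v\<close> orthogonal to \<open>w\<close>, so it is not timelike. Expanding
  \<open>bilin B z z\<close> gives the inequality.\<close>

lemma reverse_cauchy_schwarz:
  fixes B :: "real^'i^'i::finite"
  assumes B: "lorentzian_form B" and w: "bilin B w w < 0"
  shows "bilin B v v * bilin B w w \<le> (bilin B v w)\<^sup>2"
proof -
  have sym: "bilin B w v = bilin B v w" using B bilin_commute by (auto simp: lorentzian_form_def)
  define z where "z = bilin B w w *\<^sub>R v - bilin B v w *\<^sub>R w"
  have "bilin B z w = 0" by (simp add: z_def bilin_linear)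
  then have "0 \<le> bilin B z z" using timelike_not_orthogonal[OF B _ w] by (meson not_less)
  also have "bilin B z z = bilin B w w * (bilin B v v * bilin B w w - (bilin B v w)\<^sup>2)"
    by (simp add: z_def bilin_linear sym power2_eq_square algebra_simps)
  finally show ?thesis using w by (auto simp: zero_le_mult_iff)
qed

text \<open>The trace of the equation determines the coefficient \<open>\<mu>\<close> of the metric; what remains is
  the square of the covector \<open>G U\<close>, whose sign is fixed by the time orientation \<open>T\<close>.\<close>

lemma fluid_velocity_converges:
  fixes G R :: "'x \<Rightarrow> real^'i^'i::finite" and U T :: "'x \<Rightarrow> real^'i"
  assumes lim: "(G \<longlongrightarrow> G0) F" "(R \<longlongrightarrow> R0) F" "(T \<longlongrightarrow> T0) F" "(s \<longlongrightarrow> s0) F"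
    and G0: "lorentzian_form G0" "bilin G0 T0 T0 < 0" and s0: "s0 \<noteq> 0" and F: "F \<noteq> bot"
    and ev: "\<forall>\<^sub>F x in F. lorentzian_form (G x) \<and> bilin (G x) (T x) (T x) < 0 \<and>
      bilin (G x) (U x) (U x) = -1 \<and> bilin (G x) (U x) (T x) < 0 \<and>
      (\<forall>i j. R x $ i $ j = s x * ((G x *v U x) $ i * (G x *v U x) $ j) + \<mu> x * G x $ i $ j)"
  obtains e where "(U \<longlongrightarrow> e) F" "bilin G0 e e = -1" "bilin G0 e T0 < 0"
proof -
  define tr where "tr = (\<lambda>x. \<Sum>i\<in>UNIV. \<Sum>j\<in>UNIV. matrix_inv (G x) $ j $ i * R x $ i $ j)"
  \<comment> \<open>\<open>U\<close> has square -1, so the trace of the equation is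
    \<open>tr x = - s x + \<mu> x * real CARD('i)\<close>. Thus \<open>l\<close> is
    \<open>\<mu>\<close>, expressed by convergent quantities.\<close>
  define l where "l = (\<lambda>x. (tr x + s x) / real CARD('i))"
  define l0 where "l0 = ((\<Sum>i\<in>UNIV. \<Sum>j\<in>UNIV. matrix_inv G0 $ j $ i * R0 $ i $ j) + s0) / real CARD('i)"
  \<comment> \<open>Where the equation holds, \<open>A x\<close> is the tensor square of the
    covector \<open>G x *v U x\<close>, and \<open>q x\<close> is the square of
    \<open>bilin (G x) (U x) (T x)\<close>.\<close>
  define A :: "'x \<Rightarrow> real^'i^'i" where "A = (\<lambda>x. \<chi> i j. (R x $ i $ j - l x * G x $ i $ j) / s x)"
  define q where "q = (\<lambda>x. bilin (A x) (T x) (T x))"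
  have inv: "((\<lambda>x. matrix_inv (G x)) \<longlongrightarrow> matrix_inv G0) F"
    by (rule tendsto_matrix_inv[OF lim(1) lorentzian_det[OF G0(1)]])
  have "(tr \<longlongrightarrow> (\<Sum>i\<in>UNIV. \<Sum>j\<in>UNIV. matrix_inv G0 $ j $ i * R0 $ i $ j)) F"
    unfolding tr_def by (intro tendsto_intros inv lim)
  then have l0: "(l \<longlongrightarrow> l0) F"
    unfolding l_def l0_def by (intro tendsto_intros lim) auto
  define A0 :: "real^'i^'i" where "A0 = (\<chi> i j. (R0 $ i $ j - l0 * G0 $ i $ j) / s0)"
  have A0: "(A \<longlongrightarrow> A0) F"
  proof (intro vec_tendstoI)
    fix i j
    show "((\<lambda>x. A x $ i $ j) \<longlongrightarrow> A0 $ i $ j) F"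
      unfolding A_def A0_def vec_lambda_beta by (intro tendsto_intros l0 lim s0)
  qed
  have q0: "(q \<longlongrightarrow> bilin A0 T0 T0) F"
    unfolding q_def by (intro tendsto_intros A0 lim)
  have "\<forall>\<^sub>F x in F. s x \<noteq> 0" using lim(4) s0 by (rule tendsto_imp_eventually_ne)
  \<comment> \<open>Applying the tensor square to \<open>T\<close> gives the covector of
    \<open>U\<close> times \<open>bilin (G x) (U x) (T x)\<close>. Since \<open>U\<close> is future
    directed this factor is the negative root of \<open>q\<close>, and dividing by it recovers
    \<open>U\<close>.\<close>
  with ev have ev': "\<forall>\<^sub>F x in F. - bilin (G x) (T x) (T x) \<le> q x \<and> bilin (G x) (U x) (T x) = - sqrt (q x) \<and>
      U x = (matrix_inv (G x) *v (A x *v T x)) /\<^sub>R (- sqrt (q x))"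
  proof eventually_elim
    case (elim x)
    let ?G = "G x" and ?U = "U x" and ?T = "T x" and ?l = "G x *v U x"
    define \<phi> where "\<phi> = bilin ?G ?U ?T"
    have LG: "lorentzian_form ?G" and sym: "transpose ?G = ?G" and \<phi>: "\<phi> < 0"
      using elim by (auto simp: lorentzian_form_def \<phi>_def)
    have det: "det ?G \<noteq> 0" by (rule lorentzian_det[OF LG])
    then have i1: "matrix_inv ?G ** ?G = mat 1" by (simp add: invertible_det_nz matrix_inv_cancel)
    have iU: "matrix_inv ?G *v ?l = ?U" by (simp add: matrix_vector_mul_assoc i1)
    have lT: "?l \<bullet> ?T = \<phi>"
      unfolding \<phi>_def bilin_commute[OF sym, of ?U] by (simp add: bilin_def inner_commute)
    have lU: "?l \<bullet> ?U = -1" using elim by (simp add: bilin_def inner_commute)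
    have t1: "(\<Sum>i\<in>UNIV. \<Sum>j\<in>UNIV. matrix_inv ?G $ j $ i * (?l $ i * ?l $ j)) = -1"
    proof -
      have "(\<Sum>i\<in>UNIV. \<Sum>j\<in>UNIV. matrix_inv ?G $ j $ i * (?l $ i * ?l $ j))
          = (\<Sum>j\<in>UNIV. ?l $ j * (\<Sum>i\<in>UNIV. matrix_inv ?G $ j $ i * ?l $ i))"
        by (subst sum.swap) (simp add: sum_distrib_left mult_ac)
      also have "\<dots> = ?l \<bullet> (matrix_inv ?G *v ?l)" by (simp add: inner_vec_def matrix_vector_mult_def)
      finally show ?thesis by (simp add: iU lU)
    qed
    have t2: "(\<Sum>i\<in>UNIV. \<Sum>j\<in>UNIV. matrix_inv ?G $ j $ i * ?G $ i $ j) = real CARD('i)"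
    proof -
      have "(\<Sum>i\<in>UNIV. \<Sum>j\<in>UNIV. matrix_inv ?G $ j $ i * ?G $ i $ j)
          = (\<Sum>j\<in>UNIV. (matrix_inv ?G ** ?G) $ j $ j)"
        by (subst sum.swap) (simp add: matrix_matrix_mult_def)
      then show ?thesis by (simp add: i1 mat_def)
    qed
    have R: "R x $ i $ j = s x * (?l $ i * ?l $ j) + \<mu> x * ?G $ i $ j" for i j using elim by blast
    have "tr x = s x * (\<Sum>i\<in>UNIV. \<Sum>j\<in>UNIV. matrix_inv ?G $ j $ i * (?l $ i * ?l $ j))
        + \<mu> x * (\<Sum>i\<in>UNIV. \<Sum>j\<in>UNIV. matrix_inv ?G $ j $ i * ?G $ i $ j)"
      unfolding tr_def R by (simp add: sum_distrib_left sum.distrib algebra_simps)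
    then have "tr x = - s x + \<mu> x * real CARD('i)" unfolding t1 t2 by simp
    then have "l x = \<mu> x" by (simp add: l_def)
    then have A: "A x $ i $ j = ?l $ i * ?l $ j" for i j using elim by (simp add: A_def R)
    have AT: "A x *v ?T = \<phi> *\<^sub>R ?l"
      by (simp add: vec_eq_iff matrix_vector_mult_def A lT[symmetric] inner_vec_def sum_distrib_left mult_ac)
    have q: "q x = \<phi>\<^sup>2"
      unfolding q_def bilin_def AT using lT by (simp add: inner_commute power2_eq_square)
    have sq: "- sqrt (q x) = \<phi>" using \<phi> by (simp add: q)
    have "- bilin ?G ?T ?T \<le> q x"
      using reverse_cauchy_schwarz[OF LG, of ?T ?U] elim by (simp add: q \<phi>_def)
    moreover have "(matrix_inv ?G *v (A x *v ?T)) /\<^sub>R \<phi> = ?U"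
      using \<phi> by (simp add: AT matrix_vector_mult_scaleR iU)
    ultimately show ?case using sq by (simp add: \<phi>_def)
  qed
  \<comment> \<open>The reverse Cauchy-Schwarz inequality survives in the limit. As
    \<open>T0\<close> is timelike, it keeps the divisor \<open>sqrt (q x)\<close> away from
    zero.\<close>
  have "- bilin G0 T0 T0 \<le> bilin A0 T0 T0"
  proof (rule tendsto_le[OF F q0])
    show "((\<lambda>x. - bilin (G x) (T x) (T x)) \<longlongrightarrow> - bilin G0 T0 T0) F" by (intro tendsto_intros lim)
    show "\<forall>\<^sub>F x in F. - bilin (G x) (T x) (T x) \<le> q x" using ev' by (rule eventually_mono) blast
  qed
  then have pos: "bilin A0 T0 T0 > 0" using G0(2) by linarith
  define e where "e = (matrix_inv G0 *v (A0 *v T0)) /\<^sub>R (- sqrt (bilin A0 T0 T0))"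
  have "((\<lambda>x. (matrix_inv (G x) *v (A x *v T x)) /\<^sub>R (- sqrt (q x))) \<longlongrightarrow> e) F"
    unfolding e_def using pos by (intro tendsto_intros inv A0 lim q0) auto
  moreover have "\<forall>\<^sub>F x in F. (matrix_inv (G x) *v (A x *v T x)) /\<^sub>R (- sqrt (q x)) = U x"
    using ev' by (rule eventually_mono) simp
  ultimately have U: "(U \<longlongrightarrow> e) F" by (rule Lim_transform_eventually)
  have "((\<lambda>x. bilin (G x) (U x) (U x)) \<longlongrightarrow> -1) F"
    by (rule Lim_transform_eventually[OF tendsto_const]) (use ev in \<open>auto elim: eventually_mono\<close>)
  moreover have "((\<lambda>x. bilin (G x) (U x) (U x)) \<longlongrightarrow> bilin G0 e e) F" by (intro tendsto_intros lim U)
  ultimately have ee: "bilin G0 e e = -1" using tendsto_unique[OF F] by blast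
  have "((\<lambda>x. - sqrt (q x)) \<longlongrightarrow> - sqrt (bilin A0 T0 T0)) F" by (intro tendsto_intros q0)
  moreover have "\<forall>\<^sub>F x in F. - sqrt (q x) = bilin (G x) (U x) (T x)"
    using ev' by (rule eventually_mono) (elim conjE, erule sym)
  ultimately have "((\<lambda>x. bilin (G x) (U x) (T x)) \<longlongrightarrow> - sqrt (bilin A0 T0 T0)) F"
    by (rule Lim_transform_eventually)
  moreover have "((\<lambda>x. bilin (G x) (U x) (T x)) \<longlongrightarrow> bilin G0 e T0) F" by (intro tendsto_intros lim U)
  ultimately have "bilin G0 e T0 = - sqrt (bilin A0 T0 T0)" using tendsto_unique[OF F] by blast
  then show thesis using that U ee pos by simp
qed

section \<open>Change of coordinates for tensors of perfect fluid form\<close>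

lemma bilin_axis: "bilin R (axis i 1) (axis j 1) = (R :: real^'i^'i::finite) $ i $ j"
  by (simp add: bilin_def matrix_vector_mult_basis column_def inner_axis')

lemma bilin_fluid_form:
  fixes R G :: "real^'i^'i::finite"
  assumes "\<And>i j. R $ i $ j = s * (l $ i * l $ j) + m * G $ i $ j"
  shows "bilin R v w = s * ((v \<bullet> l) * (w \<bullet> l)) + m * bilin G v w"
proof -
  have "R *v w = (s * (w \<bullet> l)) *\<^sub>R l + m *\<^sub>R (G *v w)"
    by (simp add: vec_eq_iff matrix_vector_mult_def assms inner_vec_def sum_distrib_left
        sum_distrib_right sum.distrib algebra_simps)
  then show ?thesis by (simp add: bilin_def inner_add_right algebra_simps)
qed

text \<open>Moves the field equations from a chart of \<open>M\<close> to a chart of the extension.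
  An injective \<open>J\<close> is also surjective, so it suffices to test the bilinear forms on
  vectors \<open>J *v v\<close> and \<open>J *v w\<close>.\<close>

lemma fluid_form_change:
  fixes J R G R' G' :: "real^'i^'i::finite"
  assumes J: "inj ((*v) J)" and G': "G' = transpose J ** G ** J" and R': "R' = transpose J ** R ** J"
    and eq: "\<And>i j. R' $ i $ j = s * ((G' *v u) $ i * (G' *v u) $ j) + m * G' $ i $ j"
  shows "R $ i $ j = s * ((G *v (J *v u)) $ i * (G *v (J *v u)) $ j) + m * G $ i $ j"
proof -
  let ?l = "G *v (J *v u)"
  have surj: "surj ((*v) J)" using J by (simp add: linear_injective_imp_surjective)
  have l: "G' *v u = transpose J *v ?l" by (simp add: G' matrix_vector_mul_assoc matrix_mul_assoc)
  have pull: "v \<bullet> (transpose J *v ?l) = (J *v v) \<bullet> ?l" for v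
    by (simp add: dot_lmul_matrix flip: vector_transpose_matrix)
  have on: "bilin R (J *v v) (J *v w) = s * ((J *v v) \<bullet> ?l * ((J *v w) \<bullet> ?l)) + m * bilin G (J *v v) (J *v w)" for v w
    using bilin_fluid_form[of R' s "G' *v u" m G' v w, OF eq]
    unfolding l pull unfolding R' G' bilin_congruence .
  obtain v w where vw: "J *v v = axis i 1" "J *v w = axis j 1" using surj by (metis surjD)
  show ?thesis
    using on[of v w] unfolding vw bilin_axis by (simp add: inner_axis')
qed

section \<open>The continuous extension\<close>

lemma continuous_extensionD:
  fixes M M\<^sub>e :: "('p::{t2_space,second_countable_topology}, 'i::finite) spacetime"
  assumes ext: "continuous_extension M M\<^sub>e"
    and d: "d \<in> atlas M" "x \<in> cdom d" and c: "c \<in> atlas M\<^sub>e" "x \<in> cdom c"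
  shows "inj ((*v) (jac id d c x))"
    and "gmetric M d x = transpose (jac id d c x) ** gmetric M\<^sub>e c x ** jac id d c x"
    and "((crd c \<circ> cinv d) has_derivative (\<lambda>v. jac id d c x *v v)) (at (crd d x))"
    and "future_timelike M d x v \<Longrightarrow> future_timelike M\<^sub>e c x (jac id d c x *v v)"
proof -
  have x: "x \<in> cdom d \<inter> id -` cdom c" using d c by simp
  have iso: "isometric_embedding M M\<^sub>e id" and pres: "preserves_time_orientation M M\<^sub>e id"
    using ext by (auto simp: continuous_extension_def)
  have iso': "smooth_on (crd d ` (cdom d \<inter> id -` cdom c)) (crd c \<circ> id \<circ> cinv d)"
    "\<forall>x\<in>cdom d \<inter> id -` cdom c. inj ((*v) (jac id d c x)) \<and>
       gmetric M d x = transpose (jac id d c x) ** gmetric M\<^sub>e c (id x) ** jac id d c x"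
    using iso d(1) c(1) unfolding isometric_embedding_def by blast+
  show "inj ((*v) (jac id d c x))"
    and "gmetric M d x = transpose (jac id d c x) ** gmetric M\<^sub>e c x ** jac id d c x"
    using iso'(2)[rule_format, OF x] by auto
  show "((crd c \<circ> cinv d) has_derivative (\<lambda>v. jac id d c x *v v)) (at (crd d x))"
    using jac_has_derivative[OF iso'(1), of x] d c by simp
  show "future_timelike M\<^sub>e c x (jac id d c x *v v)" if "future_timelike M d x v"
  proof -
    have "future_timelike M\<^sub>e c (id x) (jac id d c x *v v)"
      using pres d(1) c(1) x that unfolding preserves_time_orientation_def by blast
    then show ?thesis by simp
  qed
qed

text \<open>Integral curves are defined in charts of \<open>M\<close>, but limits at a boundary
  point make sense only in a chart of the extension. The pushed-forward velocity obtained here is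
  the one whose limit is studied.\<close>

lemma integral_curve_in_extension:
  fixes M M\<^sub>e :: "('p::{t2_space,second_countable_topology}, 'i::finite) spacetime"
  assumes ext: "continuous_extension M M\<^sub>e" and \<gamma>: "integral_curve M u \<gamma> I" "t \<in> I"
    and c: "c \<in> atlas M\<^sub>e" "\<gamma> t \<in> cdom c"
  defines "d \<equiv> chart_at (atlas M) (\<gamma> t)"
  shows "((crd c \<circ> \<gamma>) has_vector_derivative jac id d c (\<gamma> t) *v u d (\<gamma> t)) (at t within I)"
proof -
  have A: "smooth_manifold (atlas M)"
    using ext continuous_spacetimeD(1) by (auto simp: continuous_extension_def smooth_spacetime_def)
  have "\<gamma> t \<in> points (atlas M)" using \<gamma> by (auto simp: integral_curve_def carrier_def)
  then have d: "d \<in> atlas M" "\<gamma> t \<in> cdom d" unfolding d_def by (rule points_chart_at)+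
  have "((crd d \<circ> \<gamma>) has_vector_derivative u d (\<gamma> t)) (at t within I)"
    using \<gamma> d unfolding integral_curve_def by blast
  then show ?thesis
    by (rule curve_change_chart[OF smooth_manifold_chart[OF A d(1)] integral_curve_continuous[OF A \<gamma>]
      d(2) \<gamma>(2) continuous_extensionD(3)[OF ext d c]])
qed

lemma function_extension_tendsto:
  assumes "function_extension M q f F"
  shows "(f \<longlongrightarrow> F q) (at q within carrier M)"
proof (rule Lim_transform_eventually)
  show "(F \<longlongrightarrow> F q) (at q within carrier M)"
    using assms unfolding function_extension_def continuous_on
    by (metis insertI1 subset_insertI tendsto_within_subset)
  show "\<forall>\<^sub>F x in at q within carrier M. F x = f x"
    using assms by (simp add: function_extension_def eventually_at_topological) blast
qed

text \<open>\<open>c\<close> is the chart in which the components of the Ricci tensor extend. In it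
  the field equations have the form required by \<open>fluid_velocity_converges\<close>, with
  coefficient \<open>8 * pi * (\<rho> x + p x)\<close> of nonzero limit.\<close>

lemma fluid_velocity_limit:
  fixes M M\<^sub>e :: "('p::{t2_space,second_countable_topology}, 'i::finite) spacetime"
  assumes ext: "continuous_extension M M\<^sub>e" and q: "q \<in> boundary M M\<^sub>e"
    and fluid: "fluid_data M u \<rho> p" and ein: "einstein_perfect_fluid M u \<rho> p"
    and ricci: "tensor2_extends M M\<^sub>e q (ricci M)"
    and \<rho>: "function_extension M q \<rho> \<rho>'" and p: "function_extension M q p p'"
    and ne: "\<rho>' q + p' q \<noteq> 0"
  defines "d \<equiv> chart_at (atlas M)"
  obtains c e where "c \<in> atlas M\<^sub>e" "q \<in> cdom c"
    "((\<lambda>x. jac id (d x) c x *v u (d x) x) \<longlongrightarrow> e) (at q within carrier M)"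
    "bilin (gmetric M\<^sub>e c q) e e = -1" "bilin (gmetric M\<^sub>e c q) e (tfield M\<^sub>e c q) < 0"
proof -
  have Me: "continuous_spacetime M\<^sub>e" and A: "smooth_manifold (atlas M)"
    using ext continuous_spacetimeD(1) by (auto simp: continuous_extension_def smooth_spacetime_def)
  note D = continuous_spacetimeD[OF Me]
  obtain c F where c: "c \<in> atlas M\<^sub>e" "q \<in> cdom c"
    and F: "\<And>i j. continuous_on (insert q (cdom c \<inter> carrier M)) (\<lambda>x. (F x :: real^'i^'i) $ i $ j)"
    "\<And>d x. d \<in> atlas M \<Longrightarrow> x \<in> cdom d \<inter> cdom c \<Longrightarrow> ricci M d x = transpose (jac id d c x) ** F x ** jac id d c x"
    using ricci unfolding tensor2_extends_def by blast
  have op: "open (cdom c)" by (rule chart_inv(6)[OF smooth_manifold_chart[OF D(1) c(1)]])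
  let ?F = "at q within carrier M"
  let ?U = "\<lambda>x. jac id (d x) c x *v u (d x) x"
  have F_ne: "?F \<noteq> bot"
    using q by (auto simp: boundary_def closure_def trivial_limit_within)
  have loc: "(f \<longlongrightarrow> f q) ?F" if "continuous_on (cdom c) f" for f :: "'p \<Rightarrow> 'b::topological_space"
  proof -
    have "(f \<longlongrightarrow> f q) (at q)" using that op c(2) by (metis at_within_open continuous_on)
    then show ?thesis by (rule tendsto_within_subset) simp
  qed
  have G: "(gmetric M\<^sub>e c \<longlongrightarrow> gmetric M\<^sub>e c q) ?F" and T: "(tfield M\<^sub>e c \<longlongrightarrow> tfield M\<^sub>e c q) ?F"
    by (rule loc[OF D(5)[OF c(1)]], rule loc[OF D(6)[OF c(1)]])
  have R: "(F \<longlongrightarrow> F q) ?F"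
  proof (intro vec_tendstoI)
    fix i j
    have "((\<lambda>x. F x $ i $ j) \<longlongrightarrow> F q $ i $ j) (at q within insert q (cdom c \<inter> carrier M))"
      using F(1)[of i j] unfolding continuous_on by blast
    then have "((\<lambda>x. F x $ i $ j) \<longlongrightarrow> F q $ i $ j) (at q within cdom c \<inter> carrier M)"
      by (rule tendsto_within_subset) blast
    moreover have "at q within cdom c \<inter> carrier M = ?F"
      by (rule at_within_nhd[OF c(2) op]) blast
    ultimately show "((\<lambda>x. F x $ i $ j) \<longlongrightarrow> F q $ i $ j) ?F" by simp
  qed
  have s: "((\<lambda>x. 8 * pi * (\<rho> x + p x)) \<longlongrightarrow> 8 * pi * (\<rho>' q + p' q)) ?F"
    by (intro tendsto_intros function_extension_tendsto \<rho> p)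
  \<comment> \<open>Everything proportional to the metric is collected here, including the scalar
    curvature; its behaviour at \<open>q\<close> comes out of the trace.\<close>
  let ?\<mu> = "\<lambda>x. 1/2 * scalar_curvature M (d x) x + 8 * pi * p x"
  have ev: "lorentzian_form (gmetric M\<^sub>e c x) \<and> bilin (gmetric M\<^sub>e c x) (tfield M\<^sub>e c x) (tfield M\<^sub>e c x) < 0 \<and>
      bilin (gmetric M\<^sub>e c x) (?U x) (?U x) = -1 \<and> bilin (gmetric M\<^sub>e c x) (?U x) (tfield M\<^sub>e c x) < 0 \<and>
      (\<forall>i j. F x $ i $ j = 8 * pi * (\<rho> x + p x) *
        ((gmetric M\<^sub>e c x *v ?U x) $ i * (gmetric M\<^sub>e c x *v ?U x) $ j) + ?\<mu> x * gmetric M\<^sub>e c x $ i $ j)"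
    if x: "x \<in> carrier M" "x \<in> cdom c" for x
  proof -
    have "x \<in> points (atlas M)" using x(1) by (simp add: carrier_def)
    then have d: "d x \<in> atlas M" "x \<in> cdom (d x)" unfolding d_def by (rule points_chart_at)+
    note E = continuous_extensionD[OF ext d c(1) x(2)]
    have u: "future_timelike M (d x) x (u (d x) x)"
      "bilin (gmetric M (d x) x) (u (d x) x) (u (d x) x) = -1"
      using fluid d unfolding fluid_data_def by blast+
    have "ricci M (d x) x $ i $ j = 8 * pi * (\<rho> x + p x) * ((gmetric M (d x) x *v u (d x) x) $ i *
        (gmetric M (d x) x *v u (d x) x) $ j) + ?\<mu> x * gmetric M (d x) x $ i $ j" for i j
    proof -
      have "ricci M (d x) x $ i $ j - 1/2 * scalar_curvature M (d x) x * gmetric M (d x) x $ i $ j =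
        8 * pi * ((\<rho> x + p x) * (lower_index M u (d x) x $ i * lower_index M u (d x) x $ j)
                  + p x * gmetric M (d x) x $ i $ j)"
        using ein d unfolding einstein_perfect_fluid_def by blast
      then show ?thesis unfolding lower_index_def by (simp add: algebra_simps)
    qed
    note fluid_form_change[OF E(1,2) F(2)[OF d(1)] this]
    then show ?thesis
      using D(7,8)[OF c(1) x(2)] E(4)[OF u(1)] u(2) d(2) x(2)
      unfolding E(2) bilin_congruence future_timelike_def by simp
  qed
  have "\<forall>\<^sub>F x in ?F. x \<in> carrier M \<and> x \<in> cdom c"
    using op c(2) unfolding eventually_at_topological by blast
  then have ev: "\<forall>\<^sub>F x in ?F. lorentzian_form (gmetric M\<^sub>e c x) \<and> bilin (gmetric M\<^sub>e c x) (tfield M\<^sub>e c x) (tfield M\<^sub>e c x) < 0 \<and>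
      bilin (gmetric M\<^sub>e c x) (?U x) (?U x) = -1 \<and> bilin (gmetric M\<^sub>e c x) (?U x) (tfield M\<^sub>e c x) < 0 \<and>
      (\<forall>i j. F x $ i $ j = 8 * pi * (\<rho> x + p x) *
        ((gmetric M\<^sub>e c x *v ?U x) $ i * (gmetric M\<^sub>e c x *v ?U x) $ j) + ?\<mu> x * gmetric M\<^sub>e c x $ i $ j)"
    by (rule eventually_mono) (elim conjE, rule ev)
  have s0: "8 * pi * (\<rho>' q + p' q) \<noteq> 0" using ne by simp
  show thesis
    by (rule fluid_velocity_converges[OF G R T s D(7)[OF c] D(8)[OF c] s0 F_ne ev]) (rule that[OF c])
qed

section \<open>Coordinate estimates near the boundary point\<close>

lemma curve_deviation_bound:
  fixes y :: "real \<Rightarrow> 'a::real_normed_vector"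
  assumes y: "\<And>t. t \<in> {a..b} \<Longrightarrow> (y has_vector_derivative V t) (at t within {a..b})"
    and V: "\<And>t. t \<in> {a..b} \<Longrightarrow> norm (V t - e) \<le> k" and ab: "a \<le> b"
  shows "norm (y b - y a - (b - a) *\<^sub>R e) \<le> k * (b - a)"
proof -
  \<comment> \<open>Mean value inequality for the difference between \<open>y\<close> and uniform
    motion with velocity \<open>e\<close>.\<close>
  have "norm ((\<lambda>t. y t - t *\<^sub>R e) b - (\<lambda>t. y t - t *\<^sub>R e) a) \<le> k * norm (b - a)"
  proof (rule differentiable_bound[of "{a..b}"])
    fix t assume t: "t \<in> {a..b}"
    have "((\<lambda>t. y t - t *\<^sub>R e) has_vector_derivative (V t - e)) (at t within {a..b})"
      using y[OF t] by (auto intro!: derivative_eq_intros)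
    then show "((\<lambda>t. y t - t *\<^sub>R e) has_derivative (\<lambda>h. h *\<^sub>R (V t - e))) (at t within {a..b})"
      by (simp add: has_vector_derivative_def)
    show "onorm (\<lambda>h. h *\<^sub>R (V t - e)) \<le> k"
      using V[OF t] by (intro onorm_le) (simp add: mult.commute[of k] mult_left_mono)
  qed (use ab in auto)
  then show ?thesis using ab by (simp add: algebra_simps)
qed

text \<open>Both inequalities are open conditions on a pair of point and vector, and they hold at
  \<open>(crd c q, e)\<close>, so they hold on a product neighbourhood. The bound
  \<open>-1/2\<close> is one choice above -1; it provides the uniform margin for
  \<open>timelike_segment\<close>.\<close>

lemma uniform_timelike_cone:
  fixes M\<^sub>e :: "('p::{t2_space,second_countable_topology}, 'i::finite) spacetime"
  assumes Me: "continuous_spacetime M\<^sub>e" and c: "c \<in> atlas M\<^sub>e" "q \<in> cdom c"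
    and e: "bilin (gmetric M\<^sub>e c q) e e = -1" "bilin (gmetric M\<^sub>e c q) e (tfield M\<^sub>e c q) < 0"
  obtains r k where "r > 0" "k > 0" "ball (crd c q) r \<subseteq> crd c ` cdom c"
    "\<And>y v. y \<in> ball (crd c q) r \<Longrightarrow> norm (v - e) \<le> k \<Longrightarrow>
      future_timelike M\<^sub>e c (cinv c y) v \<and> bilin (gmetric M\<^sub>e c (cinv c y)) v v < - (1/2)"
proof -
  note D = continuous_spacetimeD[OF Me]
  note ch = chart_inv[OF smooth_manifold_chart[OF D(1) c(1)]]
  let ?W = "crd c ` cdom c" and ?g = "\<lambda>z. gmetric M\<^sub>e c (cinv c (fst z))"
  let ?f1 = "\<lambda>z. bilin (?g z) (snd z) (snd z)"
  let ?f2 = "\<lambda>z. bilin (?g z) (snd z) (tfield M\<^sub>e c (cinv c (fst z)))"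
  have ci: "continuous_on (?W \<times> UNIV) (\<lambda>z. cinv c (fst z))"
    by (rule continuous_on_compose2[OF ch(5) continuous_on_fst]) (auto intro: continuous_on_id)
  have cg: "continuous_on (?W \<times> UNIV) ?g" and ct: "continuous_on (?W \<times> UNIV) (\<lambda>z. tfield M\<^sub>e c (cinv c (fst z)))"
    using ch(3) by (auto intro!: continuous_on_compose2[OF D(5)[OF c(1)] ci] continuous_on_compose2[OF D(6)[OF c(1)] ci])
  have cs: "continuous_on (?W \<times> UNIV) snd" by (intro continuous_intros)
  have opW: "open (?W \<times> (UNIV :: (real^'i) set))" using ch(7) by (rule open_Times) simp
  let ?N = "((?W \<times> UNIV) \<inter> ?f1 -` {..< - (1/2)}) \<inter> ((?W \<times> UNIV) \<inter> ?f2 -` {..<0})"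
  have "open ?N"
    by (intro open_Int continuous_open_preimage opW continuous_on_bilin cg ct cs) auto
  moreover have "(crd c q, e) \<in> ?N" using c(2) ch(1) e by auto
  ultimately obtain S T where ST: "open S" "open T" "crd c q \<in> S" "e \<in> T" "S \<times> T \<subseteq> ?N"
    by (auto elim!: open_prod_elim)
  obtain r where r: "r > 0" "ball (crd c q) r \<subseteq> S" using ST by (meson open_contains_ball)
  obtain k where k: "k > 0" "cball e k \<subseteq> T" using ST by (meson open_contains_cball)
  show thesis
  proof (rule that[OF r(1) k(1)])
    show "ball (crd c q) r \<subseteq> ?W" using r ST(4,5) by blast
    fix y v assume "y \<in> ball (crd c q) r" "norm (v - e) \<le> k"
    then have "y \<in> S" "v \<in> T" using r(2) k(2) by (auto simp: dist_norm norm_minus_commute)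
    then have "(y, v) \<in> ?N" using ST(5) by blast
    then show "future_timelike M\<^sub>e c (cinv c y) v \<and> bilin (gmetric M\<^sub>e c (cinv c y)) v v < - (1/2)"
      by (auto simp: future_timelike_def)
  qed
qed

text \<open>The exit parameter is the supremum of the parameters outside the open half ball
  \<open>N\<close>. A bound on the norm alone says nothing off the chart domain; that the exit point
  is still in the domain follows because the closed half ball \<open>K\<close> is compact, hence
  closed in the Hausdorff space.\<close>

lemma last_exit:
  fixes \<gamma> :: "real \<Rightarrow> 'p::t2_space" and c :: "('p, 'i::finite) chart"
  assumes c: "is_chart c" and r: "r > 0" "ball p r \<subseteq> crd c ` cdom c"
    and I: "is_interval I" "b \<in> I" "I \<subseteq> {..b}"
    and cont: "\<And>t. t \<in> I \<Longrightarrow> (\<gamma> \<longlongrightarrow> \<gamma> t) (at t within I)"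
    and b: "\<gamma> b \<in> cdom c" "norm (crd c (\<gamma> b) - p) < r / 2"
  shows "(\<forall>s\<in>I. \<gamma> s \<in> cdom c \<and> norm (crd c (\<gamma> s) - p) < r / 2) \<or>
    (\<exists>s\<in>I. s < b \<and> norm (crd c (\<gamma> s) - p) = r / 2 \<and>
      (\<forall>t\<in>{s..b}. \<gamma> t \<in> cdom c \<and> norm (crd c (\<gamma> t) - p) \<le> r / 2))"
proof (rule disjCI)
  note ch = chart_inv[OF c]
  define N where "N = cdom c \<inter> crd c -` ball p (r / 2)"
  have N: "x \<in> N \<longleftrightarrow> x \<in> cdom c \<and> norm (crd c x - p) < r / 2" for x
    by (auto simp: N_def dist_norm norm_minus_commute)
  have opN: "open N" unfolding N_def by (intro continuous_open_preimage ch open_ball)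
  define K where "K = cinv c ` cball p (r / 2)"
  have sub: "cball p (r / 2) \<subseteq> crd c ` cdom c"
  proof -
    have "cball p (r / 2) \<subseteq> ball p r" using r(1) by auto
    then show ?thesis using r(2) by blast
  qed
  have K: "x \<in> K \<longleftrightarrow> x \<in> cdom c \<and> norm (crd c x - p) \<le> r / 2" for x
  proof
    assume "x \<in> K"
    then obtain y where y: "y \<in> cball p (r / 2)" "x = cinv c y" by (auto simp: K_def)
    then have "y \<in> crd c ` cdom c" using sub by blast
    then show "x \<in> cdom c \<and> norm (crd c x - p) \<le> r / 2"
      using y ch(2,3) by (auto simp: dist_norm norm_minus_commute)
  next
    assume x: "x \<in> cdom c \<and> norm (crd c x - p) \<le> r / 2"
    then have "crd c x \<in> cball p (r / 2)" by (simp add: dist_norm norm_minus_commute)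
    then show "x \<in> K" unfolding K_def using x ch(1) by (metis imageI)
  qed
  have "compact K"
    unfolding K_def by (intro compact_continuous_image continuous_on_subset[OF ch(5) sub] compact_cball)
  then have clK: "closed K" by (rule compact_imp_closed)
  define B where "B = {s \<in> I. \<gamma> s \<notin> N}"
  assume "\<not> (\<exists>s\<in>I. s < b \<and> norm (crd c (\<gamma> s) - p) = r / 2 \<and>
      (\<forall>t\<in>{s..b}. \<gamma> t \<in> cdom c \<and> norm (crd c (\<gamma> t) - p) \<le> r / 2))"
  then have no: False if "s \<in> I" "s < b" "norm (crd c (\<gamma> s) - p) = r / 2" "\<forall>t\<in>{s..b}. \<gamma> t \<in> K" for s
    using that unfolding K by blast
  have "B = {}"
  proof (rule ccontr)
    assume ne: "B \<noteq> {}"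
    have bdd: "bdd_above B" using I(3) by (auto simp: B_def intro!: bdd_aboveI[of _ b])
    define s where "s = Sup B"
    have le: "t \<le> s" if "t \<in> B" for t unfolding s_def by (rule cSup_upper[OF that bdd])
    obtain t0 where t0: "t0 \<in> B" using ne by blast
    have "s \<le> b" unfolding s_def using I(3) by (intro cSup_least ne) (auto simp: B_def)
    moreover have "t0 \<in> I" using t0 by (simp add: B_def)
    ultimately have sI: "s \<in> I" using I(1,2) le[OF t0] unfolding is_interval_1 by blast
    \<comment> \<open>Otherwise continuity would keep the curve in \<open>N\<close> for parameters
      near \<open>s\<close>, and the supremum would be smaller.\<close>
    have "s \<in> B"
    proof (rule ccontr)
      assume "s \<notin> B"
      then have "\<gamma> s \<in> N" using sI by (simp add: B_def)
      then have "\<forall>\<^sub>F t in at s within I. \<gamma> t \<in> N"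
        using topological_tendstoD[OF cont[OF sI] opN] by blast
      then obtain d where d: "d > 0" "\<And>t. t \<in> I \<Longrightarrow> t \<noteq> s \<Longrightarrow> dist t s < d \<Longrightarrow> \<gamma> t \<in> N"
        unfolding eventually_at by blast
      have "t \<le> s - d" if "t \<in> B" for t
      proof (rule ccontr)
        assume "\<not> t \<le> s - d"
        then have "dist t s < d" using le[OF that] by (simp add: dist_real_def)
        moreover have "t \<noteq> s" using that \<open>s \<notin> B\<close> by blast
        ultimately have "\<gamma> t \<in> N" using d(2) that by (auto simp: B_def)
        then show False using that by (simp add: B_def)
      qed
      then have "s \<le> s - d" unfolding s_def using ne by (intro cSup_least)
      then show False using d(1) by simp
    qed
    then have sN: "\<gamma> s \<notin> N" by (simp add: B_def)
    then have sb: "s < b" using \<open>s \<le> b\<close> b N by (cases "s = b") auto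
    have seg: "t \<in> I" if "s \<le> t" "t \<le> b" for t using I(1,2) sI that unfolding is_interval_1 by blast
    have after: "\<gamma> t \<in> K" if "s < t" "t \<le> b" for t
    proof -
      have "t \<notin> B" using le[of t] that by auto
      then have "\<gamma> t \<in> N" using seg[of t] that by (simp add: B_def)
      then show ?thesis unfolding N K by auto
    qed
    have "(\<gamma> \<longlongrightarrow> \<gamma> s) (at s within {s<..<b})"
      by (rule tendsto_within_subset[OF cont[OF sI]]) (use seg in auto)
    moreover have "at s within {s<..<b} = at_right s"
      by (rule at_within_nhd[of s "{..<b}"]) (use sb in auto)
    ultimately have "(\<gamma> \<longlongrightarrow> \<gamma> s) (at_right s)" by simp
    moreover have "\<forall>\<^sub>F t in at_right s. \<gamma> t \<in> K"
      using eventually_at_right_less[of s] eventually_at_right_real[OF sb]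
      by eventually_elim (use after in auto)
    ultimately have "\<gamma> s \<in> K"
      using Lim_in_closed_set[OF clK] trivial_limit_at_right_real by blast
    moreover have "norm (crd c (\<gamma> s) - p) = r / 2"
      using \<open>\<gamma> s \<in> K\<close> sN unfolding N K by auto
    moreover have "\<forall>t\<in>{s..b}. \<gamma> t \<in> K" using \<open>\<gamma> s \<in> K\<close> after by (metis atLeastAtMost_iff le_less)
    ultimately show False using no[OF sI sb] by blast
  qed
  then show "\<forall>s\<in>I. \<gamma> s \<in> cdom c \<and> norm (crd c (\<gamma> s) - p) < r / 2"
    using N by (auto simp: B_def)
qed

text \<open>All estimates are made in the coordinates of \<open>c\<close>, where \<open>U\<close> is
  the fluid velocity. The flow line reaches \<open>x\<close> at parameter 0, so its past has
  negative parameters and elapsed times appear as \<open>- s\<close> and \<open>- a\<close>.\<close>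

lemma no_fluid_velocity_limit:
  fixes M M\<^sub>e :: "('p::{t2_space,second_countable_topology}, 'i::finite) spacetime"
  assumes dim: "CARD('i) \<ge> 2"
    and ext: "continuous_extension M M\<^sub>e" and q: "q \<in> past_boundary M M\<^sub>e"
    and future: "carrier M = chronological_future M\<^sub>e q"
    and fluid: "fluid_data M u \<rho> p"
    and endpoint: "\<And>\<gamma> I. past_maximal_integral_curve M u \<gamma> I \<Longrightarrow> has_past_endpoint \<gamma> I q"
    and c: "c \<in> atlas M\<^sub>e" "q \<in> cdom c"
    and lim: "((\<lambda>x. jac id (chart_at (atlas M) x) c x *v u (chart_at (atlas M) x) x) \<longlongrightarrow> e)
      (at q within carrier M)"
    and e: "bilin (gmetric M\<^sub>e c q) e e = -1" "bilin (gmetric M\<^sub>e c q) e (tfield M\<^sub>e c q) < 0"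
  shows False
proof -
  define U where "U = (\<lambda>x. jac id (chart_at (atlas M) x) c x *v u (chart_at (atlas M) x) x)"
  have Me: "continuous_spacetime M\<^sub>e" and A: "smooth_manifold (atlas M)"
    using ext continuous_spacetimeD(1) by (auto simp: continuous_extension_def smooth_spacetime_def)
  note A' = continuous_spacetimeD(1)[OF Me]
  note cc = smooth_manifold_chart[OF A' c(1)]
  note ch = chart_inv[OF cc]
  have qM: "q \<notin> carrier M" using q by (simp add: past_boundary_def boundary_def)
  \<comment> \<open>The curve that puts \<open>q\<close> into the past boundary brings a complete
    metric with it; the first segment from \<open>q\<close> uses it.\<close>
  obtain h where h: "complete_riemannian_metric (atlas M\<^sub>e) h"
    using q unfolding past_boundary_def timelike_curve_def by blast
  define p0 where "p0 = crd c q"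
  have cp0: "cinv c p0 = q" using ch(1)[OF c(2)] by (simp add: p0_def)
  have e0: "norm e > 0" using e(1) by (auto simp: bilin_def)
  obtain r0 k0 where r0: "r0 > 0" "ball p0 r0 \<subseteq> crd c ` cdom c" and k0: "k0 > 0"
    and cone0: "\<And>y v. y \<in> ball p0 r0 \<Longrightarrow> norm (v - e) \<le> k0 \<Longrightarrow>
      future_timelike M\<^sub>e c (cinv c y) v \<and> bilin (gmetric M\<^sub>e c (cinv c y)) v v < - (1/2)"
    unfolding p0_def by (rule uniform_timelike_cone[OF Me c e]) blast
  \<comment> \<open>The first bound keeps the cone timelike. The second makes the flow error
    \<open>k / 4\<close> at most \<open>norm e / 8\<close>, as needed to compare components along
    \<open>e\<close> if the line stays in the ball.\<close>
  define k where "k = min k0 (norm e / 2)"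
  have k: "k > 0" "k \<le> k0" "k \<le> norm e / 2" using k0 e0 by (auto simp: k_def)
  obtain S where S: "open S" "q \<in> S" "\<And>x. x \<in> S \<Longrightarrow> x \<in> carrier M \<Longrightarrow> norm (U x - e) < k / 4"
  proof -
    have "\<forall>\<^sub>F x in at q within carrier M. dist (U x) e < k / 4"
      unfolding U_def using k by (intro tendstoD[OF lim]) simp
    then obtain S where "open S" "q \<in> S" "\<forall>x\<in>S. x \<noteq> q \<longrightarrow> x \<in> carrier M \<longrightarrow> dist (U x) e < k / 4"
      unfolding eventually_at_topological by blast
    moreover have "norm (U x - e) < k / 4" if "x \<in> S" "x \<in> carrier M" for x
      using calculation(3) that qM by (cases "x = q") (auto simp: dist_norm)
    ultimately show thesis using that[of S] by blast
  qed
  have "open (crd c ` (cdom c \<inter> S))" using ch(6) S(1) by (intro open_chart_image[OF cc]) auto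
  moreover have "p0 \<in> crd c ` (cdom c \<inter> S)" using c(2) S(2) by (auto simp: p0_def)
  ultimately obtain r1 where r1: "r1 > 0" "ball p0 r1 \<subseteq> crd c ` (cdom c \<inter> S)"
    by (meson open_contains_ball)
  define r where "r = min r0 r1"
  have r: "r > 0" "ball p0 r \<subseteq> crd c ` cdom c" using r0 r1 by (auto simp: r_def)
  have cone: "future_timelike M\<^sub>e c (cinv c y) v \<and> bilin (gmetric M\<^sub>e c (cinv c y)) v v < - (1/2)"
    if "norm (y - p0) < r" "norm (v - e) \<le> k" for y v
    using that k(2) by (intro cone0) (auto simp: r_def dist_norm norm_minus_commute)
  have Ue: "norm (U x - e) \<le> k / 4" if "x \<in> carrier M" "x \<in> cdom c" "norm (crd c x - p0) < r" for x
  proof -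
    have "crd c x \<in> ball p0 r1" using that(3) by (simp add: r_def dist_norm norm_minus_commute)
    then have "crd c x \<in> crd c ` (cdom c \<inter> S)" using r1(2) by blast
    then have "x \<in> S" using ch(1) that(2) by (metis IntE imageE)
    then show ?thesis using S(3) that(1) by force
  qed
  have segI: "timelike_segment M\<^sub>e c y v \<tau>"
    if "\<tau> > 0" "norm (v - e) \<le> k" "\<And>t. t \<in> {0..\<tau>} \<Longrightarrow> norm (y + t *\<^sub>R v - p0) < r" for y v \<tau>
  proof -
    have "y + t *\<^sub>R v \<in> crd c ` cdom c" if "t \<in> {0..\<tau>}" for t
    proof -
      have "y + t *\<^sub>R v \<in> ball p0 r"
        using \<open>\<And>t. t \<in> {0..\<tau>} \<Longrightarrow> norm (y + t *\<^sub>R v - p0) < r\<close>[OF that]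
        by (simp add: dist_norm norm_minus_commute)
      then show ?thesis using r(2) by blast
    qed
    then show ?thesis
      unfolding timelike_segment_def using that cone
      by (intro conjI exI[of _ "1/2"] ballI) auto
  qed
  obtain z where z: "norm z = 1" "e \<bullet> z = 0"
  proof -
    have "2 \<le> DIM(real^'i)" using dim by simp
    then obtain z0 :: "real^'i" where "z0 \<noteq> 0" "orthogonal e z0" by (rule orthogonal_to_vector_exists)
    then show thesis using that[of "z0 /\<^sub>R norm z0"] by (simp add: orthogonal_def)
  qed
  \<comment> \<open>The sideways deviation \<open>k\<close> is four times what the flow is allowed,
    yet \<open>w\<close> still lies in the timelike cone.\<close>
  define w where "w = e + k *\<^sub>R z"
  have we: "norm (w - e) \<le> k" using k z by (simp add: w_def)
  have w0: "norm w > 0"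
  proof -
    have "w \<bullet> e = e \<bullet> e" using z by (simp add: w_def inner_add_left inner_commute[of z])
    then show ?thesis using e0 by auto
  qed
  \<comment> \<open>The starting point is to lie within \<open>r / 4\<close> of \<open>p0\<close>.
    The last factor of the other bound is the least time in which the flow, with speed at most
    \<open>norm e + k / 4\<close>, can cover the coordinate distance \<open>r / 4\<close>.\<close>
  define m where "m = min (r / 4) (3/4 * k * (r / (4 * (norm e + k / 4))))"
  have m: "m > 0" "m \<le> r / 4" "m \<le> 3/4 * k * (r / (4 * (norm e + k / 4)))"
    using r(1) k(1) e0 by (auto simp: m_def add_pos_pos)
  define t where "t = m / (2 * norm w)"
  have t: "t > 0" "t * norm w < m" using m(1) w0 by (auto simp: t_def)
  define x where "x = cinv c (p0 + t *\<^sub>R w)"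
  have nx: "norm (t *\<^sub>R w) < r / 4" using t m(2) by simp
  have x_mem: "x \<in> cdom c" "crd c x = p0 + t *\<^sub>R w"
  proof -
    have "p0 + t *\<^sub>R w \<in> ball p0 r" using nx r(1) by (simp add: dist_norm)
    then have "p0 + t *\<^sub>R w \<in> crd c ` cdom c" using r(2) by blast
    then show "x \<in> cdom c" "crd c x = p0 + t *\<^sub>R w" unfolding x_def by (auto intro: ch(2,3))
  qed
  have "timelike_segment M\<^sub>e c p0 w t"
  proof (rule segI[OF t(1) we])
    fix s assume s: "s \<in> {0..t}"
    have "norm (s *\<^sub>R w) \<le> t * norm w" using s by (simp add: mult_right_mono)
    then show "norm (p0 + s *\<^sub>R w - p0) < r" using nx t(1) r(1) by simp
  qed
  from timelike_segment_chronological[OF Me c(1) this h]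
  have xM: "x \<in> carrier M" using cp0 future by (simp add: x_def)
  have fl: "vector_field (atlas M) u" "smooth_components (atlas M) u"
    using fluid by (auto simp: fluid_data_def)
  obtain \<gamma> I where max: "past_maximal_integral_curve M u \<gamma> I" and I: "0 \<in> I" "I \<subseteq> {..0}" and \<gamma>0: "\<gamma> 0 = x"
    by (rule past_maximal_integral_curve_exists[OF A fl xM])
  then have \<gamma>: "integral_curve M u \<gamma> I" by (simp add: past_maximal_integral_curve_def)
  then have int: "is_interval I" and \<gamma>M: "\<And>s. s \<in> I \<Longrightarrow> \<gamma> s \<in> carrier M"
    by (auto simp: integral_curve_def)
  define y where "y = crd c \<circ> \<gamma>"
  have y0: "y 0 = p0 + t *\<^sub>R w" using \<gamma>0 x_mem by (simp add: y_def)
  have dev: "norm (y 0 - y s - (- s) *\<^sub>R e) \<le> k / 4 * (- s)"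
    if s: "s \<in> I" and near: "\<And>\<sigma>. \<sigma> \<in> {s..0} \<Longrightarrow> \<gamma> \<sigma> \<in> cdom c \<and> norm (y \<sigma> - p0) < r" for s
  proof -
    have sub: "{s..0} \<subseteq> I" using mem_is_interval_1_I[OF int s I(1)] by auto
    have "norm (y 0 - y s - (0 - s) *\<^sub>R e) \<le> k / 4 * (0 - s)"
    proof (rule curve_deviation_bound[where V = "\<lambda>\<sigma>. U (\<gamma> \<sigma>)"])
      fix \<sigma> assume \<sigma>: "\<sigma> \<in> {s..0}"
      have "(y has_vector_derivative U (\<gamma> \<sigma>)) (at \<sigma> within I)"
        unfolding y_def U_def using \<sigma> sub near by (intro integral_curve_in_extension[OF ext \<gamma> _ c(1)]) auto
      then show "(y has_vector_derivative U (\<gamma> \<sigma>)) (at \<sigma> within {s..0})"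
        by (rule has_vector_derivative_within_subset[OF _ sub])
      show "norm (U (\<gamma> \<sigma>) - e) \<le> k / 4"
        using near[OF \<sigma>] \<gamma>M \<sigma> sub by (intro Ue) (auto simp: y_def)
    qed (use s I(2) in auto)
    then show ?thesis by simp
  qed
  have near0: "\<gamma> 0 \<in> cdom c" "norm (crd c (\<gamma> 0) - p0) < r / 2"
    using x_mem nx r(1) by (auto simp: \<gamma>0)
  consider (stay) "\<forall>s\<in>I. \<gamma> s \<in> cdom c \<and> norm (y s - p0) < r / 2"
    | (exit) s where "s \<in> I" "s < 0" "norm (y s - p0) = r / 2"
        "\<forall>t\<in>{s..0}. \<gamma> t \<in> cdom c \<and> norm (y t - p0) \<le> r / 2"
    using last_exit[OF cc r int I integral_curve_continuous[OF A \<gamma>] near0]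
    unfolding y_def o_def by blast
  then show False
  proof cases
    case stay
    obtain a where a: "\<And>s. s \<in> I \<Longrightarrow> a < s" "\<And>s. s > a \<Longrightarrow> \<exists>t\<in>I. t < s" "(\<gamma> \<longlongrightarrow> q) (at a within I)"
      using endpoint[OF max] unfolding has_past_endpoint_def by blast
    have nb: "at a within I \<noteq> bot"
      unfolding trivial_limit_within islimpt_approachable
    proof (intro notI, elim notE, intro allI impI)
      fix d :: real assume "d > 0"
      then obtain s where "s \<in> I" "s < a + d" using a(2)[of "a + d"] by auto
      then show "\<exists>s\<in>I. s \<noteq> a \<and> dist s a < d" using a(1)[of s] by (intro bexI[of _ s]) (auto simp: dist_real_def)
    qed
    have "isCont (crd c) q" using ch(4,6) c(2) continuous_on_eq_continuous_at by blast
    then have ya: "(y \<longlongrightarrow> p0) (at a within I)"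
      unfolding y_def p0_def o_def using a(3) by (rule isCont_tendsto_compose)
    \<comment> \<open>The deviation estimate is carried to the past endpoint by letting
      \<open>s\<close> tend to \<open>a\<close>.\<close>
    have "norm (y 0 - p0 - (- a) *\<^sub>R e) \<le> k / 4 * (- a)"
    proof (rule tendsto_le[OF nb])
      show "((\<lambda>s. norm (y 0 - y s - (- s) *\<^sub>R e)) \<longlongrightarrow> norm (y 0 - p0 - (- a) *\<^sub>R e)) (at a within I)"
        by (intro tendsto_intros ya)
      show "((\<lambda>s. k / 4 * (- s)) \<longlongrightarrow> k / 4 * (- a)) (at a within I)" by (intro tendsto_intros)
      have "norm (y 0 - y s - (- s) *\<^sub>R e) \<le> k / 4 * (- s)" if "s \<in> I" for s
      proof (rule dev[OF that])
        fix \<sigma> assume "\<sigma> \<in> {s..0}"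
        then have "\<sigma> \<in> I" using mem_is_interval_1_I[OF int that I(1)] by auto
        then show "\<gamma> \<sigma> \<in> cdom c \<and> norm (y \<sigma> - p0) < r" using stay r(1) by fastforce
      qed
      then show "\<forall>\<^sub>F s in at a within I. norm (y 0 - y s - (- s) *\<^sub>R e) \<le> k / 4 * (- s)"
        by (auto simp: eventually_at_filter)
    qed
    then have le: "norm (t *\<^sub>R w + a *\<^sub>R e) \<le> k / 4 * (- a)" by (simp add: y0)
    have a0: "a < 0" using a(1) I(1) by blast
    \<comment> \<open>The component along \<open>z\<close> forces \<open>t \<le> - a / 4\<close>.
      The component along \<open>e\<close> forces \<open>t\<close> to differ from \<open>- a\<close>
      by at most \<open>- a / 8\<close>. These are incompatible for \<open>a < 0\<close>.\<close>
    have "(t *\<^sub>R w + a *\<^sub>R e) \<bullet> z = t * k"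
      using z by (simp add: w_def inner_add_left algebra_simps) (simp add: dot_square_norm)
    then have "t * k = (t *\<^sub>R w + a *\<^sub>R e) \<bullet> z" by simp
    also have "\<dots> \<le> norm (t *\<^sub>R w + a *\<^sub>R e) * norm z" by (rule norm_cauchy_schwarz)
    also have "\<dots> \<le> k / 4 * (- a)" using le z(1) by simp
    finally have "k * t \<le> k * (- a / 4)" by (simp add: mult.commute)
    then have 1: "t \<le> - a / 4" using k(1) by (rule mult_left_le_imp_le)
    have "(t *\<^sub>R w + a *\<^sub>R e) \<bullet> e = (t + a) * (norm e)\<^sup>2"
      using z by (simp add: w_def inner_add_left inner_commute[of z] dot_square_norm algebra_simps)
    then have "\<bar>(t + a) * (norm e)\<^sup>2\<bar> \<le> norm (t *\<^sub>R w + a *\<^sub>R e) * norm e"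
      by (metis Cauchy_Schwarz_ineq2)
    also have "\<dots> \<le> (k / 4 * (- a)) * norm e" using le by (intro mult_right_mono) auto
    also have "\<dots> \<le> (norm e / 8 * (- a)) * norm e"
      using k(3) a0 by (intro mult_right_mono) auto
    finally have "\<bar>t + a\<bar> * (norm e)\<^sup>2 \<le> (- a / 8) * (norm e)\<^sup>2"
      by (simp add: abs_mult power2_eq_square mult_ac)
    then have "\<bar>t + a\<bar> \<le> - a / 8" by (rule mult_right_le_imp_le) (use e0 in simp)
    then show False using 1 a0 by linarith
  next
    case (exit s)
    define \<tau> where "\<tau> = - s"
    have \<tau>: "\<tau> > 0" using exit by (simp add: \<tau>_def)
    have near: "\<gamma> \<sigma> \<in> cdom c \<and> norm (y \<sigma> - p0) < r" if "\<sigma> \<in> {s..0}" for \<sigma>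
      using exit(4) that r(1) by fastforce
    have d: "norm (y 0 - y s - \<tau> *\<^sub>R e) \<le> k / 4 * \<tau>"
      using dev[OF exit(1) near] by (simp add: \<tau>_def)
    \<comment> \<open>Velocity of the straight segment from the exit point to \<open>q\<close>,
      traversed in the time that the flow takes from the exit point to \<open>x\<close>. It differs
      from the mean flow velocity by \<open>t *\<^sub>R w\<close> divided by
      \<open>\<tau>\<close>.\<close>
    define v where "v = (p0 - y s) /\<^sub>R \<tau>"
    have \<tau>v: "\<tau> *\<^sub>R v = p0 - y s" using \<tau> by (simp add: v_def)
    \<comment> \<open>Lower bound for the travel time: the flow covers at least \<open>r / 4\<close>
      between the sphere of radius \<open>r / 2\<close> and \<open>x\<close>.\<close>
    have "r / 2 \<le> norm (y 0 - y s) + norm (t *\<^sub>R w)"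
    proof -
      have "y s - p0 = t *\<^sub>R w - (y 0 - y s)" by (simp add: y0)
      then have "norm (y s - p0) \<le> norm (t *\<^sub>R w) + norm (y 0 - y s)" by (metis norm_triangle_ineq4)
      then show ?thesis using exit(3) by simp
    qed
    also have "norm (y 0 - y s) \<le> norm (y 0 - y s - \<tau> *\<^sub>R e) + norm (\<tau> *\<^sub>R e)"
      by (metis diff_add_cancel norm_triangle_ineq)
    finally have "r / 4 \<le> (norm e + k / 4) * \<tau>" using d nx \<tau> by (simp add: algebra_simps)
    moreover have "norm e + k / 4 > 0" using e0 k(1) by linarith
    ultimately have "r / 4 / (norm e + k / 4) \<le> \<tau>"
      by (subst pos_divide_le_eq) (simp_all only: mult.commute)
    then have "r / (4 * (norm e + k / 4)) \<le> \<tau>" by simp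
    then have "3/4 * k * (r / (4 * (norm e + k / 4))) \<le> 3/4 * k * \<tau>"
      using k(1) by (intro mult_left_mono) auto
    then have tw: "norm (t *\<^sub>R w) \<le> 3/4 * k * \<tau>" using t m(3) by simp
    have "norm (p0 - y s - \<tau> *\<^sub>R e) \<le> norm (y 0 - y s - \<tau> *\<^sub>R e) + norm (t *\<^sub>R w)"
    proof -
      have "p0 - y s - \<tau> *\<^sub>R e = (y 0 - y s - \<tau> *\<^sub>R e) - t *\<^sub>R w" by (simp add: y0)
      then show ?thesis by (metis norm_triangle_ineq4)
    qed
    \<comment> \<open>\<open>k / 4\<close> is due to the flow, \<open>3/4 * k\<close> to moving the
      endpoint from \<open>x\<close> to \<open>q\<close>.\<close>
    also have "\<dots> \<le> k * \<tau>" using d tw by simp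
    finally have "norm (\<tau> *\<^sub>R (v - e)) \<le> k * \<tau>" by (simp add: \<tau>v scaleR_right_diff_distrib)
    then have ve: "norm (v - e) \<le> k" using \<tau> by (simp add: mult.commute)
    have "timelike_segment M\<^sub>e c (y s) v \<tau>"
    proof (rule segI[OF \<tau> ve])
      fix \<sigma> assume \<sigma>: "\<sigma> \<in> {0..\<tau>}"
      \<comment> \<open>The segment is radial: it shrinks from the sphere of radius
        \<open>r / 2\<close> to the centre and so stays in the ball.\<close>
      have "y s + \<sigma> *\<^sub>R v - p0 = (1 - \<sigma> / \<tau>) *\<^sub>R (y s - p0)"
        using \<tau> by (simp add: v_def algebra_simps divide_inverse)
      then have "norm (y s + \<sigma> *\<^sub>R v - p0) = \<bar>1 - \<sigma> / \<tau>\<bar> * (r / 2)" using exit(3) by simp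
      also have "\<dots> \<le> 1 * (r / 2)" using \<sigma> \<tau> r(1) by (intro mult_right_mono) (auto simp: field_simps abs_le_iff)
      finally show "norm (y s + \<sigma> *\<^sub>R v - p0) < r" using r(1) by simp
    qed
    moreover have "cinv c (y s) = \<gamma> s" using near[of s] exit(2) ch(1) by (simp add: y_def)
    then have "cinv c (y s) \<in> chronological_future M\<^sub>e q" using \<gamma>M[OF exit(1)] future by simp
    ultimately have "cinv c (y s + \<tau> *\<^sub>R v) \<in> chronological_future M\<^sub>e q"
      by (rule chronological_future_append[OF Me c(1)])
    then have "q \<in> carrier M" using cp0 future by (simp add: \<tau>v)
    then show False using qM by blast
  qed
qed

theorem theorem2p3:
  fixes M M\<^sub>e :: "('p::{t2_space,second_countable_topology}, 'i::finite) spacetime"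
    and u :: "('p, 'i) vfield"
    and \<rho> p :: "'p \<Rightarrow> real"
    and \<O> :: 'p
  assumes dim: "CARD('i) \<ge> 2"
    and ext: "continuous_extension M M\<^sub>e"
    and past: "\<O> \<in> past_boundary M M\<^sub>e"
    and future: "carrier M = chronological_future M\<^sub>e \<O>"
    and fluid: "fluid_data M u \<rho> p"
    and a: "einstein_perfect_fluid M u \<rho> p"
    and b1: "\<forall>\<gamma> I. past_maximal_integral_curve M u \<gamma> I \<longrightarrow> has_past_endpoint \<gamma> I \<O>"
    and b2: "\<forall>\<gamma> b. 0 < b \<and> integral_curve M u \<gamma> {0<..b} \<and>
               has_past_endpoint \<gamma> {0<..b} \<O> \<and> \<gamma> 0 = \<O> \<longrightarrow> timelike_curve M\<^sub>e \<gamma> 0 b"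
    and c_ricci: "tensor2_extends M M\<^sub>e \<O> (ricci M)"
    and c_rho: "\<exists>\<rho>'. function_extension M \<O> \<rho> \<rho>'"
    and c_p: "\<exists>p'. function_extension M \<O> p p'"
    and d': "\<forall>U. open U \<and> \<O> \<in> U \<and> U \<subseteq> carrier M\<^sub>e \<longrightarrow>
               (\<exists>V. open V \<and> \<O> \<in> V \<and> V \<subseteq> U \<and>
                  past_boundary M M\<^sub>e \<inter> V \<subseteq> causal_future_in M\<^sub>e \<O> V)"
  shows "\<forall>\<rho>' p'. function_extension M \<O> \<rho> \<rho>' \<and> function_extension M \<O> p p' \<longrightarrow> \<rho>' \<O> = - p' \<O>"
proof (intro allI impI, elim conjE)
  fix \<rho>' p'
  assume \<rho>': "function_extension M \<O> \<rho> \<rho>'" and p': "function_extension M \<O> p p'"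
  have bd: "\<O> \<in> boundary M M\<^sub>e" using past by (simp add: past_boundary_def)
  show "\<rho>' \<O> = - p' \<O>"
  proof (rule ccontr)
    assume "\<rho>' \<O> \<noteq> - p' \<O>"
    then have ne: "\<rho>' \<O> + p' \<O> \<noteq> 0" by (simp add: eq_neg_iff_add_eq_0)
    show False
      by (rule fluid_velocity_limit[OF ext bd fluid a c_ricci \<rho>' p' ne])
        (rule no_fluid_velocity_limit[OF dim ext past future fluid b1[rule_format]])
  qed
qed

end
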